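(* The following three identities hold: $$\sum_{k=1}^\infty \frac{\binom{3k}{k}\binom{6k}{3k}}{(6k-1)k^{3}\binom{2k}{k}^{5}} \Big( 2(74k^2-47k+8) H_{2k-1} - 34k + 11 \Big) = 36 \zeta(3),$$ $$\sum_{k=1}^\infty \frac{\binom{3k}{k}\binom{6k}{3k}}{(6k-1)k^{3}\binom{2k}{k}^{5}} \left( (74 k^2-47 k+8) (200 H_{2k-1}^{(2)} - 137 H_{k-1}^{(2)}) - \frac{168}{k} \right) = \frac{526}{15} \pi^4,$$ and $$\sum_{k=1}^\infty \frac{\binom{3k}{k}\binom{6k}{3k}}{(6k-1)k^{3}\binom{2k}{k}^{5}} \left( (74 k^2-47 k+8) ( 7H_{2k-1}^{(3)} - 3 H_{k-1}^{(3)}) + \frac{1228k^2-648k+81}{8k^2(2k-1)} \right) = 8\pi^2 \zeta(3) +60 \zeta(5).$$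
   Context: For integers $m\ge1$ and $n\ge0$, $H_n^{(m)}=\sum_{0<j\le n}\frac1{j^m}$ denotes the harmonic number of order $m$, and $H_n=H_n^{(1)}$ (so $H_0=H_0^{(m)}=0$). $\zeta$ is the Riemann zeta function. *)

theory Defs
  imports "HOL-Analysis.Analysis"
begin

definition gen_harm :: "nat \<Rightarrow> nat \<Rightarrow> real" where
  "gen_harm m n = (\<Sum>j = 1..n. 1 / real j ^ m)"

lemma gen_harm_1: "gen_harm 1 n = harm n"
  by (simp add: gen_harm_def harm_def inverse_eq_divide)

text \<open>
  The Riemann zeta function at integers \<open>s \<ge> 2\<close>, given there by its Dirichlet series
  (no meaning is intended for \<open>s < 2\<close>, where the series diverges).
\<close>
definition zeta_nat :: "nat \<Rightarrow> real" where
  "zeta_nat s = (\<Sum>n. 1 / real (Suc n) ^ s)"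

lemma zeta_nat_sums:
  assumes "s \<ge> 2"
  shows "(\<lambda>n. 1 / real (Suc n) ^ s) sums zeta_nat s"
proof -
  have "summable (\<lambda>n. inverse (real n ^ s))"
    using assms by (rule inverse_power_summable)
  then have "summable (\<lambda>n. 1 / real (Suc n) ^ s)"
    by (subst (asm) summable_Suc_iff [symmetric]) (simp add: inverse_eq_divide)
  then show ?thesis
    unfolding zeta_nat_def by (rule summable_sums)
qed

text \<open>The factor common to the three series; only used for \<open>k \<ge> 1\<close>.\<close>
definition binom_weight :: "nat \<Rightarrow> real" where
  "binom_weight k =
     real ((3 * k) choose k) * real ((6 * k) choose (3 * k)) /
     ((6 * real k - 1) * real k ^ 3 * real ((2 * k) choose k) ^ 5)"

end

theory Submission
  imports Defs "HOL-Real_Asymp.Real_Asymp"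
begin

text \<open>
  The three identities are derivatives, with respect to parameters, of one Wilf--Zeilberger
  pair.  For parameters \<open>a, b, c, d, e\<close> consider the very well-poised term
  \<open>(a + 3 k + 2 n) (b)\<^bsub>n+3k\<^esub> (c)\<^bsub>n+k\<^esub> (d)\<^bsub>n+k\<^esub> (e)\<^bsub>n+k\<^esub> (1+a-c-d)\<^bsub>k\<^esub> (1+a-c-e)\<^bsub>k\<^esub> (1+a-d-e)\<^bsub>k\<^esub>\<close>
  divided by
  \<open>(1+a-b)\<^bsub>n\<^esub> (1+a-c)\<^bsub>n+2k\<^esub> (1+a-d)\<^bsub>n+2k\<^esub> (1+a-e)\<^bsub>n+2k\<^esub> (b+c-a)\<^bsub>k\<^esub> (b+d-a)\<^bsub>k\<^esub> (b+e-a)\<^bsub>k\<^esub>\<close>,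
  which is the summand of Dougall's bilateral \<open>5H5\<close> sum after \<open>k\<close> steps of the
  parameter shift \<open>(3; 3, 1, 1, 1)\<close>.  It is the first half \<open>F\<close> of a pair with
  \<open>F n (k+1) - F n k = G n k - G (n+1) k\<close>.  At \<open>(a; b, c, d, e) = (2; 3/2, 1, 1, 1)\<close> one has
  \<open>F n 0 = 2 / (n+1)\<^sup>2\<close>, while \<open>G 0 k\<close> is a third of \<open>binom_weight (k+1)\<close> times the
  polynomial \<open>74 j\<^sup>2 - 47 j + 8\<close> at \<open>j = k + 1\<close>.  Differentiating the pair in a parameter
  direction multiplies it by harmonic numbers, up to a rational correction, and yields a pair again.

  Summing such a pair over a quadrant expresses the wanted series as
  \<open>\<Sum>k. G 0 k = lim (\<Sum>k. G n k) - (\<Sum>n. F n 0)\<close>, the limit being taken as \<open>n\<close> tends to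
  infinity; this is \<open>deformed_series\<close>.  Two things have to be known.

  The limit does not vanish.  For the base pair it is \<open>\<pi>\<^sup>2\<close> (\<open>column_mass_LIMSEQ\<close>): the base pair
  makes sense for real \<open>n\<close>, and \<open>G (-1/2) k = 0\<close>, so that on the lattice of half-integers the
  column sums are just the partial sums of \<open>\<Sum>n. 2 / (n + 1/2)\<^sup>2 = \<pi>\<^sup>2\<close>; monotonicity in \<open>n\<close>
  then transports the limit to the integers.  Moreover the \<open>n\<close>-th column lives at \<open>k\<close> of order
  at most \<open>n\<close> to the power \<open>2/3\<close> (\<open>suminf_spread_mass\<close>).  There the harmonic factor \<open>L\<close> of a deformed pair
  is close to a constant \<open>l\<close>, and the limit for the deformed pair is \<open>l \<pi>\<^sup>2\<close>.

  The sums \<open>\<Sum>n. F n 0\<close> are Euler sums of weights 3, 4 and 5.  All of them come from rearranging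
  double series with positive terms along antidiagonals (\<open>antidiagonal_sums\<close>) and splitting the
  terms into partial fractions.

  Put \<open>c = 1 + \<gamma>\<^sub>1\<close>, \<open>d = 1 + \<gamma>\<^sub>2\<close>, \<open>e = 1 + \<gamma>\<^sub>3\<close> and let \<open>e\<^sub>1, e\<^sub>2, e\<^sub>3\<close> be the elementary symmetric
  functions of the \<open>\<gamma>\<^sub>i\<close>.  The derivative in \<open>e\<^sub>3\<close> gives the third identity (\<open>series_dlog_e3\<close>).
  The first one comes from the derivative in \<open>e\<^sub>1\<close> minus the one in the direction \<open>(1; 0, 1, 1, 1)\<close>,
  whose harmonic factor vanishes at \<open>n = 0\<close> and makes \<open>L\<close> converge on the bulk of the columns
  (\<open>series_dlog_e1\<close>).  The second one combines the derivative in \<open>e\<^sub>2\<close>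
  (\<open>series_dlog_e2\<close>), which produces \<open>3 H - 5 H'\<close> with \<open>H\<close> and \<open>H'\<close> the harmonic numbers of order 2
  at \<open>k\<close> and \<open>2 k + 1\<close>, and the mixed second derivative in \<open>n\<close> and in the direction
  \<open>(1; 0, 1, 1, 1)\<close> (\<open>series_shift\<close>), which produces \<open>- 3 H\<close> alone.
\<close>

section \<open>Harmonic sums over integers and half-integers\<close>

definition half_harm :: "nat \<Rightarrow> nat \<Rightarrow> real" where
  "half_harm m n = (\<Sum>j = 1..n. 1 / (real j - 1 / 2) ^ m)"

lemma gen_harm_0 [simp]: "gen_harm m 0 = 0"
  by (simp add: gen_harm_def)

lemma gen_harm_Suc [simp]: "gen_harm m (Suc n) = gen_harm m n + 1 / (real n + 1) ^ m"
  by (simp add: gen_harm_def add.commute)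

lemma half_harm_0 [simp]: "half_harm m 0 = 0"
  by (simp add: half_harm_def)

lemma half_harm_Suc [simp]: "half_harm m (Suc n) = half_harm m n + 1 / (real n + 1 / 2) ^ m"
  by (simp add: half_harm_def algebra_simps)

lemma gen_harm_nonneg: "gen_harm m n \<ge> 0"
  by (simp add: gen_harm_def sum_nonneg)

lemma half_harm_nonneg: "half_harm m n \<ge> 0"
  unfolding half_harm_def by (intro sum_nonneg divide_nonneg_nonneg zero_le_power) auto

lemma gen_harm_conv_lessThan: "gen_harm m n = (\<Sum>i<n. 1 / (real i + 1) ^ m)"
  by (induction n) auto

lemma half_harm_conv_lessThan: "half_harm m n = (\<Sum>i<n. 1 / (real i + 1 / 2) ^ m)"
  by (induction n) auto

text \<open>
  The first \<open>n\<close> half-integers are the odd multiples of \<open>1/2\<close> among the first \<open>2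
  n\<close> ones.
\<close>
lemma half_harm_eq: "half_harm m n = 2 ^ m * gen_harm m (2 * n) - gen_harm m n"
proof (induction n)
  case (Suc n)
  have "1 / (real n + 1 / 2) ^ m = 2 ^ m / (2 * real n + 1) ^ m"
    by (simp add: divide_simps flip: power_mult_distrib)
  moreover have "2 ^ m / (2 * real n + 2) ^ m = 1 / (real n + 1) ^ m"
    by (simp add: divide_simps flip: power_mult_distrib)
  ultimately show ?case
    using Suc by (simp add: algebra_simps add_divide_distrib)
qed simp

lemma gen_harm_LIMSEQ:
  assumes "m \<ge> 2"
  shows "gen_harm m \<longlonglongrightarrow> zeta_nat m"
  using zeta_nat_sums[OF assms] unfolding sums_def gen_harm_conv_lessThan
  by (simp add: add.commute)

lemma gen_harm_le_zeta: "m \<ge> 2 \<Longrightarrow> gen_harm m n \<le> zeta_nat m"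
  by (rule LIMSEQ_le_const[OF gen_harm_LIMSEQ])
     (auto intro!: exI[of _ n] sum_mono2 simp: gen_harm_def)

lemma half_harm_LIMSEQ:
  assumes "m \<ge> 2"
  shows "half_harm m \<longlonglongrightarrow> (2 ^ m - 1) * zeta_nat m"
proof -
  have "(\<lambda>n. gen_harm m (2 * n)) \<longlonglongrightarrow> zeta_nat m"
    using LIMSEQ_subseq_LIMSEQ[OF gen_harm_LIMSEQ[OF assms], of "\<lambda>n. 2 * n"]
    by (auto simp: strict_mono_def o_def)
  then have "(\<lambda>n. 2 ^ m * gen_harm m (2 * n) - gen_harm m n) \<longlonglongrightarrow> 2 ^ m * zeta_nat m - zeta_nat m"
    by (intro tendsto_intros gen_harm_LIMSEQ assms)
  then show ?thesis
    by (simp add: half_harm_eq[abs_def] algebra_simps)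
qed

lemma half_sums:
  assumes "m \<ge> 2"
  shows "(\<lambda>i. 1 / (real i + 1 / 2) ^ m) sums ((2 ^ m - 1) * zeta_nat m)"
  using half_harm_LIMSEQ[OF assms] unfolding sums_def half_harm_conv_lessThan .

lemma zeta_2: "zeta_nat 2 = pi\<^sup>2 / 6"
  using sums_unique2[OF zeta_nat_sums[of 2]] inverse_squares_sums by (simp add: add.commute)

text \<open>
  Any power of \<open>n\<close> below 1 suffices as a bound, both for the convergence of Euler sums and for the
  error terms in the last deformation; the square root admits a simple induction.
\<close>
lemma gen_harm_le_sqrt:
  assumes "m \<ge> 1"
  shows "gen_harm m n \<le> 2 * sqrt (real n)"
proof (induction n)
  case (Suc n)
  have "1 / (real n + 1) ^ m \<le> 1 / (real n + 1)"
    using assms by (intro divide_left_mono self_le_power) auto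
  also have "\<dots> \<le> 2 * (sqrt (real n + 1) - sqrt (real n))"
  proof -
    have "sqrt (real n + 1) \<le> real n + 1"
      by (rule real_le_lsqrt) (simp_all add: power2_eq_square algebra_simps)
    then have 1: "sqrt (real n) \<le> sqrt (real n + 1)" "sqrt (real n + 1) \<le> real n + 1" "sqrt (real n + 1) > 0"
        "sqrt (real n) \<ge> 0"
      by simp_all
    have "(sqrt (real n + 1) - sqrt (real n)) * (sqrt (real n + 1) + sqrt (real n)) = 1"
      by (simp add: algebra_simps)
    then have "sqrt (real n + 1) - sqrt (real n) = 1 / (sqrt (real n + 1) + sqrt (real n))"
      using 1 by (subst eq_divide_eq) (auto simp: add_pos_nonneg less_imp_neq[symmetric])
    also have "\<dots> \<ge> 1 / (2 * (real n + 1))"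
      using 1 add_mono[OF 1(2) order_trans[OF 1(1,2)]]
      by (intro frac_le) (simp_all only: mult_2 add_pos_nonneg zero_le_one order.refl)
    finally have "2 * (1 / (2 * (real n + 1))) \<le> 2 * (sqrt (real n + 1) - sqrt (real n))"
      by (rule mult_left_mono) simp
    moreover have "2 * (1 / (2 * c)) = 1 / c" for c :: real by simp
    ultimately show ?thesis by metis
  qed
  finally show ?case using Suc by (simp add: add.commute)
qed simp

section \<open>Euler sums by summation along antidiagonals\<close>

text \<open>
  Since \<open>gen_harm t n\<close> stops strictly below \<open>n + 1\<close>, the sum of these terms is the
  double zeta value \<open>\<zeta>(s, t)\<close>, the sum of \<open>1 / (p ^ s * q ^ t)\<close> over the integers
  \<open>p > q \<ge> 1\<close>.
\<close>
definition dzeta_term :: "nat \<Rightarrow> nat \<Rightarrow> nat \<Rightarrow> real" where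
  "dzeta_term s t n = gen_harm t n / (real n + 1) ^ s"

definition dzeta :: "nat \<Rightarrow> nat \<Rightarrow> real" where
  "dzeta s t = suminf (dzeta_term s t)"

lemma summable_dzeta:
  assumes "s \<ge> 2" "t \<ge> 1"
  shows "summable (dzeta_term s t)"
proof (rule summable_comparison_test)
  show "\<exists>N. \<forall>n\<ge>N. norm (dzeta_term s t n) \<le> 2 * real (Suc n) powr (-3/2)"
  proof (intro exI allI impI)
    fix n :: nat
    have "dzeta_term s t n \<le> 2 * sqrt (real n + 1) / (real n + 1) ^ 2"
      unfolding dzeta_term_def
    proof (rule frac_le)
      have "gen_harm t n \<le> 2 * sqrt (real n)" using gen_harm_le_sqrt assms by simp
      also have "\<dots> \<le> 2 * sqrt (real n + 1)" by simp
      finally show "gen_harm t n \<le> 2 * sqrt (real n + 1)" .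
    qed (use assms in \<open>auto intro!: power_increasing\<close>)
    also have "\<dots> = 2 * real (Suc n) powr (-3/2)"
    proof -
      have "(real n + 1) ^ 2 = (real n + 1) powr 2"
        by (simp add: powr_realpow)
      then show ?thesis
        by (simp only: powr_half_sqrt[symmetric] times_divide_eq_right[symmetric] powr_diff[symmetric]) (simp add: add.commute)
    qed
    finally show "norm (dzeta_term s t n) \<le> 2 * real (Suc n) powr (-3/2)"
      using gen_harm_nonneg by (simp add: dzeta_term_def)
  qed
  show "summable (\<lambda>n. 2 * real (Suc n) powr (-3/2))"
    using summable_real_powr_iff[of "-3/2"]
    by (intro summable_mult) (subst summable_Suc_iff[where f = "\<lambda>n. real n powr (-3/2)"], simp)
qed

lemma dzeta_sums: "s \<ge> 2 \<Longrightarrow> t \<ge> 1 \<Longrightarrow> dzeta_term s t sums dzeta s t"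
  unfolding dzeta_def by (intro summable_sums summable_dzeta)

lemma dzeta_term_0 [simp]: "dzeta_term s t 0 = 0"
  by (simp add: dzeta_term_def)

text \<open>
  A double series with nonnegative terms may be summed in any order; reordering rows into antidiagonals is the
  only analytic input to the evaluation of Euler sums.
\<close>
lemma antidiagonal_sums:
  fixes a :: "nat \<Rightarrow> nat \<Rightarrow> real"
  assumes nonneg: "\<And>i j. a i j \<ge> 0"
    and rows: "\<And>i. a i sums r i" and total: "r sums s"
  shows "(\<lambda>n. \<Sum>i\<le>n. a i (n - i)) sums s"
proof -
  have rows': "(a i has_sum r i) UNIV" for i
    by (rule sums_nonneg_imp_has_sum[OF rows nonneg])
  have "r i \<ge> 0" for i
    using has_sum_nonneg[OF rows'] nonneg by simp
  with total have total': "(r has_sum s) UNIV"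
    by (rule sums_nonneg_imp_has_sum)
  have "((\<lambda>(i, j). a i j) has_sum s) (Sigma UNIV (\<lambda>_. UNIV))"
  proof (rule has_sum_SigmaI[where g = r])
    show "(\<lambda>(i, j). a i j) summable_on Sigma UNIV (\<lambda>_. UNIV)"
      by (rule summable_on_SigmaI[where g = r])
         (use rows' total' nonneg in \<open>auto simp: summable_on_def\<close>)
  qed (use rows' total' in auto)
  also have "?this \<longleftrightarrow> ((\<lambda>(n, i). a i (n - i)) has_sum s) (Sigma UNIV (\<lambda>n. {..n}))"
    by (rule has_sum_reindex_bij_witness[where i = "\<lambda>(n, i). (i, n - i)" and j = "\<lambda>(i, j). (i + j, i)"])
       auto
  finally have "((\<lambda>n. \<Sum>i\<le>n. a i (n - i)) has_sum s) UNIV"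
    by (rule has_sum_SigmaD) (auto intro!: has_sum_finiteI)
  then show ?thesis
    by (rule has_sum_imp_sums)
qed

lemma antidiagonal_sums_product:
  fixes f g :: "nat \<Rightarrow> real"
  assumes "f sums s" "g sums t" "\<And>i. f i \<ge> 0" "\<And>i. g i \<ge> 0"
  shows "(\<lambda>n. \<Sum>i\<le>n. f i * g (n - i)) sums (s * t)"
  by (rule antidiagonal_sums[where r = "\<lambda>i. f i * t"])
     (use assms in \<open>auto intro: sums_mult sums_mult2\<close>)

lemma tendsto_gen_harm_diff:
  "(\<lambda>n. gen_harm 1 (n + k) - gen_harm 1 n) \<longlonglongrightarrow> 0"
proof (induction k)
  case (Suc k)
  have "(\<lambda>n. 1 / (real (n + k) + 1)) \<longlonglongrightarrow> 0"
    using LIMSEQ_ignore_initial_segment[OF LIMSEQ_inverse_real_of_nat, of k]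
    by (simp add: inverse_eq_divide algebra_simps)
  from tendsto_add[OF Suc this] show ?case
    by (simp add: algebra_simps)
qed simp

text \<open>
  After partial fractions the series telescopes.
\<close>
lemma sums_shifted_product:
  "(\<lambda>j. 1 / ((real j + 1) * (real j + 1 + (real k + 1)))) sums (gen_harm 1 (k + 1) / (real k + 1))"
proof -
  have "(\<Sum>j<n. 1 / ((real j + 1) * (real j + 1 + (real k + 1)))) =
        (gen_harm 1 (k + 1) - (gen_harm 1 (n + (k + 1)) - gen_harm 1 n)) / (real k + 1)" for n
  proof (induction n)
    case (Suc n)
    have "1 / ((real n + 1) * (real n + 1 + (real k + 1))) =
        (1 / (real n + 1) - 1 / (real n + 1 + (real k + 1))) / (real k + 1)"
    proof -
      have "real n + 1 \<noteq> 0" "real k + 1 \<noteq> 0" "real n + 1 + (real k + 1) \<noteq> 0" by linarith+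
      then show ?thesis by (simp add: divide_simps)
    qed
    then show ?case
      using Suc by (simp add: diff_divide_distrib add_divide_distrib add.commute add.left_commute)
  qed auto
  moreover have "(\<lambda>n. (gen_harm 1 (k + 1) - (gen_harm 1 (n + (k + 1)) - gen_harm 1 n)) / (real k + 1))
      \<longlonglongrightarrow> (gen_harm 1 (k + 1) - 0) / (real k + 1)"
    by (intro tendsto_intros tendsto_gen_harm_diff) auto
  ultimately show ?thesis
    by (simp only: sums_def diff_zero)
qed

lemma sum_gen_harm_rev: "(\<Sum>i\<le>n. 1 / (real (n - i) + 1) ^ m) = gen_harm m (n + 1)"
proof -
  have "(\<Sum>i\<le>n. 1 / (real (n - i) + 1) ^ m) = (\<Sum>i\<le>n. 1 / (real i + 1) ^ m)"
    by (rule sum.reindex_bij_witness[of _ "\<lambda>i. n - i" "\<lambda>i. n - i"]) auto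
  then show ?thesis
    by (simp add: gen_harm_conv_lessThan lessThan_Suc_atMost)
qed

lemma sum_gen_harm_atMost: "(\<Sum>i\<le>n. 1 / (real i + 1) ^ m) = gen_harm m (n + 1)"
  by (simp add: gen_harm_conv_lessThan lessThan_Suc_atMost)

lemma sum_half_harm_rev: "(\<Sum>i\<le>n. 1 / (real (n - i) + 1 / 2) ^ m) = half_harm m (n + 1)"
proof -
  have "(\<Sum>i\<le>n. 1 / (real (n - i) + 1 / 2) ^ m) = (\<Sum>i\<le>n. 1 / (real i + 1 / 2) ^ m)"
    by (rule sum.reindex_bij_witness[of _ "\<lambda>i. n - i" "\<lambda>i. n - i"]) auto
  then show ?thesis
    by (simp add: half_harm_conv_lessThan lessThan_Suc_atMost)
qed

lemma sum_half_harm_atMost: "(\<Sum>i\<le>n. 1 / (real i + 1 / 2) ^ m) = half_harm m (n + 1)"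
  by (simp add: half_harm_conv_lessThan lessThan_Suc_atMost)

lemma sums_gen_harm_powers:
  assumes "m \<ge> 2"
  shows "(\<lambda>i. gen_harm 1 (i + 1) / (real i + 1) ^ m) sums (dzeta m 1 + zeta_nat (m + 1))"
proof -
  have "(\<lambda>i. dzeta_term m 1 i + 1 / (real (Suc i)) ^ (m + 1)) sums (dzeta m 1 + zeta_nat (m + 1))"
    using assms by (intro sums_add dzeta_sums zeta_nat_sums) auto
  then show ?thesis
    by (simp add: dzeta_term_def add_divide_distrib add.commute)
qed

text \<open>
  The array \<open>1 / (u\<^sup>p v (u + v))\<close> over integers \<open>u, v \<ge> 1\<close> is chosen because
  its row sums are harmonic numbers divided by a power of \<open>u\<close>, whereas on an antidiagonal \<open>u +
  v\<close> is constant and partial fractions produce double zeta values. Comparing both gives one linear relation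
  per \<open>p\<close>, namely Euler's sum formula.
\<close>
lemma sum_formula_array:
  assumes "p \<ge> 1"
  shows "(\<lambda>n. \<Sum>i\<le>n. 1 / ((real i + 1) ^ p * (real (n - i) + 1) * (real n + 2)))
           sums (dzeta (p + 1) 1 + zeta_nat (p + 2))"
proof -
  let ?a = "\<lambda>i j. 1 / ((real i + 1) ^ p * (real j + 1) * (real i + real j + 2))"
  have "(\<lambda>n. \<Sum>i\<le>n. ?a i (n - i)) sums (dzeta (p + 1) 1 + zeta_nat (p + 2))"
  proof (rule antidiagonal_sums)
    show "?a i sums (gen_harm 1 (i + 1) / (real i + 1) ^ (p + 1))" for i
    proof -
      have "1 / (real i + 1) ^ p * (1 / ((real j + 1) * (real j + 1 + (real i + 1)))) = ?a i j" for j
      proof -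
        have *: "real j + 1 + (real i + 1) = real i + real j + 2" by simp
        show ?thesis unfolding * by (simp only: times_divide_times_eq mult_1 mult.assoc)
      qed
      moreover have "1 / (real i + 1) ^ p * (g / (real i + 1)) = g / (real i + 1) ^ (p + 1)" for g
        by (simp only: times_divide_times_eq mult_1 power_add power_one_right)
      ultimately show ?thesis
        using sums_mult[OF sums_shifted_product[of i], of "1 / (real i + 1) ^ p"] by (simp only:)
    qed
    show "(\<lambda>i. gen_harm 1 (i + 1) / (real i + 1) ^ (p + 1)) sums (dzeta (p + 1) 1 + zeta_nat (p + 2))"
      using sums_gen_harm_powers[of "p + 1"] assms by simp
  qed auto
  also have "(\<lambda>n. \<Sum>i\<le>n. ?a i (n - i)) = (\<lambda>n. \<Sum>i\<le>n. 1 / ((real i + 1) ^ p * (real (n - i) + 1) * (real n + 2)))"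
    by (intro ext sum.cong) (auto simp: of_nat_diff)
  finally show ?thesis .
qed

lemma dzeta_Suc_sums:
  assumes "s \<ge> 2" "t \<ge> 1"
  shows "(\<lambda>n. dzeta_term s t (Suc n)) sums dzeta s t"
  using dzeta_sums[OF assms] by (simp add: sums_Suc_iff)

lemma dzeta_term_Suc: "dzeta_term s t (Suc n) = gen_harm t (n + 1) / (real n + 2) ^ s"
  by (simp add: dzeta_term_def add_ac)

text \<open>
  The case \<open>p = 1\<close>: the antidiagonal sums are \<open>2 \<zeta>(2, 1)\<close>, the row sums
  \<open>\<zeta>(2, 1) + \<zeta>(3)\<close>.
\<close>
lemma euler_21: "dzeta 2 1 = zeta_nat 3"
proof -
  have "(\<Sum>i\<le>n. 1 / ((real i + 1) ^ 1 * (real (n - i) + 1) * (real n + 2))) = 2 * dzeta_term 2 1 (Suc n)" for n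
  proof -
    have "(\<Sum>i\<le>n. 1 / ((real i + 1) ^ 1 * (real (n - i) + 1) * (real n + 2))) =
        (\<Sum>i\<le>n. (1 / (real i + 1) ^ 1 + 1 / (real (n - i) + 1) ^ 1) * (1 / (real n + 2) ^ 2))"
    proof (intro sum.cong refl)
      fix i assume "i \<in> {..n}"
      define x y where "x = real i + 1" and "y = real (n - i) + 1"
      have nz: "x > 0" "y > 0" "x + y \<noteq> 0" and n: "real n + 2 = x + y"
        using \<open>i \<in> {..n}\<close> by (auto simp: x_def y_def of_nat_diff)
      have "1 / (x ^ 1 * y * (x + y)) = (1 / x ^ 1 + 1 / y ^ 1) * (1 / (x + y) ^ 2)"
        using nz by (simp add: divide_simps) algebra
      then show "1 / ((real i + 1) ^ 1 * (real (n - i) + 1) * (real n + 2)) =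
          (1 / (real i + 1) ^ 1 + 1 / (real (n - i) + 1) ^ 1) * (1 / (real n + 2) ^ 2)"
        unfolding n by (simp only: x_def y_def)
    qed
    also have "\<dots> = 2 * dzeta_term 2 1 (Suc n)"
      by (simp only: sum_distrib_right[symmetric] sum.distrib sum_gen_harm_rev sum_gen_harm_atMost dzeta_term_Suc)
        simp
    finally show ?thesis .
  qed
  then have "(\<lambda>n. 2 * dzeta_term 2 1 (Suc n)) sums (dzeta 2 1 + zeta_nat 3)"
    using sum_formula_array[of 1] by (simp add: numeral_2_eq_2 numeral_3_eq_3)
  from sums_unique2[OF this sums_mult[OF dzeta_Suc_sums[of 2 1]]] show ?thesis by simp
qed

lemma euler_31_22: "dzeta 3 1 + zeta_nat 4 = dzeta 2 2 + 2 * dzeta 3 1"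
proof -
  have "(\<Sum>i\<le>n. 1 / ((real i + 1) ^ 2 * (real (n - i) + 1) * (real n + 2))) =
        dzeta_term 2 2 (Suc n) + 2 * dzeta_term 3 1 (Suc n)" for n
  proof -
    have "(\<Sum>i\<le>n. 1 / ((real i + 1) ^ 2 * (real (n - i) + 1) * (real n + 2))) =
        (\<Sum>i\<le>n. 1 / (real i + 1) ^ 2 * (1 / (real n + 2) ^ 2) +
            (1 / (real i + 1) ^ 1 + 1 / (real (n - i) + 1) ^ 1) * (1 / (real n + 2) ^ 3))"
    proof (intro sum.cong refl)
      fix i assume "i \<in> {..n}"
      define x y where "x = real i + 1" and "y = real (n - i) + 1"
      have nz: "x > 0" "y > 0" "x + y \<noteq> 0" and n: "real n + 2 = x + y"
        using \<open>i \<in> {..n}\<close> by (auto simp: x_def y_def of_nat_diff)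
      have "1 / (x ^ 2 * y * (x + y)) =
          1 / x ^ 2 * (1 / (x + y) ^ 2) + (1 / x ^ 1 + 1 / y ^ 1) * (1 / (x + y) ^ 3)"
        using nz by (simp add: divide_simps) algebra
      then show "1 / ((real i + 1) ^ 2 * (real (n - i) + 1) * (real n + 2)) =
          1 / (real i + 1) ^ 2 * (1 / (real n + 2) ^ 2) +
            (1 / (real i + 1) ^ 1 + 1 / (real (n - i) + 1) ^ 1) * (1 / (real n + 2) ^ 3)"
        unfolding n by (simp only: x_def y_def)
    qed
    also have "\<dots> = dzeta_term 2 2 (Suc n) + 2 * dzeta_term 3 1 (Suc n)"
      by (simp only: sum_distrib_right[symmetric] sum.distrib sum_gen_harm_rev sum_gen_harm_atMost dzeta_term_Suc)
        simp
    finally show ?thesis .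
  qed
  then have "(\<lambda>n. dzeta_term 2 2 (Suc n) + 2 * dzeta_term 3 1 (Suc n)) sums (dzeta 3 1 + zeta_nat 4)"
    using sum_formula_array[of 2] by simp
  from sums_unique2[OF this sums_add[OF dzeta_Suc_sums[of 2 2] sums_mult[OF dzeta_Suc_sums[of 3 1], of 2]]]
  show ?thesis by simp
qed

lemma euler_41_32_23: "dzeta 4 1 + zeta_nat 5 = dzeta 2 3 + dzeta 3 2 + 2 * dzeta 4 1"
proof -
  have "(\<Sum>i\<le>n. 1 / ((real i + 1) ^ 3 * (real (n - i) + 1) * (real n + 2))) =
        dzeta_term 2 3 (Suc n) + dzeta_term 3 2 (Suc n) + 2 * dzeta_term 4 1 (Suc n)" for n
  proof -
    have "(\<Sum>i\<le>n. 1 / ((real i + 1) ^ 3 * (real (n - i) + 1) * (real n + 2))) =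
        (\<Sum>i\<le>n. 1 / (real i + 1) ^ 3 * (1 / (real n + 2) ^ 2) + 1 / (real i + 1) ^ 2 * (1 / (real n + 2) ^ 3) +
            (1 / (real i + 1) ^ 1 + 1 / (real (n - i) + 1) ^ 1) * (1 / (real n + 2) ^ 4))"
    proof (intro sum.cong refl)
      fix i assume "i \<in> {..n}"
      define x y where "x = real i + 1" and "y = real (n - i) + 1"
      have nz: "x > 0" "y > 0" "x + y \<noteq> 0" and n: "real n + 2 = x + y"
        using \<open>i \<in> {..n}\<close> by (auto simp: x_def y_def of_nat_diff)
      have "1 / (x ^ 3 * y * (x + y)) =
          1 / x ^ 3 * (1 / (x + y) ^ 2) + 1 / x ^ 2 * (1 / (x + y) ^ 3) + (1 / x ^ 1 + 1 / y ^ 1) * (1 / (x + y) ^ 4)"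
        using nz by (simp add: divide_simps) algebra
      then show "1 / ((real i + 1) ^ 3 * (real (n - i) + 1) * (real n + 2)) =
          1 / (real i + 1) ^ 3 * (1 / (real n + 2) ^ 2) + 1 / (real i + 1) ^ 2 * (1 / (real n + 2) ^ 3) +
            (1 / (real i + 1) ^ 1 + 1 / (real (n - i) + 1) ^ 1) * (1 / (real n + 2) ^ 4)"
        unfolding n by (simp only: x_def y_def)
    qed
    also have "\<dots> = dzeta_term 2 3 (Suc n) + dzeta_term 3 2 (Suc n) + 2 * dzeta_term 4 1 (Suc n)"
      by (simp only: sum_distrib_right[symmetric] sum.distrib sum_gen_harm_rev sum_gen_harm_atMost dzeta_term_Suc)
        simp
    finally show ?thesis .
  qed
  then have "(\<lambda>n. dzeta_term 2 3 (Suc n) + dzeta_term 3 2 (Suc n) + 2 * dzeta_term 4 1 (Suc n)) sums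
      (dzeta 4 1 + zeta_nat 5)"
    using sum_formula_array[of 3] by simp
  from sums_unique2[OF this sums_add[OF sums_add[OF dzeta_Suc_sums[of 2 3] dzeta_Suc_sums[of 3 2]]
      sums_mult[OF dzeta_Suc_sums[of 4 1], of 2]]]
  show ?thesis by simp
qed

text \<open>
  The antidiagonals of the product array for \<open>\<zeta>(2)\<^sup>2\<close>, split by partial fractions.
\<close>
lemma euler_shuffle_22: "zeta_nat 2 * zeta_nat 2 = 2 * dzeta 2 2 + 4 * dzeta 3 1"
proof -
  have "(\<Sum>i\<le>n. 1 / (real i + 1) ^ 2 * (1 / (real (n - i) + 1) ^ 2)) =
        2 * dzeta_term 2 2 (Suc n) + 4 * dzeta_term 3 1 (Suc n)" for n
  proof -
    have "(\<Sum>i\<le>n. 1 / (real i + 1) ^ 2 * (1 / (real (n - i) + 1) ^ 2)) =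
        (\<Sum>i\<le>n. (1 / (real i + 1) ^ 2 + 1 / (real (n - i) + 1) ^ 2) * (1 / (real n + 2) ^ 2) +
            (1 / (real i + 1) ^ 1 + 1 / (real (n - i) + 1) ^ 1) * (2 / (real n + 2) ^ 3))"
    proof (intro sum.cong refl)
      fix i assume "i \<in> {..n}"
      define x y where "x = real i + 1" and "y = real (n - i) + 1"
      have nz: "x > 0" "y > 0" "x + y \<noteq> 0" and n: "real n + 2 = x + y"
        using \<open>i \<in> {..n}\<close> by (auto simp: x_def y_def of_nat_diff)
      have "1 / x ^ 2 * (1 / y ^ 2) =
          (1 / x ^ 2 + 1 / y ^ 2) * (1 / (x + y) ^ 2) + (1 / x ^ 1 + 1 / y ^ 1) * (2 / (x + y) ^ 3)"
        using nz by (simp add: divide_simps) algebra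
      then show "1 / (real i + 1) ^ 2 * (1 / (real (n - i) + 1) ^ 2) =
          (1 / (real i + 1) ^ 2 + 1 / (real (n - i) + 1) ^ 2) * (1 / (real n + 2) ^ 2) +
            (1 / (real i + 1) ^ 1 + 1 / (real (n - i) + 1) ^ 1) * (2 / (real n + 2) ^ 3)"
        unfolding n by (simp only: x_def y_def)
    qed
    also have "\<dots> = 2 * dzeta_term 2 2 (Suc n) + 4 * dzeta_term 3 1 (Suc n)"
      by (simp only: sum_distrib_right[symmetric] sum.distrib sum_gen_harm_rev sum_gen_harm_atMost dzeta_term_Suc)
        simp
    finally show ?thesis .
  qed
  moreover have "(\<lambda>i. 1 / (real i + 1) ^ 2) sums zeta_nat 2"
    using zeta_nat_sums[of 2] by (simp add: add.commute)
  ultimately have "(\<lambda>n. 2 * dzeta_term 2 2 (Suc n) + 4 * dzeta_term 3 1 (Suc n)) sums (zeta_nat 2 * zeta_nat 2)"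
    using antidiagonal_sums_product[of "\<lambda>i. 1 / (real i + 1) ^ 2" "zeta_nat 2" "\<lambda>i. 1 / (real i + 1) ^ 2"] by simp
  from sums_unique2[OF this sums_add[OF sums_mult[OF dzeta_Suc_sums[of 2 2], of 2]
      sums_mult[OF dzeta_Suc_sums[of 3 1], of 4]]]
  show ?thesis by simp
qed

lemma euler_shuffle_23: "zeta_nat 2 * zeta_nat 3 = dzeta 2 3 + 3 * dzeta 3 2 + 6 * dzeta 4 1"
proof -
  have "(\<Sum>i\<le>n. 1 / (real i + 1) ^ 2 * (1 / (real (n - i) + 1) ^ 3)) =
        dzeta_term 2 3 (Suc n) + 3 * dzeta_term 3 2 (Suc n) + 6 * dzeta_term 4 1 (Suc n)" for n
  proof -
    have "(\<Sum>i\<le>n. 1 / (real i + 1) ^ 2 * (1 / (real (n - i) + 1) ^ 3)) =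
        (\<Sum>i\<le>n. 1 / (real (n - i) + 1) ^ 3 * (1 / (real n + 2) ^ 2) +
            1 / (real (n - i) + 1) ^ 2 * (2 / (real n + 2) ^ 3) + 1 / (real i + 1) ^ 2 * (1 / (real n + 2) ^ 3) +
            (1 / (real i + 1) ^ 1 + 1 / (real (n - i) + 1) ^ 1) * (3 / (real n + 2) ^ 4))"
    proof (intro sum.cong refl)
      fix i assume "i \<in> {..n}"
      define x y where "x = real i + 1" and "y = real (n - i) + 1"
      have nz: "x > 0" "y > 0" "x + y \<noteq> 0" and n: "real n + 2 = x + y"
        using \<open>i \<in> {..n}\<close> by (auto simp: x_def y_def of_nat_diff)
      have "1 / x ^ 2 * (1 / y ^ 3) = 1 / y ^ 3 * (1 / (x + y) ^ 2) +
            1 / y ^ 2 * (2 / (x + y) ^ 3) + 1 / x ^ 2 * (1 / (x + y) ^ 3) +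
            (1 / x ^ 1 + 1 / y ^ 1) * (3 / (x + y) ^ 4)"
        using nz by (simp add: divide_simps) algebra
      then show "1 / (real i + 1) ^ 2 * (1 / (real (n - i) + 1) ^ 3) =
          1 / (real (n - i) + 1) ^ 3 * (1 / (real n + 2) ^ 2) +
            1 / (real (n - i) + 1) ^ 2 * (2 / (real n + 2) ^ 3) + 1 / (real i + 1) ^ 2 * (1 / (real n + 2) ^ 3) +
            (1 / (real i + 1) ^ 1 + 1 / (real (n - i) + 1) ^ 1) * (3 / (real n + 2) ^ 4)"
        unfolding n by (simp only: x_def y_def)
    qed
    also have "\<dots> = dzeta_term 2 3 (Suc n) + 3 * dzeta_term 3 2 (Suc n) + 6 * dzeta_term 4 1 (Suc n)"
      by (simp only: sum_distrib_right[symmetric] sum.distrib sum_gen_harm_rev sum_gen_harm_atMost dzeta_term_Suc)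
        (simp add: add_divide_distrib)
    finally show ?thesis .
  qed
  moreover have "(\<lambda>i. 1 / (real i + 1) ^ 2) sums zeta_nat 2" "(\<lambda>i. 1 / (real i + 1) ^ 3) sums zeta_nat 3"
    using zeta_nat_sums[of 2] zeta_nat_sums[of 3] by (simp_all add: add.commute)
  ultimately have "(\<lambda>n. dzeta_term 2 3 (Suc n) + 3 * dzeta_term 3 2 (Suc n) + 6 * dzeta_term 4 1 (Suc n)) sums
      (zeta_nat 2 * zeta_nat 3)"
    using antidiagonal_sums_product[of "\<lambda>i. 1 / (real i + 1) ^ 2" "zeta_nat 2" "\<lambda>i. 1 / (real i + 1) ^ 3"]
    by simp
  from sums_unique2[OF this sums_add[OF sums_add[OF dzeta_Suc_sums[of 2 3] sums_mult[OF dzeta_Suc_sums[of 3 2], of 3]]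
      sums_mult[OF dzeta_Suc_sums[of 4 1], of 6]]]
  show ?thesis by simp
qed

text \<open>
  Summation by parts applied to the product of two harmonic numbers.
\<close>
lemma euler_stuffle:
  assumes "s \<ge> 2" "t \<ge> 2"
  shows "zeta_nat s * zeta_nat t = dzeta s t + dzeta t s + zeta_nat (s + t)"
proof -
  have "(\<Sum>j<n. dzeta_term s t j + dzeta_term t s j + 1 / real (Suc j) ^ (s + t)) = gen_harm s n * gen_harm t n" for n
    by (induction n) (auto simp: dzeta_term_def power_add field_simps)
  moreover have "(\<lambda>n. gen_harm s n * gen_harm t n) \<longlonglongrightarrow> zeta_nat s * zeta_nat t"
    by (intro tendsto_mult gen_harm_LIMSEQ assms)
  ultimately have "(\<lambda>j. dzeta_term s t j + dzeta_term t s j + 1 / real (Suc j) ^ (s + t)) sums (zeta_nat s * zeta_nat t)"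
    by (simp only: sums_def)
  moreover have "(\<lambda>j. dzeta_term s t j + dzeta_term t s j + 1 / real (Suc j) ^ (s + t)) sums
      (dzeta s t + dzeta t s + zeta_nat (s + t))"
    using assms by (intro sums_add dzeta_sums zeta_nat_sums) auto
  ultimately show ?thesis
    by (rule sums_unique2)
qed

text \<open>
  The stuffle, shuffle and sum relations in weight 4 together express \<open>\<zeta>(4)\<close> by
  \<open>\<zeta>(2)\<^sup>2\<close>.
\<close>
lemma zeta_4: "zeta_nat 4 = pi ^ 4 / 90"
  using euler_stuffle[of 2 2] euler_shuffle_22 euler_31_22 by (simp add: zeta_2 field_simps)

text \<open>
  In weight 5 the same three relations determine \<open>\<zeta>(2, 3)\<close>, \<open>\<zeta>(3, 2)\<close> and
  \<open>\<zeta>(4, 1)\<close>.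
\<close>
lemma dzeta_23: "dzeta 2 3 = 9 / 2 * zeta_nat 5 - 2 * zeta_nat 2 * zeta_nat 3"
proof -
  have "zeta_nat 2 * zeta_nat 3 = dzeta 2 3 + dzeta 3 2 + zeta_nat 5"
    using euler_stuffle[of 2 3] by simp
  then show ?thesis
    using euler_shuffle_23 euler_41_32_23 by linarith
qed

text \<open>
  Two half-integers add up to an integer, so the shuffle relation for the square of \<open>\<Sum>i. 1 / (i +
  1/2)\<^sup>2 = \<pi>\<^sup>2 / 2\<close> involves only this combination of mixed Euler sums.
\<close>
lemma half_shuffle_22:
  "(\<lambda>n. half_harm 2 (n + 1) / (real n + 1) ^ 2 + 2 * half_harm 1 (n + 1) / (real n + 1) ^ 3) sums (pi ^ 4 / 8)"
proof -
  have "(\<Sum>i\<le>n. 1 / (real i + 1 / 2) ^ 2 * (1 / (real (n - i) + 1 / 2) ^ 2)) =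
        2 * (half_harm 2 (n + 1) / (real n + 1) ^ 2 + 2 * half_harm 1 (n + 1) / (real n + 1) ^ 3)" for n
  proof -
    have "(\<Sum>i\<le>n. 1 / (real i + 1 / 2) ^ 2 * (1 / (real (n - i) + 1 / 2) ^ 2)) =
        (\<Sum>i\<le>n. (1 / (real i + 1 / 2) ^ 2 + 1 / (real (n - i) + 1 / 2) ^ 2) * (1 / (real n + 1) ^ 2) +
            (1 / (real i + 1 / 2) ^ 1 + 1 / (real (n - i) + 1 / 2) ^ 1) * (2 / (real n + 1) ^ 3))"
    proof (intro sum.cong refl)
      fix i assume "i \<in> {..n}"
      define x y where "x = real i + 1 / 2" and "y = real (n - i) + 1 / 2"
      have nz: "x > 0" "y > 0" "x + y \<noteq> 0" and n: "real n + 1 = x + y"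
        using \<open>i \<in> {..n}\<close> by (auto simp: x_def y_def of_nat_diff)
      have "1 / x ^ 2 * (1 / y ^ 2) =
          (1 / x ^ 2 + 1 / y ^ 2) * (1 / (x + y) ^ 2) + (1 / x ^ 1 + 1 / y ^ 1) * (2 / (x + y) ^ 3)"
        using nz by (simp add: divide_simps) algebra
      then show "1 / (real i + 1 / 2) ^ 2 * (1 / (real (n - i) + 1 / 2) ^ 2) =
          (1 / (real i + 1 / 2) ^ 2 + 1 / (real (n - i) + 1 / 2) ^ 2) * (1 / (real n + 1) ^ 2) +
            (1 / (real i + 1 / 2) ^ 1 + 1 / (real (n - i) + 1 / 2) ^ 1) * (2 / (real n + 1) ^ 3)"
        unfolding n by (simp only: x_def y_def)
    qed
    also have "\<dots> = 2 * (half_harm 2 (n + 1) / (real n + 1) ^ 2 + 2 * half_harm 1 (n + 1) / (real n + 1) ^ 3)"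
      by (simp only: sum_distrib_right[symmetric] sum.distrib sum_half_harm_rev sum_half_harm_atMost)
        (simp del: half_harm_Suc add: add_divide_distrib)
    finally show ?thesis .
  qed
  then have "(\<lambda>n. 2 * (half_harm 2 (n + 1) / (real n + 1) ^ 2 + 2 * half_harm 1 (n + 1) / (real n + 1) ^ 3)) sums
      (3 * zeta_nat 2 * (3 * zeta_nat 2))"
    using antidiagonal_sums_product[OF half_sums half_sums, of 2 2] by simp
  also have "3 * zeta_nat 2 * (3 * zeta_nat 2) = 2 * (pi ^ 4 / 8)"
    by (simp add: zeta_2 power2_eq_square power4_eq_xxxx)
  finally show ?thesis
    by (subst (asm) sums_mult_iff) auto
qed

lemma sums_odd_cubes: "(\<lambda>i. 1 / (2 * real i + 1) ^ 3) sums (7 / 8 * zeta_nat 3)"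
proof -
  have "1 / (real i + 1 / 2) ^ 3 * (1 / 8) = 1 / (2 * real i + 1) ^ 3" for i
    by (simp add: field_simps power3_eq_cube)
  then show ?thesis
    using sums_mult2[OF half_sums[of 3], of "1 / 8"] by (simp add: mult.commute)
qed

lemma half_harm_conv_odd: "half_harm 1 n = 2 * (\<Sum>i<n. 1 / (2 * real i + 1))"
  by (induction n) (auto simp: field_simps)

text \<open>
  Consider \<open>1 / (p m (p + m))\<close> for odd \<open>p\<close> and arbitrary \<open>m \<ge> 1\<close>. Its
  row sums are \<open>H\<^sub>p / p\<^sup>2\<close>. On the antidiagonals, the even \<open>m\<close> contribute
  \<open>H\<^bsub>q-1\<^esub> / q\<^sup>2\<close> with \<open>q = p + m\<close> odd, and the odd \<open>m\<close>
  contribute the series in question. The difference of the row sums and the even part is the sum of the reciprocal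
  odd cubes, so no logarithm of 2 appears.
\<close>
lemma half_euler_21: "(\<lambda>n. half_harm 1 (n + 1) / (real n + 1) ^ 2) sums (7 / 2 * zeta_nat 3)"
proof -
  define r where "r i = gen_harm 1 (2 * i + 1) / (2 * real i + 1) ^ 2" for i
  define a where "a i j = 1 / ((2 * real i + 1) * (2 * real j + 1) * (2 * real i + 1 + (2 * real j + 1)))
      + 1 / ((2 * real i + 1) * (2 * real j + 2) * (2 * real i + 1 + (2 * real j + 2)))" for i j :: nat
  have rows: "a i sums r i" for i
  proof -
    have "(\<lambda>j. 1 / ((real j + 1) * (real j + 1 + (real (2 * i) + 1))) * (1 / (2 * real i + 1))) sums r i"
      using sums_mult2[OF sums_shifted_product[of "2 * i"], of "1 / (2 * real i + 1)"]
      by (simp add: r_def power2_eq_square)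
    \<comment> \<open>The array collects the odd and the even second index in one entry.\<close>
    from sums_group[OF this, of 2] have "(\<lambda>j. \<Sum>m = 2 * j..<2 * j + 2.
        1 / ((real m + 1) * (real m + 1 + (real (2 * i) + 1))) * (1 / (2 * real i + 1))) sums r i"
      by (simp add: mult.commute)
    also have "(\<lambda>j. \<Sum>m = 2 * j..<2 * j + 2.
        1 / ((real m + 1) * (real m + 1 + (real (2 * i) + 1))) * (1 / (2 * real i + 1))) = a i"
    proof
      fix j :: nat
      have "{2 * j..<2 * j + 2} = {2 * j, 2 * j + 1}" by auto
      then show "(\<Sum>m = 2 * j..<2 * j + 2.
        1 / ((real m + 1) * (real m + 1 + (real (2 * i) + 1))) * (1 / (2 * real i + 1))) = a i j"
        by (simp add: a_def algebra_simps)
    qed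
    finally show ?thesis .
  qed
  have "summable r"
  proof (rule summable_comparison_test)
    show "\<exists>N. \<forall>n\<ge>N. norm (r n) \<le> gen_harm 1 (2 * n + 1) / (real (2 * n) + 1) ^ 2"
      by (intro exI[of _ 0]) (auto simp: r_def gen_harm_nonneg simp del: gen_harm_Suc)
    show "summable (\<lambda>n. gen_harm 1 (2 * n + 1) / (real (2 * n) + 1) ^ 2)"
      using summable_reindex[OF sums_summable[OF sums_gen_harm_powers[of 2]], of "\<lambda>n. 2 * n"]
      by (simp add: o_def inj_on_def gen_harm_nonneg del: gen_harm_Suc)
  qed
  then have "(\<lambda>n. \<Sum>i\<le>n. a i (n - i)) sums suminf r"
    by (intro antidiagonal_sums[where r = r] rows summable_sums) (auto simp: a_def)
  also have "(\<lambda>n. \<Sum>i\<le>n. a i (n - i)) =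
      (\<lambda>n. half_harm 1 (n + 1) / (real n + 1) ^ 2 / 4 + gen_harm 1 (2 * n + 2) / (2 * real n + 3) ^ 2)"
  proof
    fix n
    have split: "gen_harm 1 (2 * n + 2) = (\<Sum>i\<le>n. 1 / (2 * real i + 1)) + (\<Sum>i\<le>n. 1 / (2 * real i + 2))"
      by (induction n) (auto simp: algebra_simps)
    have odd: "half_harm 1 (n + 1) = 2 * (\<Sum>i\<le>n. 1 / (2 * real i + 1))"
      unfolding half_harm_conv_odd by (simp add: lessThan_Suc_atMost)
    have rev: "(\<Sum>i\<le>n. 1 / (2 * real (n - i) + c)) = (\<Sum>i\<le>n. 1 / (2 * real i + c))" for c :: real
      by (rule sum.reindex_bij_witness[of _ "\<lambda>i. n - i" "\<lambda>i. n - i"]) auto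
    have "a i (n - i) = (1 / (2 * real i + 1) + 1 / (2 * real (n - i) + 1)) * (1 / (2 * real n + 2) ^ 2)
        + (1 / (2 * real i + 1) + 1 / (2 * real (n - i) + 2)) * (1 / (2 * real n + 3) ^ 2)" if "i \<le> n" for i
    proof -
      have pf: "1 / (x * y * (x + y)) = (1 / x + 1 / y) * (1 / (x + y) ^ 2)" if "x > 0" "y > 0" for x y :: real
        using that by (simp add: divide_simps power2_eq_square)
      have "2 * real i + 1 + (2 * real (n - i) + 1) = 2 * real n + 2"
        "2 * real i + 1 + (2 * real (n - i) + 2) = 2 * real n + 3"
        using that by (auto simp: of_nat_diff)
      then show ?thesis
        using pf[of "2 * real i + 1" "2 * real (n - i) + 1"] pf[of "2 * real i + 1" "2 * real (n - i) + 2"]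
        unfolding a_def by (simp add: add_ac)
    qed
    then have "(\<Sum>i\<le>n. a i (n - i)) =
        (\<Sum>i\<le>n. (1 / (2 * real i + 1) + 1 / (2 * real (n - i) + 1)) * (1 / (2 * real n + 2) ^ 2)
        + (1 / (2 * real i + 1) + 1 / (2 * real (n - i) + 2)) * (1 / (2 * real n + 3) ^ 2))"
      by (intro sum.cong) auto
    also have "\<dots> = half_harm 1 (n + 1) * (1 / (2 * real n + 2) ^ 2) + gen_harm 1 (2 * n + 2) * (1 / (2 * real n + 3) ^ 2)"
      by (simp only: sum_distrib_right[symmetric] sum.distrib rev split odd) (simp add: algebra_simps)
    also have "1 / (2 * real n + 2) ^ 2 = 1 / (real n + 1) ^ 2 / 4"
      by (simp add: divide_simps power2_eq_square) (simp add: algebra_simps)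
    finally show "(\<Sum>i\<le>n. a i (n - i)) = half_harm 1 (n + 1) / (real n + 1) ^ 2 / 4 + gen_harm 1 (2 * n + 2) / (2 * real n + 3) ^ 2"
      by (simp del: half_harm_Suc gen_harm_Suc)
  qed
  finally have total: "(\<lambda>n. half_harm 1 (n + 1) / (real n + 1) ^ 2 / 4 + gen_harm 1 (2 * n + 2) / (2 * real n + 3) ^ 2)
      sums suminf r" .
  have "(\<lambda>i. r i - 1 / (2 * real i + 1) ^ 3) sums (suminf r - 7 / 8 * zeta_nat 3)"
    by (intro sums_diff summable_sums \<open>summable r\<close> sums_odd_cubes)
  then have "(\<lambda>i. r (Suc i) - 1 / (2 * real (Suc i) + 1) ^ 3) sums (suminf r - 7 / 8 * zeta_nat 3)"
    by (subst sums_Suc_iff) (simp add: r_def)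
  also have "(\<lambda>i. r (Suc i) - 1 / (2 * real (Suc i) + 1) ^ 3) = (\<lambda>n. gen_harm 1 (2 * n + 2) / (2 * real n + 3) ^ 2)"
  proof
    fix n
    have "gen_harm 1 (2 * Suc n + 1) = gen_harm 1 (2 * n + 2) + 1 / (2 * real n + 3)"
      by (simp add: add_ac)
    moreover have "2 * real (Suc n) + 1 = 2 * real n + 3"
      by simp
    moreover have "(g + 1 / d) / d ^ 2 - 1 / d ^ 3 = g / d ^ 2" for g d :: real
      by (simp add: add_divide_distrib power2_eq_square power3_eq_cube)
    ultimately show "r (Suc n) - 1 / (2 * real (Suc n) + 1) ^ 3 = gen_harm 1 (2 * n + 2) / (2 * real n + 3) ^ 2"
      unfolding r_def by (simp only:)
  qed
  finally have even: "(\<lambda>n. gen_harm 1 (2 * n + 2) / (2 * real n + 3) ^ 2) sums (suminf r - 7 / 8 * zeta_nat 3)" .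
  have cancel: "4 * (x / 4 + b - b) = x" "4 * (t - (t - 7 / 8 * z)) = 7 / 2 * z" for x b t z :: real
    by simp_all
  show ?thesis
    using sums_mult[OF sums_diff[OF total even], of 4] by (simp only: cancel)
qed

section \<open>A well-poised kernel and its certificates\<close>

text \<open>
  The polynomials of this section come from Gosper's algorithm: \<open>cert_poly\<close> belongs to the base pair,
  and the others describe how the certificate changes in a parameter direction. Their signs are chosen so that all
  coefficients are positive; \<open>e1_poly\<close>, \<open>e2_poly\<close>, \<open>e3_poly\<close> and
  \<open>shift_poly\<close> enter the deformed certificates negatively. In \<open>cert_poly x z\<close> the
  variable \<open>x\<close> stands for \<open>n\<close> and \<open>z\<close> for \<open>k\<close>.
\<close>
definition cert_poly :: "real \<Rightarrow> real \<Rightarrow> real" where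
  "cert_poly x z =
        (70 + 552 * z + 1788 * z ^ 2 + 3048 * z ^ 3 + 2886 * z ^ 4 + 1440 * z ^ 5 + 296 * z ^ 6)
      + (196 + 1284 * z + 3324 * z ^ 2 + 4252 * z ^ 3 + 2688 * z ^ 4 + 672 * z ^ 5) * x
      + (200 + 1044 * z + 2028 * z ^ 2 + 1736 * z ^ 3 + 552 * z ^ 4) * x ^ 2
      + (88 + 342 * z + 444 * z ^ 2 + 192 * z ^ 3) * x ^ 3
      + (14 + 36 * z + 24 * z ^ 2) * x ^ 4"

definition cert_poly_dx :: "real \<Rightarrow> real \<Rightarrow> real" where
  "cert_poly_dx x z =
        (196 + 1284 * z + 3324 * z ^ 2 + 4252 * z ^ 3 + 2688 * z ^ 4 + 672 * z ^ 5)
      + (400 + 2088 * z + 4056 * z ^ 2 + 3472 * z ^ 3 + 1104 * z ^ 4) * x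
      + (264 + 1026 * z + 1332 * z ^ 2 + 576 * z ^ 3) * x ^ 2
      + (56 + 144 * z + 96 * z ^ 2) * x ^ 3"

definition shift_poly :: "real \<Rightarrow> real \<Rightarrow> real" where
  "shift_poly x z =
        (84 + 456 * z + 900 * z ^ 2 + 768 * z ^ 3 + 240 * z ^ 4) * x
      + (164 + 660 * z + 864 * z ^ 2 + 368 * z ^ 3) * x ^ 2
      + (102 + 264 * z + 168 * z ^ 2) * x ^ 3
      + (20 + 24 * z) * x ^ 4"

definition shift_poly_dx :: "real \<Rightarrow> real \<Rightarrow> real" where
  "shift_poly_dx x z =
        (84 + 456 * z + 900 * z ^ 2 + 768 * z ^ 3 + 240 * z ^ 4)
      + (328 + 1320 * z + 1728 * z ^ 2 + 736 * z ^ 3) * x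
      + (306 + 792 * z + 504 * z ^ 2) * x ^ 2
      + (80 + 96 * z) * x ^ 3"

text \<open>
  The direction of this polynomial is \<open>e\<^sub>1\<close> minus \<open>(1; 0, 1, 1, 1)\<close>.
\<close>
definition e1_poly :: "real \<Rightarrow> real \<Rightarrow> real" where
  "e1_poly x z =
        (152 + 1220 * z + 4036 * z ^ 2 + 7052 * z ^ 3 + 6868 * z ^ 4 + 3536 * z ^ 5 + 752 * z ^ 6)
      + (364 + 2384 * z + 6196 * z ^ 2 + 8000 * z ^ 3 + 5136 * z ^ 4 + 1312 * z ^ 5) * x
      + (316 + 1594 * z + 3000 * z ^ 2 + 2504 * z ^ 3 + 784 * z ^ 4) * x ^ 2
      + (118 + 416 * z + 488 * z ^ 2 + 192 * z ^ 3) * x ^ 3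
      + (16 + 32 * z + 16 * z ^ 2) * x ^ 4"

definition e2_poly :: "real \<Rightarrow> real \<Rightarrow> real" where
  "e2_poly x z =
        (266 + 2080 * z + 6670 * z ^ 2 + 11232 * z ^ 3 + 10472 * z ^ 4 + 5120 * z ^ 5 + 1024 * z ^ 6)
      + (732 + 4750 * z + 12172 * z ^ 2 + 15400 * z ^ 3 + 9616 * z ^ 4 + 2368 * z ^ 5) * x
      + (730 + 3732 * z + 7080 * z ^ 2 + 5904 * z ^ 3 + 1824 * z ^ 4) * x ^ 2
      + (312 + 1160 * z + 1424 * z ^ 2 + 576 * z ^ 3) * x ^ 3
      + (48 + 112 * z + 64 * z ^ 2) * x ^ 4"

definition e3_poly :: "real \<Rightarrow> real \<Rightarrow> real" where
  "e3_poly x z =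
        (734 + 6120 * z + 21180 * z ^ 2 + 39008 * z ^ 3 + 40368 * z ^ 4 + 22272 * z ^ 5 + 5120 * z ^ 6)
      + (1834 + 12528 * z + 34152 * z ^ 2 + 46512 * z ^ 3 + 31680 * z ^ 4 + 8640 * z ^ 5) * x
      + (1736 + 9336 * z + 18864 * z ^ 2 + 16992 * z ^ 3 + 5760 * z ^ 4) * x ^ 2
      + (728 + 2880 * z + 3840 * z ^ 2 + 1728 * z ^ 3) * x ^ 3
      + (112 + 288 * z + 192 * z ^ 2) * x ^ 4"

text \<open>
  The quotients of the kernel \<open>kern\<close> below under \<open>k \<mapsto> k + 1\<close> and under \<open>x
  \<mapsto> x + 1\<close>.
\<close>
definition ratio_k :: "real \<Rightarrow> real \<Rightarrow> real" where
  "ratio_k x z =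
     (2 * x + 6 * z + 3) * (2 * x + 6 * z + 5) * (2 * x + 6 * z + 7) * (x + z + 1) ^ 3 * (z + 1) ^ 3 /
     ((x + 2 * z + 2) ^ 3 * (x + 2 * z + 3) ^ 3 * (2 * z + 1) ^ 3)"

definition ratio_x :: "real \<Rightarrow> real \<Rightarrow> real" where
  "ratio_x x z = (2 * x + 6 * z + 3) * (x + z + 1) ^ 3 / ((2 * x + 3) * (x + 2 * z + 2) ^ 3)"

definition corr :: "nat \<Rightarrow> (real \<Rightarrow> real \<Rightarrow> real) \<Rightarrow> real \<Rightarrow> real \<Rightarrow> real" where
  "corr e p x z = (2 * x + 1) * p x z / (2 * (2 * z + 1) ^ e * (x + 2 * z + 2) ^ 3)"

definition cert :: "real \<Rightarrow> real \<Rightarrow> real" where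
  "cert x z = corr 3 cert_poly x z"

definition corr_dx ::
  "(real \<Rightarrow> real \<Rightarrow> real) \<Rightarrow> (real \<Rightarrow> real \<Rightarrow> real) \<Rightarrow> real \<Rightarrow> real \<Rightarrow> real" where
  "corr_dx p dp x z =
     ((2 - 3 * (2 * x + 1) / (x + 2 * z + 2)) * p x z + (2 * x + 1) * dp x z) /
     (2 * (2 * z + 1) ^ 3 * (x + 2 * z + 2) ^ 3)"

definition cert_dx :: "real \<Rightarrow> real \<Rightarrow> real" where
  "cert_dx x z = corr_dx cert_poly cert_poly_dx x z"

text \<open>
  The base pair, divided by the kernel: a rational function identity that becomes a polynomial identity once the
  denominators are cleared. It is stated for real \<open>x\<close> because the half-integers are needed too.
\<close>
lemma wz_base:
  fixes x z :: real
  assumes "x > - 1" "z \<ge> 0"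
  shows "ratio_k x z * (2 * x + 3 * z + 5) - (2 * x + 3 * z + 2) =
         cert x z - ratio_x x z * cert (x + 1) z"
proof -
  have nz: "x + 2 * z + 2 \<noteq> 0" "x + 2 * z + 3 \<noteq> 0" "2 * z + 1 \<noteq> 0" "2 * x + 3 \<noteq> 0"
    using assms by auto
  have eq: "x + 1 + 2 * z + 2 = x + 2 * z + 3" "2 * (x + 1) + 1 = 2 * x + 3"
    by auto
  show ?thesis
    unfolding ratio_k_def ratio_x_def cert_def corr_def eq
    apply (simp add: divide_simps nz)
    unfolding cert_poly_def by algebra
qed

text \<open>
  In a deformed pair the harmonic factor \<open>L\<close> cancels by \<open>wz_base\<close>, except for its
  increments, which are rational. What remains is the identity of this lemma: the first bracket is the increment
  of \<open>L\<close> in \<open>k\<close>, the second one its increment in \<open>n\<close>, and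
  \<open>phi\<close> is the rational part of \<open>F\<close>. The following lemmas are the analogues for the
  other directions.
\<close>
lemma wz_e1:
  fixes x z :: real
  assumes "x \<ge> 0" "z \<ge> 0"
  defines "phi \<equiv> \<lambda>x z. (2 * x + 3 * z + 2) * (2 / (2 * x + 1) - 1 / (x + 2 * z + 2)) - 1"
  shows "ratio_k x z * ((2 * x + 3 * z + 5) *
             (1 / (x + 2 * z + 3) + 1 / (x + 2 * z + 4) - 2 / (x + z + 1) + 1 / (z + 1) - 2 / (2 * z + 1))
           + phi x (z + 1)) - phi x z =
         - corr 4 e1_poly x z - ratio_x x z *
           (cert (x + 1) z * (1 / (x + 2 * z + 3) - 2 / (x + z + 1) + 2 / (2 * x + 1)) - corr 4 e1_poly (x + 1) z)"
proof -
  have nz: "x + 2 * z + 2 \<noteq> 0" "x + 2 * z + 3 \<noteq> 0" "x + 2 * z + 4 \<noteq> 0" "2 * z + 1 \<noteq> 0"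
      "z + 1 \<noteq> 0" "2 * x + 1 \<noteq> 0" "2 * x + 3 \<noteq> 0" "x + z + 1 \<noteq> 0"
    using assms by auto
  have eq: "x + 1 + 2 * z + 2 = x + 2 * z + 3" "x + 2 * (z + 1) + 2 = x + 2 * z + 4"
      "2 * (x + 1) + 1 = 2 * x + 3"
    by auto
  show ?thesis
    unfolding phi_def ratio_k_def ratio_x_def cert_def corr_def eq
    apply (simp add: divide_simps nz)
    unfolding cert_poly_def e1_poly_def by algebra
qed

lemma wz_e2:
  fixes x z :: real
  assumes "x \<ge> 0" "z \<ge> 0"
  defines "phi \<equiv> \<lambda>x z. (2 * x + 3 * z + 2) / (x + 2 * z + 2) ^ 2"
  shows "ratio_k x z * ((2 * x + 3 * z + 5) *
             (1 / (x + z + 1) ^ 2 + 1 / (z + 1) ^ 2 - 1 / (x + 2 * z + 3) ^ 2 - 1 / (x + 2 * z + 4) ^ 2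
              - 4 / (2 * z + 1) ^ 2)
           + phi x (z + 1)) - phi x z =
         - corr 5 e2_poly x z - ratio_x x z *
           (cert (x + 1) z * (1 / (x + z + 1) ^ 2 - 1 / (x + 2 * z + 3) ^ 2) - corr 5 e2_poly (x + 1) z)"
proof -
  have nz: "x + 2 * z + 2 \<noteq> 0" "x + 2 * z + 3 \<noteq> 0" "x + 2 * z + 4 \<noteq> 0" "2 * z + 1 \<noteq> 0"
      "z + 1 \<noteq> 0" "2 * x + 1 \<noteq> 0" "2 * x + 3 \<noteq> 0" "x + z + 1 \<noteq> 0"
    using assms by auto
  have eq: "x + 1 + 2 * z + 2 = x + 2 * z + 3" "x + 2 * (z + 1) + 2 = x + 2 * z + 4"
      "2 * (x + 1) + 1 = 2 * x + 3"
    by auto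
  show ?thesis
    unfolding phi_def ratio_k_def ratio_x_def cert_def corr_def eq
    apply (simp add: divide_simps nz)
    unfolding cert_poly_def e2_poly_def by algebra
qed

lemma wz_e3:
  fixes x z :: real
  assumes "x \<ge> 0" "z \<ge> 0"
  defines "phi \<equiv> \<lambda>x z. - (2 * x + 3 * z + 2) / (x + 2 * z + 2) ^ 3"
  shows "ratio_k x z * ((2 * x + 3 * z + 5) *
             (1 / (x + z + 1) ^ 3 + 1 / (z + 1) ^ 3 + 1 / (x + 2 * z + 3) ^ 3 + 1 / (x + 2 * z + 4) ^ 3
              - 8 / (2 * z + 1) ^ 3)
           + phi x (z + 1)) - phi x z =
         - corr 6 e3_poly x z - ratio_x x z *
           (cert (x + 1) z * (1 / (x + z + 1) ^ 3 + 1 / (x + 2 * z + 3) ^ 3) - corr 6 e3_poly (x + 1) z)"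
proof -
  have nz: "x + 2 * z + 2 \<noteq> 0" "x + 2 * z + 3 \<noteq> 0" "x + 2 * z + 4 \<noteq> 0" "2 * z + 1 \<noteq> 0"
      "z + 1 \<noteq> 0" "2 * x + 1 \<noteq> 0" "2 * x + 3 \<noteq> 0" "x + z + 1 \<noteq> 0"
    using assms by auto
  have eq: "x + 1 + 2 * z + 2 = x + 2 * z + 3" "x + 2 * (z + 1) + 2 = x + 2 * z + 4"
      "2 * (x + 1) + 1 = 2 * x + 3"
    by auto
  show ?thesis
    unfolding phi_def ratio_k_def ratio_x_def cert_def corr_def eq
    apply (simp add: divide_simps nz)
    unfolding cert_poly_def e3_poly_def by algebra
qed

lemma wz_shift:
  fixes x z :: real
  assumes "x \<ge> 0" "z \<ge> 0"
  defines "phi \<equiv> \<lambda>x z. 1 - (2 * x + 3 * z + 2) * (2 / (2 * x + 1))"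
  shows "ratio_k x z * ((2 * x + 3 * z + 5) *
             (3 / (x + z + 1) - 3 / (z + 1))
           + phi x (z + 1)) - phi x z =
         - corr 3 shift_poly x z - ratio_x x z *
           (cert (x + 1) z * (3 / (x + z + 1) - 2 / (2 * x + 1)) - corr 3 shift_poly (x + 1) z)"
proof -
  have nz: "x + 2 * z + 2 \<noteq> 0" "x + 2 * z + 3 \<noteq> 0" "x + 2 * z + 4 \<noteq> 0" "2 * z + 1 \<noteq> 0"
      "z + 1 \<noteq> 0" "2 * x + 1 \<noteq> 0" "2 * x + 3 \<noteq> 0" "x + z + 1 \<noteq> 0"
    using assms by auto
  have eq: "x + 1 + 2 * z + 2 = x + 2 * z + 3" "x + 2 * (z + 1) + 2 = x + 2 * z + 4"
      "2 * (x + 1) + 1 = 2 * x + 3"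
    by auto
  show ?thesis
    unfolding phi_def ratio_k_def ratio_x_def cert_def corr_def eq
    apply (simp add: divide_simps nz)
    unfolding cert_poly_def shift_poly_def by algebra
qed

text \<open>
  The \<open>x\<close>-derivative of \<open>wz_base\<close>; \<open>hk\<close> and \<open>hx\<close> are the
  logarithmic derivatives of \<open>ratio_k\<close> and \<open>ratio_x\<close>.
\<close>
lemma wz_base_dx:
  fixes x z :: real
  assumes "x \<ge> 0" "z \<ge> 0"

  defines "hk \<equiv> 2 / (2 * x + 6 * z + 3) + 2 / (2 * x + 6 * z + 5) + 2 / (2 * x + 6 * z + 7)
                      + 3 / (x + z + 1) - 3 / (x + 2 * z + 2) - 3 / (x + 2 * z + 3)"
    and "hx \<equiv> 2 / (2 * x + 6 * z + 3) + 3 / (x + z + 1) - 2 / (2 * x + 3) - 3 / (x + 2 * z + 2)"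
  shows "ratio_k x z * (hk * (2 * x + 3 * z + 5) + 2) - 2 =
         cert_dx x z - ratio_x x z * (hx * cert (x + 1) z + cert_dx (x + 1) z)"
proof -
  have nz: "x + 2 * z + 2 \<noteq> 0" "x + 2 * z + 3 \<noteq> 0" "x + 2 * z + 4 \<noteq> 0" "2 * z + 1 \<noteq> 0"
      "z + 1 \<noteq> 0" "2 * x + 1 \<noteq> 0" "2 * x + 3 \<noteq> 0" "x + z + 1 \<noteq> 0"
      "2 * x + 6 * z + 3 \<noteq> 0" "2 * x + 6 * z + 5 \<noteq> 0" "2 * x + 6 * z + 7 \<noteq> 0"
    using assms by auto
  have eq: "x + 1 + 2 * z + 2 = x + 2 * z + 3" "x + 2 * (z + 1) + 2 = x + 2 * z + 4"
      "2 * (x + 1) + 1 = 2 * x + 3"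
    by auto
  show ?thesis
    unfolding  hk_def hx_def ratio_k_def ratio_x_def cert_def corr_def cert_dx_def corr_dx_def eq
    apply (simp add: divide_simps nz)
    unfolding cert_poly_def shift_poly_def cert_poly_dx_def shift_poly_dx_def by algebra
qed

text \<open>
  The \<open>x\<close>-derivative of \<open>wz_shift\<close>.
\<close>
lemma wz_shift_dx:
  fixes x z :: real
  assumes "x \<ge> 0" "z \<ge> 0"
  defines "phi \<equiv> \<lambda>x z. 1 - (2 * x + 3 * z + 2) * (2 / (2 * x + 1))"
    and "dphi \<equiv> \<lambda>x z. 4 * (2 * x + 3 * z + 2) / (2 * x + 1) ^ 2 - 4 / (2 * x + 1)"
    and "Lk \<equiv> 3 / (x + z + 1) - 3 / (z + 1)"
    and "Lx \<equiv> 3 / (x + z + 1) - 2 / (2 * x + 1)"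
  defines "hk \<equiv> 2 / (2 * x + 6 * z + 3) + 2 / (2 * x + 6 * z + 5) + 2 / (2 * x + 6 * z + 7)
                      + 3 / (x + z + 1) - 3 / (x + 2 * z + 2) - 3 / (x + 2 * z + 3)"
    and "hx \<equiv> 2 / (2 * x + 6 * z + 3) + 3 / (x + z + 1) - 2 / (2 * x + 3) - 3 / (x + 2 * z + 2)"
  shows "ratio_k x z * (hk * ((2 * x + 3 * z + 5) * Lk + phi x (z + 1)) + 2 * Lk
           - (2 * x + 3 * z + 5) * (3 / (x + z + 1) ^ 2) + dphi x (z + 1)) - dphi x z =
         - corr_dx shift_poly shift_poly_dx x z - ratio_x x z *
           (hx * (cert (x + 1) z * Lx - corr 3 shift_poly (x + 1) z) + cert_dx (x + 1) z * Lx
            + cert (x + 1) z * (4 / (2 * x + 1) ^ 2 - 3 / (x + z + 1) ^ 2)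
            - corr_dx shift_poly shift_poly_dx (x + 1) z)"
proof -
  have nz: "x + 2 * z + 2 \<noteq> 0" "x + 2 * z + 3 \<noteq> 0" "x + 2 * z + 4 \<noteq> 0" "2 * z + 1 \<noteq> 0"
      "z + 1 \<noteq> 0" "2 * x + 1 \<noteq> 0" "2 * x + 3 \<noteq> 0" "x + z + 1 \<noteq> 0"
      "2 * x + 6 * z + 3 \<noteq> 0" "2 * x + 6 * z + 5 \<noteq> 0" "2 * x + 6 * z + 7 \<noteq> 0"
    using assms by auto
  have eq: "x + 1 + 2 * z + 2 = x + 2 * z + 3" "x + 2 * (z + 1) + 2 = x + 2 * z + 4"
      "2 * (x + 1) + 1 = 2 * x + 3"
    by auto
  show ?thesis
    unfolding phi_def dphi_def Lk_def Lx_def hk_def hx_def ratio_k_def ratio_x_def cert_def corr_def cert_dx_def corr_dx_def eq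
    apply (simp add: divide_simps nz)
    unfolding cert_poly_def shift_poly_def cert_poly_dx_def shift_poly_dx_def by algebra
qed

section \<open>Polynomial bounds for the certificates\<close>

text \<open>
  All bounds of this section hold coefficientwise: the difference of both sides, expanded, has no negative
  coefficient.
\<close>
lemma cert_poly_le:
  fixes x z :: real
  assumes "x \<ge> 0" "z \<ge> 0"
  shows "cert_poly x z \<le> 300 * ((z + 1) ^ 2 * (x + z + 1) ^ 4)"
proof -
  have "300 * ((z + 1) ^ 2 * (x + z + 1) ^ 4) - cert_poly x z =
        (230 + 1248 * z + 2712 * z ^ 2 + 2952 * z ^ 3 + 1614 * z ^ 4 + 360 * z ^ 5 + 4 * z ^ 6)
      + (1004 + 4716 * z + 8676 * z ^ 2 + 7748 * z ^ 3 + 3312 * z ^ 4 + 528 * z ^ 5) * x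
      + (1600 + 6156 * z + 8772 * z ^ 2 + 5464 * z ^ 3 + 1248 * z ^ 4) * x ^ 2
      + (1112 + 3258 * z + 3156 * z ^ 2 + 1008 * z ^ 3) * x ^ 3
      + (286 + 564 * z + 276 * z ^ 2) * x ^ 4"
    unfolding cert_poly_def by algebra
  also have "\<dots> \<ge> 0"
    using assms by (intro add_nonneg_nonneg mult_nonneg_nonneg zero_le_power) simp_all
  finally show ?thesis by simp
qed

lemma cert_poly_step:
  fixes x z :: real
  assumes "x \<ge> 0" "z \<ge> 0"
  shows "(z + 1) * (cert_poly x (z + 1) - cert_poly x z) \<le> 150 * cert_poly x z"
proof -
  have "150 * cert_poly x z - (z + 1) * (cert_poly x (z + 1) - cert_poly x z) =
        (490 + 39550 * z + 189660 * z ^ 2 + 380036 * z ^ 3 + 389396 * z ^ 4 + 202584 * z ^ 5 + 42624 * z ^ 6)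
      + (17180 + 146864 * z + 429480 * z ^ 2 + 584724 * z ^ 3 + 382368 * z ^ 4 + 97440 * z ^ 5) * x
      + (24640 + 139768 * z + 284208 * z ^ 2 + 249672 * z ^ 3 + 80592 * z ^ 4) * x ^ 2
      + (12222 + 48858 * z + 64560 * z ^ 2 + 28224 * z ^ 3) * x ^ 3
      + (2040 + 5292 * z + 3552 * z ^ 2) * x ^ 4"
    unfolding cert_poly_def by algebra
  also have "\<dots> \<ge> 0"
    using assms by (intro add_nonneg_nonneg mult_nonneg_nonneg zero_le_power) simp_all
  finally show ?thesis by simp
qed

lemma e1_poly_le:
  fixes x z :: real
  assumes "x \<ge> 0" "z \<ge> 0"
  shows "(z + 1) * e1_poly x z \<le> 3 * (cert_poly x z * (2 * z + 1))"
proof -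
  have "3 * (cert_poly x z * (2 * z + 1)) - (z + 1) * e1_poly x z =
        (58 + 704 * z + 3420 * z ^ 2 + 8784 * z ^ 3 + 13026 * z ^ 4 + 11232 * z ^ 5 + 5240 * z ^ 6 + 1024 * z ^ 7)
      + (224 + 2280 * z + 9096 * z ^ 2 + 18504 * z ^ 3 + 20440 * z ^ 4 + 11696 * z ^ 5 + 2720 * z ^ 6) * x
      + (284 + 2422 * z + 7754 * z ^ 2 + 11872 * z ^ 3 + 8784 * z ^ 4 + 2528 * z ^ 5) * x ^ 2
      + (146 + 1020 * z + 2480 * z ^ 2 + 2560 * z ^ 3 + 960 * z ^ 4) * x ^ 3
      + (26 + 144 * z + 240 * z ^ 2 + 128 * z ^ 3) * x ^ 4"
    unfolding cert_poly_def e1_poly_def by algebra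
  also have "\<dots> \<ge> 0"
    using assms by (intro add_nonneg_nonneg mult_nonneg_nonneg zero_le_power) simp_all
  finally show ?thesis by simp
qed

lemma e2_poly_le:
  fixes x z :: real
  assumes "x \<ge> 0" "z \<ge> 0"
  shows "(z + 1) * e2_poly x z \<le> 4 * (cert_poly x z * (2 * z + 1) ^ 2)"
proof -
  have "4 * (cert_poly x z * (2 * z + 1) ^ 2) - (z + 1) * e2_poly x z =
        (14 + 982 * z + 8354 * z ^ 2 + 31730 * z ^ 3 + 67216 * z ^ 4 + 85112 * z ^ 5 + 64256 * z ^ 6 + 26752 * z ^ 7 + 4736 * z ^ 8)
      + (52 + 2790 * z + 20054 * z ^ 2 + 63164 * z ^ 3 + 106952 * z ^ 4 + 101744 * z ^ 5 + 51392 * z ^ 6 + 10752 * z ^ 7) * x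
      + (70 + 2914 * z + 17204 * z ^ 2 + 43112 * z ^ 3 + 54704 * z ^ 4 + 34784 * z ^ 5 + 8832 * z ^ 6) * x ^ 2
      + (40 + 1304 * z + 6072 * z ^ 2 + 11344 * z ^ 3 + 9600 * z ^ 4 + 3072 * z ^ 5) * x ^ 3
      + (8 + 208 * z + 720 * z ^ 2 + 896 * z ^ 3 + 384 * z ^ 4) * x ^ 4"
    unfolding cert_poly_def e2_poly_def by algebra
  also have "\<dots> \<ge> 0"
    using assms by (intro add_nonneg_nonneg mult_nonneg_nonneg zero_le_power) simp_all
  finally show ?thesis by simp
qed

lemma e3_poly_le:
  fixes x z :: real
  assumes "x \<ge> 0" "z \<ge> 0"
  shows "(z + 1) * e3_poly x z \<le> 11 * (cert_poly x z * (2 * z + 1) ^ 3)"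
proof -
  have "11 * (cert_poly x z * (2 * z + 1) ^ 3) - (z + 1) * e3_poly x z =
        (36 + 3838 * z + 38040 * z ^ 2 + 170372 * z ^ 3 + 438130 * z ^ 4 + 703356 * z ^ 5 + 720080 * z ^ 6 + 458464 * z ^ 7 + 165792 * z ^ 8 + 26048 * z ^ 9)
      + (322 + 12698 * z + 100500 * z ^ 2 + 372228 * z ^ 3 + 783768 * z ^ 4 + 998256 * z ^ 5 + 764704 * z ^ 6 + 325248 * z ^ 7 + 59136 * z ^ 8) * x
      + (464 + 13612 * z + 89412 * z ^ 2 + 272496 * z ^ 3 + 457464 * z ^ 4 + 438288 * z ^ 5 + 225632 * z ^ 6 + 48576 * z ^ 7) * x ^ 2
      + (240 + 5962 * z + 32352 * z ^ 2 + 78736 * z ^ 3 + 99648 * z ^ 4 + 64416 * z ^ 5 + 16896 * z ^ 6) * x ^ 3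
      + (42 + 920 * z + 4008 * z ^ 2 + 7376 * z ^ 3 + 6336 * z ^ 4 + 2112 * z ^ 5) * x ^ 4"
    unfolding cert_poly_def e3_poly_def by algebra
  also have "\<dots> \<ge> 0"
    using assms by (intro add_nonneg_nonneg mult_nonneg_nonneg zero_le_power) simp_all
  finally show ?thesis by simp
qed

lemma shift_poly_le:
  fixes x z :: real
  assumes "x \<ge> 0" "z \<ge> 0"
  shows "(z + 1) * shift_poly x z \<le> 2 * cert_poly x z"
proof -
  have "2 * cert_poly x z - (z + 1) * shift_poly x z =
        (140 + 1104 * z + 3576 * z ^ 2 + 6096 * z ^ 3 + 5772 * z ^ 4 + 2880 * z ^ 5 + 592 * z ^ 6)
      + (308 + 2028 * z + 5292 * z ^ 2 + 6836 * z ^ 3 + 4368 * z ^ 4 + 1104 * z ^ 5) * x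
      + (236 + 1264 * z + 2532 * z ^ 2 + 2240 * z ^ 3 + 736 * z ^ 4) * x ^ 2
      + (74 + 318 * z + 456 * z ^ 2 + 216 * z ^ 3) * x ^ 3
      + (8 + 28 * z + 24 * z ^ 2) * x ^ 4"
    unfolding cert_poly_def shift_poly_def by algebra
  also have "\<dots> \<ge> 0"
    using assms by (intro add_nonneg_nonneg mult_nonneg_nonneg zero_le_power) simp_all
  finally show ?thesis by simp
qed

lemma cert_poly_dx_le:
  fixes x z :: real
  assumes "x \<ge> 0" "z \<ge> 0"
  shows "(x + 1) * cert_poly_dx x z \<le> 4 * cert_poly x z"
proof -
  have "4 * cert_poly x z - (x + 1) * cert_poly_dx x z =
        (84 + 924 * z + 3828 * z ^ 2 + 7940 * z ^ 3 + 8856 * z ^ 4 + 5088 * z ^ 5 + 1184 * z ^ 6)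
      + (188 + 1764 * z + 5916 * z ^ 2 + 9284 * z ^ 3 + 6960 * z ^ 4 + 2016 * z ^ 5) * x
      + (136 + 1062 * z + 2724 * z ^ 2 + 2896 * z ^ 3 + 1104 * z ^ 4) * x ^ 2
      + (32 + 198 * z + 348 * z ^ 2 + 192 * z ^ 3) * x ^ 3"
    unfolding cert_poly_def cert_poly_dx_def by algebra
  also have "\<dots> \<ge> 0"
    using assms by (intro add_nonneg_nonneg mult_nonneg_nonneg zero_le_power) simp_all
  finally show ?thesis by simp
qed

lemma shift_poly_dx_le:
  fixes x z :: real
  assumes "x \<ge> 0" "z \<ge> 0"
  shows "(x + 1) * shift_poly_dx x z \<le> 6 * cert_poly x z"
proof -
  have "6 * cert_poly x z - (x + 1) * shift_poly_dx x z =
        (336 + 2856 * z + 9828 * z ^ 2 + 17520 * z ^ 3 + 17076 * z ^ 4 + 8640 * z ^ 5 + 1776 * z ^ 6)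
      + (764 + 5928 * z + 17316 * z ^ 2 + 24008 * z ^ 3 + 15888 * z ^ 4 + 4032 * z ^ 5) * x
      + (566 + 4152 * z + 9936 * z ^ 2 + 9680 * z ^ 3 + 3312 * z ^ 4) * x ^ 2
      + (142 + 1164 * z + 2160 * z ^ 2 + 1152 * z ^ 3) * x ^ 3
      + (4 + 120 * z + 144 * z ^ 2) * x ^ 4"
    unfolding cert_poly_def shift_poly_dx_def by algebra
  also have "\<dots> \<ge> 0"
    using assms by (intro add_nonneg_nonneg mult_nonneg_nonneg zero_le_power) simp_all
  finally show ?thesis by simp
qed

section \<open>Column sums of the base pair\<close>

text \<open>
  In closed form this is \<open>(x + 3/2)\<^bsub>3k\<^esub> k!\<^sup>3\<close> divided by the third power of
  \<open>(x + k + 1)\<^bsub>k+1\<^esub> (1/2)\<^bsub>k\<^esub>\<close>, in terms of rising factorials. It is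
  rational in \<open>x\<close>, so that \<open>x\<close> may be a half-integer.
\<close>
primrec kern :: "real \<Rightarrow> nat \<Rightarrow> real" where
  "kern x 0 = 1 / (x + 1) ^ 3"
| "kern x (Suc k) = kern x k * ratio_k x (real k)"

lemma ratio_k_pos: "x > - 1 \<Longrightarrow> z \<ge> 0 \<Longrightarrow> ratio_k x z > 0"
  unfolding ratio_k_def by (intro divide_pos_pos mult_pos_pos zero_less_power) auto

lemma kern_pos: "x > - 1 \<Longrightarrow> kern x k > 0"
  by (induction k) (auto intro!: divide_pos_pos mult_pos_pos ratio_k_pos)

lemma kern_shift:
  assumes "x > - 1"
  shows "kern (x + 1) k = kern x k * ratio_x x (real k)"
proof (induction k)
  case 0
  have "x + 1 \<noteq> 0" "x + 2 \<noteq> 0" "2 * x + 3 \<noteq> 0" "x + 1 + 1 = x + 2"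
    using assms by auto
  then show ?case
    by (simp add: ratio_x_def divide_simps add.commute)
next
  case (Suc k)
  have *: "ratio_k (x + 1) z * ratio_x x z = ratio_x x (z + 1) * ratio_k x z" if "z \<ge> 0" for z
  proof -
    have nz: "x + 2 * z + 2 \<noteq> 0" "x + 2 * z + 3 \<noteq> 0" "x + 2 * z + 4 \<noteq> 0" "2 * z + 1 \<noteq> 0" "2 * x + 3 \<noteq> 0"
      using assms that by auto
    have eq: "x + 1 + 2 * z + 2 = x + 2 * z + 3" "x + 1 + 2 * z + 3 = x + 2 * z + 4"
        "x + 2 * (z + 1) + 2 = x + 2 * z + 4" "x + 1 + z + 1 = x + z + 2" "x + (z + 1) + 1 = x + z + 2"
        "2 * (x + 1) + 6 * z + 3 = 2 * x + 6 * z + 5" "2 * (x + 1) + 6 * z + 5 = 2 * x + 6 * z + 7"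
        "2 * (x + 1) + 6 * z + 7 = 2 * x + 6 * z + 9" "2 * x + 6 * (z + 1) + 3 = 2 * x + 6 * z + 9"
      by auto
    show ?thesis
      unfolding ratio_k_def ratio_x_def eq times_divide_times_eq
      by (rule arg_cong2[where f = "(/)"]) (simp_all only: mult_ac)
  qed
  have "kern (x + 1) (Suc k) = kern x k * (ratio_k (x + 1) (real k) * ratio_x x (real k))"
    using Suc by simp
  also have "\<dots> = kern x (Suc k) * ratio_x x (real (Suc k))"
    by (subst *) (auto simp: add.commute)
  finally show ?case .
qed

text \<open>
  The quotient \<open>ratio_k\<close> tends to \<open>27/64\<close>.
\<close>
lemma summable_kern_powers:
  assumes "x > - 1"
  shows "summable (\<lambda>k. (real k + 1) ^ p * kern x k)"
proof -
  have "(\<lambda>k. ratio_k x (real k)) \<longlonglongrightarrow> 27 / 64"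
    unfolding ratio_k_def by real_asymp
  moreover have "(\<lambda>k. (real k + 2) / (real k + 1)) \<longlonglongrightarrow> 1"
    by real_asymp
  ultimately have "(\<lambda>k. ((real k + 2) / (real k + 1)) ^ p * ratio_k x (real k)) \<longlonglongrightarrow> 1 ^ p * (27 / 64)"
    by (intro tendsto_mult tendsto_power)
  then have "\<forall>\<^sub>F k in sequentially. ((real k + 2) / (real k + 1)) ^ p * ratio_k x (real k) < 1 / 2"
    by (rule order_tendstoD) simp
  then obtain N where N: "\<And>k. k \<ge> N \<Longrightarrow> ((real k + 2) / (real k + 1)) ^ p * ratio_k x (real k) < 1 / 2"
    by (auto simp: eventually_at_top_linorder)
  show ?thesis
  proof (rule summable_ratio_test[where c = "1 / 2"])
    fix k assume "k \<ge> N"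
    have "(real (Suc k) + 1) ^ p * kern x (Suc k) =
        ((real k + 2) / (real k + 1)) ^ p * ratio_k x (real k) * ((real k + 1) ^ p * kern x k)"
      by (simp add: power_divide add.commute)
    also have "\<dots> \<le> 1 / 2 * ((real k + 1) ^ p * kern x k)"
      using N[OF \<open>k \<ge> N\<close>] kern_pos[OF assms, of k] by (intro mult_right_mono) auto
    finally show "norm ((real (Suc k) + 1) ^ p * kern x (Suc k)) \<le> 1 / 2 * norm ((real k + 1) ^ p * kern x k)"
      using kern_pos[OF assms] by (simp add: less_imp_le del: kern.simps)
  qed simp
qed

lemma tendsto_kern_poly:
  assumes "x > - 1" "\<And>k. \<bar>A k\<bar> \<le> C * (real k + 1) ^ p"
  shows "(\<lambda>k. kern x k * A k) \<longlonglongrightarrow> 0"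
proof (rule Lim_null_comparison)
  show "\<forall>\<^sub>F k in sequentially. norm (kern x k * A k) \<le> C * ((real k + 1) ^ p * kern x k)"
    using assms(2) kern_pos[OF assms(1)]
    by (intro always_eventually allI) (auto simp: abs_mult mult.commute less_imp_le mult.left_commute intro!: mult_left_mono)
  show "(\<lambda>k. C * ((real k + 1) ^ p * kern x k)) \<longlonglongrightarrow> 0"
    using tendsto_mult[OF tendsto_const summable_LIMSEQ_zero[OF summable_kern_powers[OF assms(1)]], of C p] by simp
qed

text \<open>
  Summation of the pair over \<open>k\<close> turns column \<open>n\<close> into column \<open>n + 1\<close>.
\<close>
lemma telescoped_column_sums:
  fixes F G :: "nat \<Rightarrow> nat \<Rightarrow> real"
  assumes wz: "\<And>n k. F n (Suc k) - F n k = G n k - G (Suc n) k"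
    and lim: "\<And>n. F n \<longlonglongrightarrow> 0"
    and summ: "\<And>n. summable (G n)"
  shows "suminf (G N) = suminf (G 0) + (\<Sum>n<N. F n 0)"
proof (induction N)
  case (Suc N)
  have "(\<lambda>k. F N (Suc k) - F N k) sums (0 - F N 0)"
    by (rule telescope_sums[OF lim])
  moreover have "(\<lambda>k. F N (Suc k) - F N k) sums (suminf (G N) - suminf (G (Suc N)))"
    unfolding wz by (intro sums_diff summable_sums summ)
  ultimately have "0 - F N 0 = suminf (G N) - suminf (G (Suc N))"
    by (rule sums_unique2)
  then show ?case using Suc by simp
qed simp

text \<open>
  The second half of the base pair, regarded as a positive measure on the \<open>k\<close>-axis.
\<close>
definition mass :: "real \<Rightarrow> nat \<Rightarrow> real" where
  "mass x k = kern x k * cert x (real k)"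

lemma cert_poly_pos: "x \<ge> 0 \<Longrightarrow> z \<ge> 0 \<Longrightarrow> cert_poly x z > 0"
  unfolding cert_poly_def
  by (intro add_pos_nonneg mult_nonneg_nonneg add_nonneg_nonneg zero_le_power) simp_all

lemma cert_pos: "x \<ge> 0 \<Longrightarrow> z \<ge> 0 \<Longrightarrow> cert x z > 0"
  unfolding cert_def corr_def
  by (intro divide_pos_pos mult_pos_pos cert_poly_pos zero_less_power) auto

lemma mass_pos: "x \<ge> 0 \<Longrightarrow> mass x k > 0"
  unfolding mass_def by (intro mult_pos_pos kern_pos cert_pos) auto

text \<open>
  This is where the half-integer lattice has its natural boundary.
\<close>
lemma mass_half: "mass (- (1 / 2)) = (\<lambda>_. 0)"
  by (simp add: mass_def cert_def corr_def fun_eq_iff)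

lemma cert_le:
  assumes "x \<ge> 0" "z \<ge> 0"
  shows "cert x z \<le> 300 * (x + 1) ^ 2 * (z + 1) ^ 2"
proof -
  have "cert x z \<le> (2 * (x + z + 1)) * (300 * ((z + 1) ^ 2 * (x + z + 1) ^ 4)) / (2 * (z + 1) ^ 3 * (x + z + 1) ^ 3)"
    unfolding cert_def corr_def using assms
    by (intro frac_le mult_mono power_mono cert_poly_le mult_nonneg_nonneg zero_le_power) (auto intro!: less_imp_le[OF cert_poly_pos])
  also have "\<dots> = 300 * (x + z + 1) ^ 2 / (z + 1)"
    using assms by (simp add: divide_simps add_nonneg_eq_0_iff) algebra
  also have "\<dots> \<le> 300 * (x + z + 1) ^ 2 / 1"
    using assms by (intro divide_left_mono) auto
  also have "\<dots> \<le> 300 * ((x + 1) * (z + 1)) ^ 2"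
  proof -
    have "x + z + 1 \<le> (x + 1) * (z + 1)"
      using assms by (simp add: algebra_simps)
    then show ?thesis using assms by (simp add: power_mono)
  qed
  finally show ?thesis by (simp add: power_mult_distrib)
qed

lemma wz_base_kern:
  assumes "x > - 1"
  shows "kern x (Suc k) * (2 * x + 3 * real (Suc k) + 2) - kern x k * (2 * x + 3 * real k + 2) =
         mass x k - mass (x + 1) k"
proof -
  have "mass x k - mass (x + 1) k = kern x k * (cert x (real k) - ratio_x x (real k) * cert (x + 1) (real k))"
    by (simp only: mass_def kern_shift[OF assms] right_diff_distrib mult.assoc)
  also have "\<dots> = kern x k * (ratio_k x (real k) * (2 * x + 3 * real k + 5) - (2 * x + 3 * real k + 2))"
    using wz_base[of x "real k"] assms by simp
  finally show ?thesis
    by (simp add: algebra_simps)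
qed

lemma summable_mass_powers:
  assumes "x \<ge> 0"
  shows "summable (\<lambda>k. (real k + 1) ^ p * mass x k)"
proof (rule summable_comparison_test)
  show "\<exists>N. \<forall>k\<ge>N. norm ((real k + 1) ^ p * mass x k) \<le> 300 * (x + 1) ^ 2 * ((real k + 1) ^ (p + 2) * kern x k)"
  proof (intro exI allI impI)
    fix k :: nat
    have "(real k + 1) ^ p * mass x k \<le> (real k + 1) ^ p * (kern x k * (300 * (x + 1) ^ 2 * (real k + 1) ^ 2))"
      unfolding mass_def using assms by (intro mult_left_mono cert_le less_imp_le[OF kern_pos]) auto
    then show "norm ((real k + 1) ^ p * mass x k) \<le> 300 * (x + 1) ^ 2 * ((real k + 1) ^ (p + 2) * kern x k)"
      using mass_pos[OF assms, of k] by (simp add: abs_mult power_add power2_eq_square mult_ac)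
  qed
  show "summable (\<lambda>k. 300 * (x + 1) ^ 2 * ((real k + 1) ^ (p + 2) * kern x k))"
    using assms by (intro summable_mult summable_kern_powers) auto
qed

lemma summable_mass: "x \<ge> 0 \<or> x = - (1 / 2) \<Longrightarrow> summable (mass x)"
  using summable_mass_powers[of x 0] by (auto simp: mass_half)

lemma column_mass:
  assumes "x \<ge> 0 \<or> x = - (1 / 2)"
  shows "suminf (mass (x + real N)) = suminf (mass x) + (\<Sum>n<N. 2 / (x + real n + 1) ^ 2)"
proof -
  have pos: "x + real n > - 1" "x + real n \<ge> 0 \<or> x + real n = - (1 / 2)" for n
    using assms by (cases n; auto)+
  have "suminf (mass (x + real N)) = suminf (mass (x + real 0)) +
      (\<Sum>n<N. kern (x + real n) 0 * (2 * (x + real n) + 3 * real 0 + 2))"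
  proof (rule telescoped_column_sums)
    show "kern (x + real n) (Suc k) * (2 * (x + real n) + 3 * real (Suc k) + 2) -
          kern (x + real n) k * (2 * (x + real n) + 3 * real k + 2) =
          mass (x + real n) k - mass (x + real (Suc n)) k" for n k
      using wz_base_kern[OF pos(1)] by (simp add: add_ac)
    show "(\<lambda>k. kern (x + real n) k * (2 * (x + real n) + 3 * real k + 2)) \<longlonglongrightarrow> 0" for n
    proof (rule tendsto_kern_poly[OF pos(1), of _ "2 * (x + real n) + 5" 1])
      fix k
      have "real k * (2 * (x + real n) + 5) \<ge> real k * 3"
        using pos(1)[of n] by (intro mult_left_mono) auto
      then show "\<bar>2 * (x + real n) + 3 * real k + 2\<bar> \<le> (2 * (x + real n) + 5) * (real k + 1) ^ 1"
        using pos(1)[of n] by (simp add: algebra_simps)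
    qed
    show "summable (mass (x + real n))" for n
      by (rule summable_mass[OF pos(2)])
  qed
  also have "(\<Sum>n<N. kern (x + real n) 0 * (2 * (x + real n) + 3 * real 0 + 2)) = (\<Sum>n<N. 2 / (x + real n + 1) ^ 2)"
  proof (rule sum.cong[OF refl])
    fix n
    have "x + real n + 1 \<noteq> 0" using pos(1)[of n] by linarith
    then show "kern (x + real n) 0 * (2 * (x + real n) + 3 * real 0 + 2) = 2 / (x + real n + 1) ^ 2"
      by (simp add: divide_simps) algebra
  qed
  finally show ?thesis by simp
qed

lemma frac_cross_le:
  fixes a b c d :: real
  shows "0 < b \<Longrightarrow> 0 < d \<Longrightarrow> a * d \<le> c * b \<Longrightarrow> a / b \<le> c / d"
  by (simp add: divide_simps mult.commute)

lemma ratio_factor_mono: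
  fixes x y z c :: real
  assumes "0 \<le> x" "x \<le> y" "0 \<le> z" "0 \<le> c" "c \<le> 8"
  shows "(2 * x + 6 * z + c) * (x + z + 1) / ((x + 2 * z + 2) * (x + 2 * z + 3)) \<le>
         (2 * y + 6 * z + c) * (y + z + 1) / ((y + 2 * z + 2) * (y + 2 * z + 3))"
proof -
  have "(2 * y + 6 * z + c) * (y + z + 1) * ((x + 2 * z + 2) * (x + 2 * z + 3)) -
        (2 * x + 6 * z + c) * (x + z + 1) * ((y + 2 * z + 2) * (y + 2 * z + 3)) =
        (y - x) * ((8 - c) * (x * y) + (z + 1) * (2 * z + 4 + (8 - c)) * (x + y) + (z + 1) * (8 * z ^ 2 + 26 * z + 12 + c))"
    by algebra
  also have "\<dots> \<ge> 0"
    using assms by (intro mult_nonneg_nonneg add_nonneg_nonneg) simp_all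
  finally show ?thesis
    using assms by (intro frac_cross_le mult_pos_pos) auto
qed

lemma ratio_k_factors:
  "ratio_k x z =
     (2 * x + 6 * z + 3) * (x + z + 1) / ((x + 2 * z + 2) * (x + 2 * z + 3)) *
     ((2 * x + 6 * z + 5) * (x + z + 1) / ((x + 2 * z + 2) * (x + 2 * z + 3))) *
     ((2 * x + 6 * z + 7) * (x + z + 1) / ((x + 2 * z + 2) * (x + 2 * z + 3))) *
     ((z + 1) ^ 3 / (2 * z + 1) ^ 3)"
  unfolding ratio_k_def times_divide_times_eq
  by (rule arg_cong2[where f = "(/)"]) (simp_all add: power3_eq_cube mult_ac)

lemma ratio_k_mono:
  assumes "0 \<le> x" "x \<le> y" "0 \<le> z"
  shows "ratio_k x z \<le> ratio_k y z"
  unfolding ratio_k_factors using assms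
  by (intro mult_mono ratio_factor_mono mult_nonneg_nonneg divide_nonneg_nonneg) auto

text \<open>
  Every factor \<open>ratio_k\<close> increases with \<open>x\<close>, and the cube cancels the decreasing initial
  value.
\<close>
lemma kern_mono:
  assumes "0 \<le> x" "x \<le> y"
  shows "kern x k * (x + 1) ^ 3 \<le> kern y k * (y + 1) ^ 3"
proof (induction k)
  case (Suc k)
  have "kern x k * (x + 1) ^ 3 * ratio_k x (real k) \<le> kern y k * (y + 1) ^ 3 * ratio_k y (real k)"
    using assms
    by (intro mult_mono Suc ratio_k_mono mult_nonneg_nonneg less_imp_le[OF ratio_k_pos] less_imp_le[OF kern_pos]) auto
  then show ?case by (simp add: mult_ac)
qed (use assms in auto)

lemma cert_poly_mono:
  assumes "0 \<le> x" "x \<le> y" "0 \<le> z"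
  shows "cert_poly x z \<le> cert_poly y z"
  unfolding cert_poly_def using assms
  by (intro add_mono mult_left_mono power_mono add_nonneg_nonneg mult_nonneg_nonneg) simp_all

text \<open>
  By \<open>kern_mono\<close> the mass can decrease with \<open>x\<close> only through the six linear factors
  which are divided out here.
\<close>
lemma mass_half_step:
  assumes "0 \<le> x"
  shows "((x + 1) / (x + 3 / 2)) ^ 6 * mass x k \<le> mass (x + 1 / 2) k"
proof -
  define z where "z = real k"
  have z: "z \<ge> 0" by (simp add: z_def)
  define w where "w x = (2 * x + 1) * cert_poly x z / (2 * (2 * z + 1) ^ 3)" for x
  have w_mono: "w x \<le> w (x + 1 / 2)" and w_nonneg: "w x \<ge> 0"
    unfolding w_def using assms z
    by (intro divide_right_mono mult_mono cert_poly_mono divide_nonneg_nonneg mult_nonneg_nonneg less_imp_le[OF cert_poly_pos]; simp)+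
  have mass_eq: "mass y k = kern y k * (y + 1) ^ 3 * w y / ((y + 1) ^ 3 * (y + 2 * z + 2) ^ 3)" if "y \<ge> 0" for y
    using that by (simp add: mass_def cert_def corr_def w_def z_def mult_ac)
  have "((x + 1) / (x + 3 / 2)) ^ 6 * mass x k =
      kern x k * (x + 1) ^ 3 * w x * (((x + 1) / (x + 3 / 2)) ^ 6 / ((x + 1) ^ 3 * (x + 2 * z + 2) ^ 3))"
    using assms by (simp add: mass_eq)
  also have "\<dots> \<le> kern (x + 1 / 2) k * (x + 1 / 2 + 1) ^ 3 * w (x + 1 / 2) *
      (1 / ((x + 1 / 2 + 1) ^ 3 * (x + 1 / 2 + 2 * z + 2) ^ 3))"
  proof (rule mult_mono[OF mult_mono[OF kern_mono w_mono]])
    have "((x + 1) / (x + 3 / 2)) ^ 6 / ((x + 1) ^ 3 * (x + 2 * z + 2) ^ 3) =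
        1 / (x + 3 / 2) ^ 3 * ((x + 1) / ((x + 3 / 2) * (x + 2 * z + 2))) ^ 3"
      using assms by (simp add: power_divide divide_simps power_mult_distrib) algebra
    also have "\<dots> \<le> 1 / (x + 3 / 2) ^ 3 * (1 / (x + 1 / 2 + 2 * z + 2)) ^ 3"
    proof (intro mult_left_mono power_mono)
      show "(x + 1) / ((x + 3 / 2) * (x + 2 * z + 2)) \<le> 1 / (x + 1 / 2 + 2 * z + 2)"
      proof (rule frac_cross_le)
        have "1 * ((x + 3 / 2) * (x + 2 * z + 2)) - (x + 1) * (x + 1 / 2 + 2 * z + 2) = z + 1 / 2"
          by algebra
        then show "(x + 1) * (x + 1 / 2 + 2 * z + 2) \<le> 1 * ((x + 3 / 2) * (x + 2 * z + 2))"
          using z by linarith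
      qed (use assms z in \<open>auto intro!: mult_pos_pos\<close>)
    qed (use assms z in auto)
    finally show "((x + 1) / (x + 3 / 2)) ^ 6 / ((x + 1) ^ 3 * (x + 2 * z + 2) ^ 3) \<le>
        1 / ((x + 1 / 2 + 1) ^ 3 * (x + 1 / 2 + 2 * z + 2) ^ 3)"
      by (simp add: power_divide add_ac)
  qed (use assms z w_nonneg w_mono in \<open>auto intro!: mult_nonneg_nonneg less_imp_le[OF kern_pos]\<close>)
  also have "\<dots> = mass (x + 1 / 2) k"
    using assms by (simp add: mass_eq)
  finally show ?thesis .
qed

lemma suminf_mass_half_step:
  assumes "0 \<le> x"
  shows "((x + 1) / (x + 3 / 2)) ^ 6 * suminf (mass x) \<le> suminf (mass (x + 1 / 2))"
  using assms by (subst suminf_mult[symmetric])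
    (auto intro!: suminf_le mass_half_step summable_mult summable_mass)

lemma column_mass_half_LIMSEQ: "(\<lambda>n. suminf (mass (real n + 1 / 2))) \<longlonglongrightarrow> pi\<^sup>2"
proof -
  have "(\<lambda>n. \<Sum>i<n. 2 / (- (1 / 2) + real i + 1) ^ 2) \<longlonglongrightarrow> 2 * (3 * zeta_nat 2)"
    using sums_mult[OF half_sums[of 2], of 2] by (simp add: sums_def add.commute)
  moreover have "suminf (mass (- (1 / 2) + real n)) = (\<Sum>i<n. 2 / (- (1 / 2) + real i + 1) ^ 2)" for n
    using column_mass[OF disjI2[OF refl], of n] by (simp only: mass_half suminf_zero add_0)
  ultimately have "(\<lambda>n. suminf (mass (- (1 / 2) + real n))) \<longlonglongrightarrow> pi\<^sup>2"
    by (simp add: zeta_2)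
  from LIMSEQ_Suc[OF this] show ?thesis
    by (simp add: add_ac)
qed

text \<open>
  By \<open>mass_half_step\<close> the column sums at integers and at half-integers interlace up to factors
  tending to 1, hence have the same limit.
\<close>
lemma column_mass_LIMSEQ: "(\<lambda>n. suminf (mass (real n))) \<longlonglongrightarrow> pi\<^sup>2"
proof -
  have "(\<lambda>i. 2 * (1 / (real i + 1) ^ 2)) sums (2 * zeta_nat 2)"
    using zeta_nat_sums[of 2] by (intro sums_mult) (simp add: add.commute)
  then have "(\<lambda>n. suminf (mass 0) + (\<Sum>i<n. 2 / (0 + real i + 1) ^ 2)) \<longlonglongrightarrow> suminf (mass 0) + 2 * zeta_nat 2"
    by (intro tendsto_intros) (simp add: sums_def)
  then have lim: "(\<lambda>n. suminf (mass (real n))) \<longlonglongrightarrow> suminf (mass 0) + 2 * zeta_nat 2" (is "_ \<longlonglongrightarrow> ?l")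
    using column_mass[of 0] by simp
  have 1: "(\<lambda>n. ((real n + 1) / (real n + 3 / 2)) ^ 6) \<longlonglongrightarrow> 1"
      "(\<lambda>n. ((real n + 1 / 2 + 1) / (real n + 1 / 2 + 3 / 2)) ^ 6) \<longlonglongrightarrow> 1"
    by real_asymp+
  \<comment> \<open>Stepping from integers to half-integers bounds the limit from above, the next step from below.\<close>
  have "1 * ?l \<le> pi\<^sup>2"
    by (rule LIMSEQ_le[OF tendsto_mult[OF 1(1) lim] column_mass_half_LIMSEQ])
       (intro exI allI impI suminf_mass_half_step; simp)
  moreover have "1 * pi\<^sup>2 \<le> ?l"
  proof (rule LIMSEQ_le[OF tendsto_mult[OF 1(2) column_mass_half_LIMSEQ] LIMSEQ_Suc[OF lim]])
    have "((real n + 1 / 2 + 1) / (real n + 1 / 2 + 3 / 2)) ^ 6 * suminf (mass (real n + 1 / 2)) \<le> suminf (mass (real (Suc n)))" for n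
      using suminf_mass_half_step[of "real n + 1 / 2"] by (simp add: add_ac)
    then show "\<exists>N. \<forall>n\<ge>N. ((real n + 1 / 2 + 1) / (real n + 1 / 2 + 3 / 2)) ^ 6 * suminf (mass (real n + 1 / 2)) \<le> suminf (mass (real (Suc n)))"
      by blast
  qed
  ultimately show ?thesis using lim by simp
qed

section \<open>Concentration of the columns\<close>

text \<open>
  For \<open>k\<close> much smaller than \<open>x\<close> the decay of the kernel in \<open>k\<close> is governed
  by the exponential of \<open>- k\<^sup>3 / x\<^sup>2\<close>. The exponent, adjusted for large \<open>k\<close>,
  measures how far \<open>k\<close> lies beyond the bulk of column \<open>x\<close>.
\<close>
definition spread :: "real \<Rightarrow> nat \<Rightarrow> real" where
  "spread x k = (real k + 1) ^ 3 / (x + real k + 2) ^ 2"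

lemma spread_nonneg: "x \<ge> 0 \<Longrightarrow> spread x k \<ge> 0"
  by (simp add: spread_def)

text \<open>
  Each of the three factors of \<open>ratio_k\<close> is at most twice the first bracket; it suffices to use this
  for one of them and the bound 2 for the others.
\<close>
lemma ratio_k_le:
  assumes "x \<ge> 0" "z \<ge> 0"
  shows "ratio_k x z \<le> (1 - (z + 1) ^ 2 / ((x + 2 * z + 2) * (x + 2 * z + 3))) * (8 * (z + 1) ^ 3 / (2 * z + 1) ^ 3)"
proof -
  define d where "d = (x + 2 * z + 2) * (x + 2 * z + 3)"
  have d: "d > 0" using assms by (simp add: d_def)
  have s: "(z + 1) ^ 2 / d \<ge> 0" using d by simp
  have factor: "(2 * x + 6 * z + c) * (x + z + 1) / d \<le> 2 * (1 - (z + 1) ^ 2 / d)" if "c \<le> 7" for c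
  proof -
    have "2 * (d - (z + 1) ^ 2) - (2 * x + 6 * z + c) * (x + z + 1) = (8 - c) * x + (z + 1) * (10 - c)"
      unfolding d_def by algebra
    also have "\<dots> \<ge> 0"
      using assms that by (intro add_nonneg_nonneg mult_nonneg_nonneg) auto
    finally show ?thesis
      using d by (simp add: divide_simps)
  qed
  have pos: "(2 * x + 6 * z + c) * (x + z + 1) / d \<ge> 0" if "c \<ge> 0" for c
    using assms d that by (intro divide_nonneg_pos mult_nonneg_nonneg) auto
  have s1: "1 - (z + 1) ^ 2 / d \<ge> 0"
    using pos[of 3] factor[of 3] by simp
  have factor2: "(2 * x + 6 * z + c) * (x + z + 1) / d \<le> 2" if "c \<le> 7" for c
    by (rule order_trans[OF factor[OF that]]) (use d in simp)
  have "ratio_k x z = (2 * x + 6 * z + 3) * (x + z + 1) / d * ((2 * x + 6 * z + 5) * (x + z + 1) / d) *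
      ((2 * x + 6 * z + 7) * (x + z + 1) / d) * ((z + 1) ^ 3 / (2 * z + 1) ^ 3)"
    unfolding ratio_k_factors d_def ..
  also have "\<dots> \<le> (2 * (1 - (z + 1) ^ 2 / d)) * 2 * 2 * ((z + 1) ^ 3 / (2 * z + 1) ^ 3)"
    using assms d s s1 factor[of 3] factor2[of 5] factor2[of 7] pos[of 3] pos[of 5] pos[of 7]
    by (intro mult_mono mult_nonneg_nonneg divide_nonneg_nonneg zero_le_power) auto
  also have "\<dots> = (1 - (z + 1) ^ 2 / d) * (8 * (z + 1) ^ 3 / (2 * z + 1) ^ 3)"
    by simp
  finally show ?thesis
    unfolding d_def .
qed

text \<open>
  The relative decrease of the mass is at least a multiple of \<open>spread / k\<close>, up to an error of order
  \<open>1 / k\<close>. Multiplication by \<open>k + 1\<close> prepares a summation by parts.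
\<close>
lemma mass_Suc_le:
  assumes "x \<ge> 0"
  shows "(real k + 1) * mass x (Suc k) \<le> (real k + 1) * mass x k + 150 * mass x k - spread x k * mass x k / 4"
proof -
  define z where "z = real k"
  have z: "z \<ge> 0" by (simp add: z_def)
  define d where "d = (x + 2 * z + 2) * (x + 2 * z + 3)"
  define s where "s = (z + 1) ^ 2 / d"
  have d: "d > 0" using assms z by (simp add: d_def)
  have s0: "s \<ge> 0" using d by (simp add: s_def)
  have s1: "s \<le> 1"
  proof -
    have "d - (z + 1) ^ 2 = x ^ 2 + x * (4 * z + 5) + 3 * z ^ 2 + 8 * z + 5"
      unfolding d_def by algebra
    also have "\<dots> \<ge> 0" using assms z by (intro add_nonneg_nonneg mult_nonneg_nonneg) auto
    finally show ?thesis using d by (simp add: s_def)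
  qed
  define u where "u = (2 * x + 1) / (2 * (x + 2 * z + 2) ^ 3)"
  have u: "u \<ge> 0" using assms z by (simp add: u_def)
  have cert_eq: "cert x z = u * cert_poly x z / (2 * z + 1) ^ 3"
    by (simp add: cert_def corr_def u_def)
  \<comment> \<open>The factor \<open>(2 z + 3)\<^sup>3\<close> in the denominator of \<open>cert x (z + 1)\<close> absorbs the factor \<open>8 (z + 1)\<^sup>3\<close> from \<open>ratio_k_le\<close>.\<close>
  have "ratio_k x z * cert x (z + 1) \<le> (1 - s) * (8 * (z + 1) ^ 3 / (2 * z + 1) ^ 3) *
      (u * cert_poly x (z + 1) / (8 * (z + 1) ^ 3))"
  proof (rule mult_mono)
    show "ratio_k x z \<le> (1 - s) * (8 * (z + 1) ^ 3 / (2 * z + 1) ^ 3)"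
      unfolding s_def d_def by (rule ratio_k_le[OF assms z])
    have "cert x (z + 1) = (2 * x + 1) * cert_poly x (z + 1) / ((2 * z + 3) ^ 3 * (2 * (x + 2 * z + 4) ^ 3))"
      by (simp add: cert_def corr_def algebra_simps)
    also have "\<dots> \<le> (2 * x + 1) * cert_poly x (z + 1) / ((2 * (z + 1)) ^ 3 * (2 * (x + 2 * z + 2) ^ 3))"
      using assms z by (intro frac_le mult_mono power_mono mult_nonneg_nonneg less_imp_le[OF cert_poly_pos] mult_pos_pos) auto
    also have "\<dots> = u * cert_poly x (z + 1) / (8 * (z + 1) ^ 3)"
    proof -
      have *: "(2 * (z + 1)) ^ 3 = 8 * (z + 1) ^ 3"
        unfolding power_mult_distrib by simp
      have "a * c / (w * y) = a / y * c / w" for a c w y :: real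
        by (simp add: mult.commute)
      then show ?thesis unfolding * u_def .
    qed
    finally show "cert x (z + 1) \<le> u * cert_poly x (z + 1) / (8 * (z + 1) ^ 3)" .
  qed (use assms z s1 in \<open>auto intro!: mult_nonneg_nonneg divide_nonneg_nonneg less_imp_le[OF cert_pos]\<close>)
  also have "\<dots> = (1 - s) * (u * cert_poly x (z + 1) / (2 * z + 1) ^ 3)"
    using z by simp
  finally have "(z + 1) * (ratio_k x z * cert x (z + 1)) \<le>
      (z + 1) * ((1 - s) * (u * cert_poly x (z + 1) / (2 * z + 1) ^ 3))"
    using z by (intro mult_left_mono) auto
  also have "\<dots> = (1 - s) * u / (2 * z + 1) ^ 3 * ((z + 1) * cert_poly x (z + 1))"
    by simp
  also have "\<dots> \<le> (1 - s) * u / (2 * z + 1) ^ 3 * ((z + 1 + 150) * cert_poly x z)"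
  proof (rule mult_left_mono)
    show "(z + 1) * cert_poly x (z + 1) \<le> (z + 1 + 150) * cert_poly x z"
      using cert_poly_step[OF assms z] by (simp add: algebra_simps)
    show "(1 - s) * u / (2 * z + 1) ^ 3 \<ge> 0"
      using s1 u z by (intro divide_nonneg_nonneg mult_nonneg_nonneg) auto
  qed
  also have "\<dots> = (1 - s) * (z + 1 + 150) * cert x z"
    by (simp add: cert_eq)
  also have "\<dots> \<le> (z + 1 + 150 - spread x k / 4) * cert x z"
  proof (intro mult_right_mono)
    have "spread x k / 4 \<le> (z + 1) * s"
    proof -
      have "spread x k / 4 = (z + 1) ^ 3 / (4 * (x + z + 2) ^ 2)"
        by (simp add: spread_def z_def)
      also have "\<dots> \<le> (z + 1) ^ 3 / d"
      proof (rule divide_left_mono)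
        have "4 * (x + z + 2) ^ 2 - d = 3 * x ^ 2 + 4 * x * z + 11 * x + 6 * z + 10"
          unfolding d_def by algebra
        also have "\<dots> \<ge> 0" using assms z by (intro add_nonneg_nonneg mult_nonneg_nonneg) auto
        finally show "d \<le> 4 * (x + z + 2) ^ 2" by simp
      qed (use assms z d in auto)
      also have "\<dots> = (z + 1) * s"
        by (simp add: s_def power3_eq_cube power2_eq_square)
      finally show ?thesis .
    qed
    moreover have "s * 150 \<ge> 0" using s0 by simp
    ultimately show "(1 - s) * (z + 1 + 150) \<le> z + 1 + 150 - spread x k / 4"
      by (simp add: algebra_simps)
  qed (use assms z in \<open>auto intro!: less_imp_le[OF cert_pos]\<close>)
  finally have "kern x k * ((z + 1) * (ratio_k x z * cert x (z + 1))) \<le>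
      kern x k * ((z + 1 + 150 - spread x k / 4) * cert x z)"
    using assms by (intro mult_left_mono less_imp_le[OF kern_pos]) auto
  then show ?thesis
    by (simp add: mass_def z_def algebra_simps)
qed

lemma spread_le: "x \<ge> 0 \<Longrightarrow> spread x k \<le> (real k + 1) ^ 3"
proof -
  assume "x \<ge> 0"
  then have "(x + real k + 2) ^ 2 \<ge> 1" by (simp add: one_le_power)
  then have "(real k + 1) ^ 3 / (x + real k + 2) ^ 2 \<le> (real k + 1) ^ 3 / 1"
    by (intro divide_left_mono) auto
  then show ?thesis
    by (simp add: spread_def)
qed

lemma summable_spread_mass:
  assumes "x \<ge> 0"
  shows "summable (\<lambda>k. spread x k * mass x k)"
proof (rule summable_comparison_test)
  show "summable (\<lambda>k. (real k + 1) ^ 3 * mass x k)"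
    by (rule summable_mass_powers[OF assms])
  show "\<exists>N. \<forall>k\<ge>N. norm (spread x k * mass x k) \<le> (real k + 1) ^ 3 * mass x k"
    using mass_pos[OF assms] spread_nonneg[OF assms]
    by (intro exI[of _ 0]) (auto simp: abs_mult less_imp_le intro!: mult_right_mono spread_le[OF assms])
qed

text \<open>
  Summing \<open>mass_Suc_le\<close> over \<open>k\<close>, the terms with \<open>k + 1\<close> combine to a
  single copy of the total mass. So the spread is bounded on average.
\<close>
lemma suminf_spread_mass:
  assumes "x \<ge> 0"
  shows "(\<Sum>k. spread x k * mass x k) \<le> 604 * suminf (mass x)"
proof -
  have s1: "summable (\<lambda>k. (real k + 1) * mass x k)"
    using summable_mass_powers[OF assms, of 1] by simp
  then have "summable (\<lambda>k. (real k + 1) * mass x k + 150 * mass x k - spread x k * mass x k / 4)"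
    by (intro summable_add summable_diff summable_mult summable_divide summable_mass summable_spread_mass assms disjI1)
  moreover have s2: "summable (\<lambda>k. (real k + 1) * mass x (Suc k))"
  proof -
    have "summable (\<lambda>k. (real (Suc k) + 1) * mass x (Suc k) - mass x (Suc k))"
      using summable_Suc_iff[THEN iffD2, OF s1] summable_Suc_iff[THEN iffD2, OF summable_mass[OF disjI1[OF assms]]]
      by (rule summable_diff)
    then show ?thesis by (simp add: algebra_simps)
  qed
  ultimately have "(\<Sum>k. (real k + 1) * mass x (Suc k)) \<le>
      (\<Sum>k. (real k + 1) * mass x k + 150 * mass x k - spread x k * mass x k / 4)"
    by (intro suminf_le mass_Suc_le assms)
  also have "\<dots> = (\<Sum>k. (real k + 1) * mass x k) + 150 * suminf (mass x) - (\<Sum>k. spread x k * mass x k) / 4"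
    using s1 summable_mass[of x] summable_spread_mass[OF assms] assms
    by (simp add: suminf_add[symmetric] suminf_diff[symmetric] suminf_mult suminf_divide summable_mult summable_divide summable_add)
  finally have "(\<Sum>k. spread x k * mass x k) / 4 \<le>
      (\<Sum>k. (real k + 1) * mass x k) - (\<Sum>k. (real k + 1) * mass x (Suc k)) + 150 * suminf (mass x)"
    by simp
  also have "(\<Sum>k. (real k + 1) * mass x k) - (\<Sum>k. (real k + 1) * mass x (Suc k)) = suminf (mass x)"
  proof -
    have sp: "summable (\<lambda>k. real k * mass x k)"
      using summable_diff[OF s1 summable_mass[of x]] assms by (simp add: algebra_simps)
    have "(\<Sum>k. (real k + 1) * mass x (Suc k)) = (\<Sum>k. real (Suc k) * mass x (Suc k))"
      by (simp add: add.commute)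
    also have "\<dots> = (\<Sum>k. real k * mass x k)"
      using suminf_split_head[OF sp] by simp
    finally have "(\<Sum>k. (real k + 1) * mass x k) - (\<Sum>k. (real k + 1) * mass x (Suc k)) =
        (\<Sum>k. (real k + 1) * mass x k - real k * mass x k)"
      using suminf_diff[OF s1 sp] by simp
    then show ?thesis by (simp add: algebra_simps)
  qed
  finally show ?thesis by simp
qed

text \<open>
  The kernel is of order \<open>n\<close> to the power \<open>-3\<close> and the certificate of order
  \<open>n\<^sup>2\<close>.
\<close>
lemma mass_fixed_row: "(\<lambda>n. mass (real n) k) \<longlonglongrightarrow> 0"
proof (rule Lim_null_comparison)
  have kern_le: "kern x k \<le> 8 ^ k / (x + 1) ^ 3" if "x \<ge> 0" for x
  proof (induction k)
    case (Suc k)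
    have "ratio_k x (real k) \<le> (1 - (real k + 1) ^ 2 / ((x + 2 * real k + 2) * (x + 2 * real k + 3))) *
        (8 * (real k + 1) ^ 3 / (2 * real k + 1) ^ 3)"
      by (rule ratio_k_le) (use that in auto)
    also have "\<dots> \<le> 1 * (8 * 1)"
    proof (rule mult_mono)
      have "(real k + 1) ^ 3 \<le> (2 * real k + 1) ^ 3" by (intro power_mono) auto
      then show "8 * (real k + 1) ^ 3 / (2 * real k + 1) ^ 3 \<le> 8 * 1"
        by (simp add: divide_le_eq)
    qed (use that in auto)
    finally have "kern x k * ratio_k x (real k) \<le> 8 ^ k / (x + 1) ^ 3 * 8"
      using that by (intro mult_mono Suc less_imp_le[OF ratio_k_pos]) auto
    then show ?case by (simp add: mult.commute)
  qed simp
  show "\<forall>\<^sub>F n in sequentially. norm (mass (real n) k) \<le> 8 ^ k * (300 * (real k + 1) ^ 2) * inverse (real (Suc n))"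
  proof (intro always_eventually allI)
    fix n
    have "mass (real n) k \<le> 8 ^ k / (real n + 1) ^ 3 * (300 * (real n + 1) ^ 2 * (real k + 1) ^ 2)"
      unfolding mass_def by (intro mult_mono kern_le cert_le less_imp_le[OF cert_pos]) auto
    also have "\<dots> = 8 ^ k * (300 * (real k + 1) ^ 2) * ((real n + 1) ^ 2 / (real n + 1) ^ 3)"
      by simp
    also have "(real n + 1) ^ 2 / (real n + 1) ^ 3 = inverse (real (Suc n))"
      by (simp add: divide_simps power2_eq_square power3_eq_cube)
    finally show "norm (mass (real n) k) \<le> 8 ^ k * (300 * (real k + 1) ^ 2) * inverse (real (Suc n))"
      using mass_pos[of "real n" k] by simp
  qed
  show "(\<lambda>n. 8 ^ k * (300 * (real k + 1) ^ 2) * inverse (real (Suc n))) \<longlonglongrightarrow> 0"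
    using tendsto_mult[OF tendsto_const LIMSEQ_inverse_real_of_nat] by simp
qed

lemma summable_bounded_mass:
  assumes "x \<ge> 0" "\<And>k. \<bar>b k\<bar> \<le> B"
  shows "summable (\<lambda>k. b k * mass x k)"
proof (rule summable_comparison_test)
  show "summable (\<lambda>k. B * mass x k)"
    using assms by (intro summable_mult summable_mass) auto
  show "\<exists>N. \<forall>k\<ge>N. norm (b k * mass x k) \<le> B * mass x k"
    using mass_pos[OF assms(1)] assms(2)
    by (intro exI[of _ 0]) (auto simp: abs_mult less_imp_le intro!: mult_right_mono)
qed

text \<open>
  As \<open>n\<close> grows, the column moves to infinity (\<open>mass_fixed_row\<close>) while its total mass
  stays bounded.
\<close>
lemma null_sequence_average:
  fixes b :: "nat \<Rightarrow> real"
  assumes b: "b \<longlonglongrightarrow> 0" and nonneg: "\<And>k. b k \<ge> 0"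
  shows "(\<lambda>n. \<Sum>k. b k * mass (real n) k) \<longlonglongrightarrow> 0"
proof (rule LIMSEQ_I)
  fix e :: real assume e: "e > 0"
  obtain B where B: "\<And>k. \<bar>b k\<bar> \<le> B"
    using convergent_imp_Bseq[OF convergentI[OF b]] by (auto simp: Bseq_def)
  obtain M where M: "\<And>n. suminf (mass (real n)) \<le> M" "M > 0"
  proof -
    obtain M where M: "\<And>n. \<bar>suminf (mass (real n))\<bar> \<le> M"
      using convergent_imp_Bseq[OF convergentI[OF column_mass_LIMSEQ]] by (auto simp: Bseq_def)
    show ?thesis
    proof (rule that)
      show "suminf (mass (real n)) \<le> \<bar>M\<bar> + 1" for n
        using M[of n] by linarith
    qed simp
  qed
  define d where "d = e / (2 * M)"
  have d: "d > 0" "d * M = e / 2" using e M by (auto simp: d_def)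
  obtain K where K: "\<And>k. k \<ge> K \<Longrightarrow> b k < d"
    using order_tendstoD(2)[OF b d(1)] by (auto simp: eventually_at_top_linorder)
  have "(\<lambda>n. \<Sum>k<K. b k * mass (real n) k) \<longlonglongrightarrow> (\<Sum>k<K. b k * 0)"
    by (intro tendsto_intros mass_fixed_row)
  then have "(\<lambda>n. \<Sum>k<K. b k * mass (real n) k) \<longlonglongrightarrow> 0" by simp
  from order_tendstoD(2)[OF this, of "e / 2"] e obtain N where
    N: "\<And>n. n \<ge> N \<Longrightarrow> (\<Sum>k<K. b k * mass (real n) k) < e / 2"
    by (auto simp: eventually_at_top_linorder)
  show "\<exists>N. \<forall>n\<ge>N. norm ((\<Sum>k. b k * mass (real n) k) - 0) < e"
  proof (intro exI allI impI)
    fix n assume "n \<ge> N"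
    have sb: "summable (\<lambda>k. b k * mass (real n) k)"
      by (rule summable_bounded_mass[OF _ B]) simp
    have pos: "b k * mass (real n) k \<ge> 0" for k
      using nonneg mass_pos[of "real n" k] by simp
    have sm: "summable (mass (real n))"
      by (intro summable_mass) simp
    have "(\<Sum>k. b k * mass (real n) k) = (\<Sum>k. b (k + K) * mass (real n) (k + K)) + (\<Sum>k<K. b k * mass (real n) k)"
      by (rule suminf_split_initial_segment[OF sb])
    also have "(\<Sum>k. b (k + K) * mass (real n) (k + K)) \<le> (\<Sum>k. d * mass (real n) (k + K))"
    proof (rule suminf_le)
      show "b (k + K) * mass (real n) (k + K) \<le> d * mass (real n) (k + K)" for k
        using K[of "k + K"] mass_pos[of "real n" "k + K"] by (intro mult_right_mono) auto
      show "summable (\<lambda>k. b (k + K) * mass (real n) (k + K))"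
        using summable_ignore_initial_segment[OF sb, of K] .
      show "summable (\<lambda>k. d * mass (real n) (k + K))"
        using summable_ignore_initial_segment[OF sm, of K] by (intro summable_mult)
    qed
    also have "\<dots> = d * (\<Sum>k. mass (real n) (k + K))"
      by (rule suminf_mult[OF summable_ignore_initial_segment[OF sm]])
    also have "\<dots> \<le> d * M"
    proof (rule mult_left_mono)
      have "(\<Sum>k<K. mass (real n) k) \<ge> 0"
        by (intro sum_nonneg less_imp_le[OF mass_pos]) auto
      then show "(\<Sum>k. mass (real n) (k + K)) \<le> M"
        using suminf_split_initial_segment[OF sm, of K] M(1)[of n] by linarith
    qed (use d in auto)
    finally have "(\<Sum>k. b k * mass (real n) k) < e"
      using N[OF \<open>n \<ge> N\<close>] d(2) by linarith
    moreover have "(\<Sum>k. b k * mass (real n) k) \<ge> 0"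
      by (rule suminf_nonneg[OF sb pos])
    ultimately show "norm ((\<Sum>k. b k * mass (real n) k) - 0) < e"
      by simp
  qed
qed

section \<open>Series obtained from deformed pairs\<close>

text \<open>
  Here \<open>kern * A\<close> and \<open>kern * B\<close> are the two halves of a deformed pair. The condition
  \<open>bulk\<close> says that \<open>B\<close> is \<open>l * cert\<close> up to relative errors that are small
  for large \<open>n\<close>, small for large \<open>k\<close>, or a null sequence times the spread. Each of them
  is negligible on average over column \<open>n\<close>, so the column sums tend to \<open>l
  \<pi>\<^sup>2\<close>.
\<close>
lemma deformed_series:
  fixes A B :: "nat \<Rightarrow> nat \<Rightarrow> real" and a b c :: "nat \<Rightarrow> real" and l S :: real
  assumes wz: "\<And>n k. kern (real n) (Suc k) * A n (Suc k) - kern (real n) k * A n k =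
      kern (real n) k * B n k - kern (real (Suc n)) k * B (Suc n) k"
    and growth: "\<And>n. \<exists>C p. \<forall>k. \<bar>A n k\<bar> \<le> C * (real k + 1) ^ p"
    and bulk: "\<And>n k. \<bar>B n k - l * cert (real n) (real k)\<bar> \<le>
      (a n + b k + c n * spread (real n) k) * cert (real n) (real k)"
    and null: "a \<longlonglongrightarrow> 0" "b \<longlonglongrightarrow> 0" "c \<longlonglongrightarrow> 0"
    and nonneg: "\<And>n. a n \<ge> 0" "\<And>n. b n \<ge> 0" "\<And>n. c n \<ge> 0"
    and initial: "(\<lambda>n. A n 0 / (real n + 1) ^ 3) sums S"
  shows "(\<lambda>k. kern 0 k * B 0 k) sums (l * pi\<^sup>2 - S)"
proof -
  define G where "G n k = kern (real n) k * B n k" for n k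
  define D where "D n k = G n k - l * mass (real n) k" for n k
  define E where "E n k = a n * mass (real n) k + b k * mass (real n) k + c n * (spread (real n) k * mass (real n) k)" for n k
  obtain C where C: "\<And>k. \<bar>b k\<bar> \<le> C"
    using convergent_imp_Bseq[OF convergentI[OF null(2)]] by (auto simp: Bseq_def)
  have sm: "summable (mass (real n))" and sb: "summable (\<lambda>k. b k * mass (real n) k)"
    and ss: "summable (\<lambda>k. spread (real n) k * mass (real n) k)" for n
    by (auto intro!: summable_mass summable_bounded_mass C summable_spread_mass)
  have DE: "\<bar>D n k\<bar> \<le> E n k" for n k
  proof -
    have "\<bar>D n k\<bar> = kern (real n) k * \<bar>B n k - l * cert (real n) (real k)\<bar>"
    proof -
      have "D n k = kern (real n) k * (B n k - l * cert (real n) (real k))"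
        by (simp add: D_def G_def mass_def algebra_simps)
      then show ?thesis
        using kern_pos[of "real n" k] by (simp add: abs_mult)
    qed
    also have "\<dots> \<le> kern (real n) k * ((a n + b k + c n * spread (real n) k) * cert (real n) (real k))"
      by (intro mult_left_mono bulk less_imp_le[OF kern_pos]) auto
    finally show ?thesis
      by (simp add: E_def mass_def algebra_simps)
  qed
  have sE: "summable (E n)" for n
    unfolding E_def by (intro summable_add summable_mult sm sb ss)
  have sD: "summable (\<lambda>k. \<bar>D n k\<bar>)" for n
    by (rule summable_comparison_test[OF _ sE[of n]]) (use DE in auto)
  have sD': "summable (D n)" for n
    using summable_rabs_cancel[OF sD] .
  have sG: "summable (G n)" for n
    using summable_add[OF sD'[of n] summable_mult[OF sm[of n], of l]] by (simp add: D_def)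
  have suminf_D: "suminf (G n) = suminf (D n) + l * suminf (mass (real n))" for n
    using suminf_add[OF sD'[of n] summable_mult[OF sm[of n], of l]] suminf_mult[OF sm[of n], of l]
    by (simp add: D_def)
  have "(\<lambda>n. suminf (D n)) \<longlonglongrightarrow> 0"
  proof (rule Lim_null_comparison)
    show "\<forall>\<^sub>F n in sequentially. norm (suminf (D n)) \<le> a n * suminf (mass (real n)) +
        (\<Sum>k. b k * mass (real n) k) + c n * (604 * suminf (mass (real n)))"
    proof (intro always_eventually allI)
      fix n
      have "norm (suminf (D n)) \<le> (\<Sum>k. \<bar>D n k\<bar>)"
        using summable_rabs[OF sD[of n]] by simp
      also have "\<dots> \<le> suminf (E n)"
        by (rule suminf_le[OF DE sD sE])
      also have "suminf (E n) = a n * suminf (mass (real n)) + (\<Sum>k. b k * mass (real n) k) +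
          c n * (\<Sum>k. spread (real n) k * mass (real n) k)"
        unfolding E_def
        unfolding suminf_add[OF summable_add[OF summable_mult[OF sm[of n], of "a n"] sb[of n]]
              summable_mult[OF ss[of n], of "c n"], symmetric]
            suminf_add[OF summable_mult[OF sm[of n], of "a n"] sb[of n], symmetric]
            suminf_mult[OF sm[of n], of "a n"] suminf_mult[OF ss[of n], of "c n"] ..
      also have "\<dots> \<le> a n * suminf (mass (real n)) + (\<Sum>k. b k * mass (real n) k) + c n * (604 * suminf (mass (real n)))"
        by (intro add_left_mono mult_left_mono suminf_spread_mass nonneg) auto
      finally show "norm (suminf (D n)) \<le> a n * suminf (mass (real n)) +
          (\<Sum>k. b k * mass (real n) k) + c n * (604 * suminf (mass (real n)))" .
    qed
    have "(\<lambda>n. a n * suminf (mass (real n)) + (\<Sum>k. b k * mass (real n) k) + c n * (604 * suminf (mass (real n))))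
        \<longlonglongrightarrow> 0 * pi\<^sup>2 + 0 + 0 * (604 * pi\<^sup>2)"
      by (intro tendsto_intros null column_mass_LIMSEQ null_sequence_average nonneg)
    then show "(\<lambda>n. a n * suminf (mass (real n)) + (\<Sum>k. b k * mass (real n) k) + c n * (604 * suminf (mass (real n))))
        \<longlonglongrightarrow> 0" by simp
  qed
  then have limG: "(\<lambda>n. suminf (G n)) \<longlonglongrightarrow> 0 + l * pi\<^sup>2"
    unfolding suminf_D by (rule tendsto_add[OF _ tendsto_mult[OF tendsto_const column_mass_LIMSEQ]])
  have "suminf (G N) = suminf (G 0) + (\<Sum>n<N. A n 0 / (real n + 1) ^ 3)" for N
  proof -
    have "suminf (G N) = suminf (G 0) + (\<Sum>n<N. kern (real n) 0 * A n 0)"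
    proof (rule telescoped_column_sums[where F = "\<lambda>n k. kern (real n) k * A n k" and G = G])
      show "kern (real n) (Suc k) * A n (Suc k) - kern (real n) k * A n k = G n k - G (Suc n) k" for n k
        unfolding G_def by (rule wz)
      show "(\<lambda>k. kern (real n) k * A n k) \<longlonglongrightarrow> 0" for n
      proof -
        obtain C p where "\<And>k. \<bar>A n k\<bar> \<le> C * (real k + 1) ^ p"
          using growth[of n] by blast
        then show ?thesis by (intro tendsto_kern_poly) auto
      qed
    qed (rule sG)
    then show ?thesis by simp
  qed
  then have columns: "(\<lambda>N. suminf (G N)) = (\<lambda>N. suminf (G 0) + (\<Sum>n<N. A n 0 / (real n + 1) ^ 3))"
    by (intro ext)
  have "(\<lambda>N. suminf (G N)) \<longlonglongrightarrow> suminf (G 0) + S"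
    using tendsto_add[OF tendsto_const initial[unfolded sums_def]] unfolding columns .
  from LIMSEQ_unique[OF this limG] have "suminf (G 0) = l * pi\<^sup>2 - S"
    by simp
  moreover have "G 0 = (\<lambda>k. kern 0 k * B 0 k)"
    by (simp add: G_def fun_eq_iff)
  ultimately show ?thesis
    using summable_sums[OF sG[of 0]] by simp
qed

text \<open>
  Separating the terms with \<open>L n k\<close> itself, which cancel by \<open>wz_base\<close>, reduces the
  deformed pair to its rational residue.
\<close>
lemma wz_deformed:
  fixes L phi V :: "nat \<Rightarrow> nat \<Rightarrow> real"
  defines "A \<equiv> \<lambda>n k. (2 * real n + 3 * real k + 2) * L n k + phi n k"
    and "B \<equiv> \<lambda>n k. cert (real n) (real k) * L n k + V n k"
  assumes residual: "\<And>n k. ratio_k (real n) (real k) *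
        ((2 * real n + 3 * real k + 5) * (L n (Suc k) - L n k) + phi n (Suc k)) - phi n k =
      V n k - ratio_x (real n) (real k) *
        (cert (real n + 1) (real k) * (L (Suc n) k - L n k) + V (Suc n) k)"
  shows "kern (real n) (Suc k) * A n (Suc k) - kern (real n) k * A n k =
    kern (real n) k * B n k - kern (real (Suc n)) k * B (Suc n) k"
proof -
  have base: "ratio_k (real n) (real k) * (2 * real n + 3 * real k + 5) - (2 * real n + 3 * real k + 2) =
      cert (real n) (real k) - ratio_x (real n) (real k) * cert (real n + 1) (real k)"
    by (rule wz_base) auto
  have eqs: "kern (real (Suc n)) k = kern (real n) k * ratio_x (real n) (real k)"
      "2 * real n + 3 * real (Suc k) + 2 = 2 * real n + 3 * real k + 5" "real (Suc n) = real n + 1"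
    using kern_shift[of "real n" k] by (auto simp: add.commute)
  show ?thesis
    unfolding A_def B_def eqs(1,2) unfolding eqs(3) kern.simps
    using base residual[of n k] by algebra
qed

text \<open>
  The extra factor \<open>z + 1\<close> in the hypothesis makes the correction negligible for large
  \<open>z\<close>, whatever the harmonic factor.
\<close>
lemma corr_bounds:
  assumes "x \<ge> 0" "z \<ge> 0" "p x z \<ge> 0" "(z + 1) * p x z \<le> c * (cert_poly x z * (2 * z + 1) ^ j)"
  shows "\<bar>corr (3 + j) p x z\<bar> \<le> c / (z + 1) * cert x z"
proof -
  have nonneg: "corr (3 + j) p x z \<ge> 0"
    unfolding corr_def using assms by (intro divide_nonneg_nonneg mult_nonneg_nonneg) auto
  have "p x z \<le> c * (cert_poly x z * (2 * z + 1) ^ j) / (z + 1)"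
    using assms by (simp add: pos_le_divide_eq mult.commute)
  then have "corr (3 + j) p x z \<le> (2 * x + 1) * (c * (cert_poly x z * (2 * z + 1) ^ j) / (z + 1)) /
      (2 * (2 * z + 1) ^ (3 + j) * (x + 2 * z + 2) ^ 3)"
    unfolding corr_def using assms by (intro divide_right_mono mult_left_mono) auto
  also have "\<dots> = c / (z + 1) * cert x z"
  proof -
    have "2 * z + 1 \<noteq> 0" "z + 1 \<noteq> 0" "x + 2 * z + 2 \<noteq> 0" using assms by linarith+
    then show ?thesis
      by (simp add: cert_def corr_def power_add divide_simps)
  qed
  finally show ?thesis using nonneg by simp
qed

lemma corr_dx_bounds:
  assumes "x \<ge> 0" "z \<ge> 0" "p x z \<ge> 0" "p x z \<le> c * cert_poly x z"
    "dp x z \<ge> 0" "(x + 1) * dp x z \<le> d * cert_poly x z"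
  shows "\<bar>corr_dx p dp x z\<bar> \<le> (4 * c + d) / (x + 1) * cert x z"
proof -
  define w where "w = 2 * (2 * z + 1) ^ 3 * (x + 2 * z + 2) ^ 3"
  have w: "w > 0" using assms by (simp add: w_def)
  have "(2 * x + 1) / (x + 2 * z + 2) \<le> 2" "(2 * x + 1) / (x + 2 * z + 2) \<ge> 0"
    using assms by (auto simp: pos_divide_le_eq)
  then have 1: "\<bar>2 - 3 * (2 * x + 1) / (x + 2 * z + 2)\<bar> \<le> 4"
    by (simp only: times_divide_eq_right[symmetric] abs_le_iff) linarith
  have dp: "dp x z \<le> d * cert_poly x z / (x + 1)"
    using assms by (simp add: pos_le_divide_eq mult.commute)
  have "\<bar>(2 - 3 * (2 * x + 1) / (x + 2 * z + 2)) * p x z + (2 * x + 1) * dp x z\<bar> \<le>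
      4 * (c * cert_poly x z) * 1 + (2 * x + 1) * (d * cert_poly x z / (x + 1))"
  proof (rule order_trans[OF abs_triangle_ineq add_mono])
    have "\<bar>(2 - 3 * (2 * x + 1) / (x + 2 * z + 2)) * p x z\<bar> \<le> 4 * (c * cert_poly x z)"
      unfolding abs_mult using 1 assms by (intro mult_mono) auto
    then show "\<bar>(2 - 3 * (2 * x + 1) / (x + 2 * z + 2)) * p x z\<bar> \<le> 4 * (c * cert_poly x z) * 1"
      by simp
    show "\<bar>(2 * x + 1) * dp x z\<bar> \<le> (2 * x + 1) * (d * cert_poly x z / (x + 1))"
      using assms dp by (simp only: abs_of_nonneg mult_nonneg_nonneg add_nonneg_nonneg zero_le_one zero_le_numeral)
        (intro mult_left_mono; simp)
  qed
  also have "\<dots> \<le> 4 * (c * cert_poly x z) * ((2 * x + 1) / (x + 1)) + (2 * x + 1) * (d * cert_poly x z / (x + 1))"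
  proof (intro add_right_mono mult_left_mono)
    show "1 \<le> (2 * x + 1) / (x + 1)" using assms by simp
    show "0 \<le> 4 * (c * cert_poly x z)" using assms by simp
  qed
  also have "\<dots> = (4 * c + d) / (x + 1) * ((2 * x + 1) * cert_poly x z)"
    by (simp add: add_divide_distrib algebra_simps)
  finally have "\<bar>(2 - 3 * (2 * x + 1) / (x + 2 * z + 2)) * p x z + (2 * x + 1) * dp x z\<bar> / w \<le>
      (4 * c + d) / (x + 1) * ((2 * x + 1) * cert_poly x z) / w"
    using w by (intro divide_right_mono) auto
  then show ?thesis
    using w by (simp add: corr_dx_def cert_def corr_def flip: w_def)
qed

text \<open>
  Polynomial growth is all that \<open>deformed_series\<close> requires in the variable \<open>k\<close> for fixed
  \<open>n\<close>; as a predicate it has closure rules that follow the syntax of the terms.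
\<close>
definition poly_growth :: "(nat \<Rightarrow> real) \<Rightarrow> bool" where
  "poly_growth f \<longleftrightarrow> (\<exists>C p. \<forall>k. \<bar>f k\<bar> \<le> C * (real k + 1) ^ p)"

lemma poly_growthI: "(\<And>k. \<bar>f k\<bar> \<le> C * (real k + 1) ^ p) \<Longrightarrow> poly_growth f"
  unfolding poly_growth_def by blast

lemma poly_growth_const: "poly_growth (\<lambda>_. c)"
  by (rule poly_growthI[of _ "\<bar>c\<bar>" 0]) simp

lemma poly_growth_of_nat: "poly_growth (\<lambda>k. real k)"
  by (rule poly_growthI[of _ 1 1]) simp

lemma poly_growth_mult:
  assumes "poly_growth f" "poly_growth g"
  shows "poly_growth (\<lambda>k. f k * g k)"
proof -
  obtain C p D q where "\<And>k. \<bar>f k\<bar> \<le> C * (real k + 1) ^ p" "\<And>k. \<bar>g k\<bar> \<le> D * (real k + 1) ^ q"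
    using assms unfolding poly_growth_def by blast
  then have "\<bar>f k * g k\<bar> \<le> (C * D) * (real k + 1) ^ (p + q)" for k
  proof -
    have "\<bar>f k * g k\<bar> \<le> (C * (real k + 1) ^ p) * (D * (real k + 1) ^ q)"
      unfolding abs_mult
      by (intro mult_mono \<open>\<And>k. \<bar>f k\<bar> \<le> _ k\<close> \<open>\<And>k. \<bar>g k\<bar> \<le> _ k\<close>
          order_trans[OF abs_ge_zero \<open>\<And>k. \<bar>f k\<bar> \<le> _ k\<close>]) auto
    then show ?thesis by (simp add: power_add mult_ac)
  qed
  then show ?thesis by (rule poly_growthI)
qed

lemma poly_growth_add:
  assumes "poly_growth f" "poly_growth g"
  shows "poly_growth (\<lambda>k. f k + g k)"
proof -
  obtain C p D q where f: "\<And>k. \<bar>f k\<bar> \<le> C * (real k + 1) ^ p" and g: "\<And>k. \<bar>g k\<bar> \<le> D * (real k + 1) ^ q"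
    using assms unfolding poly_growth_def by blast
  have "\<bar>f k + g k\<bar> \<le> (\<bar>C\<bar> + \<bar>D\<bar>) * (real k + 1) ^ (p + q)" for k
  proof -
    have "C * (real k + 1) ^ p \<le> \<bar>C\<bar> * (real k + 1) ^ (p + q)"
      by (intro mult_mono power_increasing) auto
    moreover have "D * (real k + 1) ^ q \<le> \<bar>D\<bar> * (real k + 1) ^ (p + q)"
      by (intro mult_mono power_increasing) auto
    ultimately show ?thesis
      using f[of k] g[of k] abs_triangle_ineq[of "f k" "g k"] by (simp add: distrib_right)
  qed
  then show ?thesis by (rule poly_growthI)
qed

lemma poly_growth_minus: "poly_growth f \<Longrightarrow> poly_growth (\<lambda>k. - f k)"
  by (simp add: poly_growth_def)

lemma poly_growth_diff: "poly_growth f \<Longrightarrow> poly_growth g \<Longrightarrow> poly_growth (\<lambda>k. f k - g k)"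
  using poly_growth_add[OF _ poly_growth_minus] by fastforce

lemma poly_growth_divide:
  assumes "poly_growth f" "\<And>k. \<bar>g k\<bar> \<ge> 1"
  shows "poly_growth (\<lambda>k. f k / g k)"
proof -
  obtain C p where f: "\<And>k. \<bar>f k\<bar> \<le> C * (real k + 1) ^ p"
    using assms unfolding poly_growth_def by blast
  have "\<bar>f k / g k\<bar> \<le> \<bar>f k\<bar>" for k
    using assms(2)[of k] divide_left_mono[of 1 "\<bar>g k\<bar>" "\<bar>f k\<bar>"] by (auto simp: abs_divide)
  with f show ?thesis
    by (intro poly_growthI[of _ C p]) (meson order_trans)
qed

lemma half_harm_le: "half_harm m n \<le> 2 ^ m * gen_harm m n"
proof (induction n)
  case (Suc n)
  have "1 / (real n + 1 / 2) ^ m \<le> 1 / ((real n + 1) / 2) ^ m"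
    by (intro divide_left_mono power_mono) auto
  then show ?case using Suc by (simp add: power_divide algebra_simps)
qed simp

lemma gen_harm_le_real: "gen_harm m n \<le> real n"
proof (induction n)
  case (Suc n)
  have "1 / (real n + 1) ^ m \<le> 1"
    by (simp add: divide_le_eq one_le_power)
  with Suc show ?case
    by (simp only: gen_harm_Suc of_nat_Suc)
qed simp

lemma poly_growth_gen_harm:
  assumes "poly_growth (\<lambda>k. real (u k))"
  shows "poly_growth (\<lambda>k. gen_harm m (u k))"
proof -
  obtain C p where "\<And>k. \<bar>real (u k)\<bar> \<le> C * (real k + 1) ^ p"
    using assms unfolding poly_growth_def by blast
  then show ?thesis
    using gen_harm_le_real[of m] gen_harm_nonneg[of m]
    by (intro poly_growthI[of _ C p]) (auto intro: order_trans)
qed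

lemma poly_growth_half_harm:
  assumes "poly_growth (\<lambda>k. real (u k))"
  shows "poly_growth (\<lambda>k. half_harm m (u k))"
proof -
  obtain C p where "\<And>k. \<bar>2 ^ m * gen_harm m (u k)\<bar> \<le> C * (real k + 1) ^ p"
    using poly_growth_mult[OF poly_growth_const poly_growth_gen_harm[OF assms]] unfolding poly_growth_def by blast
  then show ?thesis
    using half_harm_le[of m] half_harm_nonneg[of m] gen_harm_nonneg[of m]
    by (intro poly_growthI[of _ C p]) (auto intro: order_trans)
qed

lemmas poly_growth_intros =
  poly_growth_const poly_growth_of_nat poly_growth_add poly_growth_diff poly_growth_minus poly_growth_mult

lemma gen_harm_diff: "gen_harm m (n + k) - gen_harm m n = (\<Sum>j<k. 1 / (real n + real j + 1) ^ m)"
  by (induction k) auto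

lemma half_harm_diff: "half_harm m (n + k) - half_harm m n = (\<Sum>j<k. 1 / (real n + real j + 1 / 2) ^ m)"
  by (induction k) auto

lemma harm_increments:
  "gen_harm m (n + 2 * Suc k + 2) =
     gen_harm m (n + 2 * k + 2) + 1 / (real n + 2 * real k + 3) ^ m + 1 / (real n + 2 * real k + 4) ^ m"
  "gen_harm m (n + Suc k) = gen_harm m (n + k) + 1 / (real n + real k + 1) ^ m"
  "gen_harm m (Suc n + 2 * k + 2) = gen_harm m (n + 2 * k + 2) + 1 / (real n + 2 * real k + 3) ^ m"
  "gen_harm m (Suc n + k) = gen_harm m (n + k) + 1 / (real n + real k + 1) ^ m"
  "gen_harm m (Suc k) = gen_harm m k + 1 / (real k + 1) ^ m"
  "half_harm m (Suc k) = half_harm m k + 2 ^ m / (2 * real k + 1) ^ m"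
proof -
  have "n + 2 * Suc k + 2 = Suc (Suc (n + 2 * k + 2))" "Suc n + 2 * k + 2 = Suc (n + 2 * k + 2)" by simp_all
  then show "gen_harm m (n + 2 * Suc k + 2) =
     gen_harm m (n + 2 * k + 2) + 1 / (real n + 2 * real k + 3) ^ m + 1 / (real n + 2 * real k + 4) ^ m"
    "gen_harm m (Suc n + 2 * k + 2) = gen_harm m (n + 2 * k + 2) + 1 / (real n + 2 * real k + 3) ^ m"
    by (simp_all only: gen_harm_Suc) (simp_all add: add_ac)
  have "1 / (real k + 1 / 2) ^ m = 2 ^ m / (2 * (real k + 1 / 2)) ^ m"
    unfolding power_mult_distrib by simp
  then show "half_harm m (Suc k) = half_harm m k + 2 ^ m / (2 * real k + 1) ^ m"
    by (simp add: distrib_left)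
qed simp_all

lemma gen_harm_mono: "i \<le> j \<Longrightarrow> gen_harm m i \<le> gen_harm m j"
  unfolding gen_harm_def by (intro sum_mono2) auto

lemma cube_le_spread: "real k ^ 3 / (real n + 1 + real k) ^ 2 \<le> 4 * spread (real n) k"
proof -
  have "real k ^ 3 / (real n + 1 + real k) ^ 2 = 4 * (real k ^ 3 / (2 * (real n + 1 + real k)) ^ 2)"
    unfolding power_mult_distrib by simp
  also have "\<dots> \<le> 4 * ((real k + 1) ^ 3 / (real n + real k + 2) ^ 2)"
    by (intro mult_left_mono frac_le power_mono) auto
  finally show ?thesis
    by (simp add: spread_def)
qed

text \<open>
  The left-hand side is \<open>k\<^sup>2 / (n + k)\<^sup>2\<close> plus the spread over \<open>n\<close>, up to
  constants. The first summand is small if \<open>k\<^sup>2 \<le> n\<close>; otherwise one factor \<open>k\<close>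
  is traded for the square root of \<open>n\<close>.
\<close>
lemma spread_dominates:
  "real k ^ 2 / ((real n + 1) * (real n + real k + 1)) \<le> (1 + 8 * spread (real n) k) / sqrt (real n + 1)"
proof -
  define N where "N = real n + 1"
  define m where "m = real k"
  have N: "N \<ge> 1" and m: "m \<ge> 0" by (auto simp: N_def m_def)
  have sq: "sqrt N \<ge> 1" "sqrt N \<le> N" "sqrt N * sqrt N = N"
    using N by (auto intro!: real_le_lsqrt simp: power2_eq_square)
  define u where "u = m ^ 3 / (N + m) ^ 2"
  have u: "u \<ge> 0" using m by (simp add: u_def)
  have u_le: "u \<le> 4 * spread (real n) k"
    using cube_le_spread[of k n] by (simp add: u_def N_def m_def)
  have "m ^ 2 / (N * (N + m)) \<le> (1 + 2 * u) / sqrt N"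
  proof (cases "m ^ 2 \<le> N")
    case True
    have "m ^ 2 / (N * (N + m)) \<le> N / (N * N)"
      using True N m by (intro frac_le mult_left_mono) auto
    also have "\<dots> = 1 / N" using N by simp
    also have "\<dots> \<le> (1 + 2 * u) / sqrt N"
      using sq u N by (intro frac_le) auto
    finally show ?thesis .
  next
    case False
    then have m1: "m \<ge> sqrt N"
      using m by (intro real_le_lsqrt) auto
    then have m0: "m > 0" using sq by linarith
    have "m ^ 2 / (N * (N + m)) = u / m + u / N"
      using N m0 by (simp add: u_def divide_simps) algebra
    also have "\<dots> \<le> u / sqrt N + u / sqrt N"
      using u sq m1 N m0 by (intro add_mono divide_left_mono mult_pos_pos) auto
    also have "\<dots> \<le> (1 + 2 * u) / sqrt N"
      using sq by (simp add: add_divide_distrib)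
    finally show ?thesis .
  qed
  also have "\<dots> \<le> (1 + 8 * spread (real n) k) / sqrt N"
    using u_le sq by (intro divide_right_mono) auto
  finally show ?thesis
    by (simp add: N_def m_def add_ac)
qed

text \<open>
  Apart from two boundary terms this is a second difference of the harmonic numbers with step \<open>k\<close>.
\<close>
lemma gen_harm_second_difference:
  "\<bar>gen_harm 1 (n + 2 * k + 2) - 2 * gen_harm 1 (n + k) + gen_harm 1 n\<bar> \<le>
     2 / (real n + 1) + real k ^ 2 / ((real n + 1) * (real n + real k + 1))"
proof -
  define t where "t j = 1 / (real n + real j + 1) - 1 / (real n + real k + real j + 1)" for j :: nat
  define q where "q = real k / ((real n + 1) * (real n + real k + 1))"
  have t: "0 \<le> t j" "t j \<le> q" for j
  proof -
    have "t j = real k / ((real n + real j + 1) * (real n + real k + real j + 1))"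
      by (simp add: t_def divide_simps add_nonneg_eq_0_iff)
    then show "0 \<le> t j" "t j \<le> q"
      by (auto simp: q_def intro!: divide_left_mono mult_mono mult_pos_pos add_nonneg_pos)
  qed
  have "n + 2 * k + 2 = Suc (Suc (n + k + k))" by simp
  then have "gen_harm 1 (n + 2 * k + 2) - gen_harm 1 (n + k) =
      (\<Sum>j<k. 1 / (real n + real k + real j + 1)) + 1 / (real n + 2 * real k + 1) + 1 / (real n + 2 * real k + 2)"
    using gen_harm_diff[of 1 "n + k" k] by (simp only: gen_harm_Suc) (simp add: algebra_simps)
  moreover have "gen_harm 1 (n + k) - gen_harm 1 n = (\<Sum>j<k. 1 / (real n + real j + 1))"
    using gen_harm_diff[of 1 n k] by simp
  ultimately have "gen_harm 1 (n + 2 * k + 2) - 2 * gen_harm 1 (n + k) + gen_harm 1 n =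
      1 / (real n + 2 * real k + 1) + 1 / (real n + 2 * real k + 2) - (\<Sum>j<k. t j)"
    by (simp add: t_def sum_subtractf)
  moreover have "0 \<le> (\<Sum>j<k. t j)" "(\<Sum>j<k. t j) \<le> real k * q"
    using sum_nonneg[of "{..<k}" t] sum_bounded_above[of "{..<k}" t q] t by auto
  moreover have "real k * q = real k ^ 2 / ((real n + 1) * (real n + real k + 1))"
    by (simp add: q_def power2_eq_square)
  moreover have "1 / (real n + 2 * real k + 1) \<le> 1 / (real n + 1)" "1 / (real n + 2 * real k + 2) \<le> 1 / (real n + 1)"
      "0 \<le> 1 / (real n + 2 * real k + 1)" "0 \<le> 1 / (real n + 2 * real k + 2)"
    by (auto intro!: divide_left_mono)
  ultimately show ?thesis
    by (simp only: abs_le_iff) linarith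
qed

lemma e1_poly_nonneg: "x \<ge> 0 \<Longrightarrow> z \<ge> 0 \<Longrightarrow> e1_poly x z \<ge> 0"
  unfolding e1_poly_def by (intro add_nonneg_nonneg mult_nonneg_nonneg zero_le_power) simp_all

lemma e2_poly_nonneg: "x \<ge> 0 \<Longrightarrow> z \<ge> 0 \<Longrightarrow> e2_poly x z \<ge> 0"
  unfolding e2_poly_def by (intro add_nonneg_nonneg mult_nonneg_nonneg zero_le_power) simp_all

lemma e3_poly_nonneg: "x \<ge> 0 \<Longrightarrow> z \<ge> 0 \<Longrightarrow> e3_poly x z \<ge> 0"
  unfolding e3_poly_def by (intro add_nonneg_nonneg mult_nonneg_nonneg zero_le_power) simp_all

lemma shift_poly_nonneg: "x \<ge> 0 \<Longrightarrow> z \<ge> 0 \<Longrightarrow> shift_poly x z \<ge> 0"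
  unfolding shift_poly_def by (intro add_nonneg_nonneg mult_nonneg_nonneg zero_le_power) simp_all

lemma shift_poly_dx_nonneg: "x \<ge> 0 \<Longrightarrow> z \<ge> 0 \<Longrightarrow> shift_poly_dx x z \<ge> 0"
  unfolding shift_poly_dx_def by (intro add_nonneg_nonneg mult_nonneg_nonneg zero_le_power) simp_all

lemma cert_poly_dx_nonneg: "x \<ge> 0 \<Longrightarrow> z \<ge> 0 \<Longrightarrow> cert_poly_dx x z \<ge> 0"
  unfolding cert_poly_dx_def by (intro add_nonneg_nonneg mult_nonneg_nonneg zero_le_power) simp_all

lemma null_inverse: "(\<lambda>n. c / (real n + 1)) \<longlonglongrightarrow> 0"
  by real_asymp

section \<open>First-order deformations\<close>

text \<open>
  The functions \<open>dlog_e1\<close>, \<open>dlog_e2\<close>, \<open>dlog_e3\<close> are the harmonic factors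
  \<open>L\<close> of the deformed pairs, that is, logarithmic derivatives of the products in the second half of
  the pair. This explains the arguments: \<open>n + k\<close> and \<open>k\<close> come from the numerator,
  \<open>n + 2 k + 2\<close> and the half-integers from the denominator. For \<open>dlog_e1\<close> the direction
  is \<open>e\<^sub>1\<close> minus \<open>(1; 0, 1, 1, 1)\<close>.
\<close>
definition dlog_e1 :: "nat \<Rightarrow> nat \<Rightarrow> real" where
  "dlog_e1 n k = gen_harm 1 (n + 2 * k + 2) - 2 * gen_harm 1 (n + k) + gen_harm 1 k - half_harm 1 k + half_harm 1 n"

text \<open>
  The gap occurs in \<open>dlog_e1\<close> once at \<open>n\<close> and once at \<open>k\<close>, with opposite
  signs, so that its limit \<open>ln 4\<close> cancels.
\<close>
definition half_gap :: "nat \<Rightarrow> real" where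
  "half_gap n = half_harm 1 n - gen_harm 1 n"

lemma half_gap_convergent: "convergent half_gap"
proof -
  have "incseq half_gap"
  proof (rule incseq_SucI)
    fix n
    have "1 / (real n + 1) \<le> 1 / (real n + 1 / 2)"
      by (intro divide_left_mono) auto
    then show "half_gap n \<le> half_gap (Suc n)"
      by (simp add: half_gap_def)
  qed
  moreover have "half_gap n \<le> 2 * zeta_nat 2" for n
  proof -
    have "half_gap n \<le> 2 * gen_harm 2 n"
    proof (induction n)
      case (Suc n)
      have "1 / (real n + 1 / 2) - 1 / (real n + 1) = 1 / 2 / ((real n + 1 / 2) * (real n + 1))"
      proof -
        have "real n + 1 / 2 \<noteq> 0" "real n + 1 \<noteq> 0" by linarith+
        then show ?thesis by (simp add: divide_simps)
      qed
      also have "\<dots> \<le> 1 / 2 / ((real n + 1) / 4 * (real n + 1))"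
        by (intro divide_left_mono mult_right_mono) auto
      also have "\<dots> = 2 * (1 / (real n + 1) ^ 2)"
        by (simp add: power2_eq_square)
      finally show ?case using Suc by (simp add: half_gap_def)
    qed (simp add: half_gap_def)
    also have "\<dots> \<le> 2 * zeta_nat 2"
      using gen_harm_le_zeta[of 2 n] by simp
    finally show ?thesis .
  qed
  ultimately obtain l where "half_gap \<longlonglongrightarrow> l"
    using incseq_convergent[of half_gap "2 * zeta_nat 2"] by blast
  then show ?thesis
    by (rule convergentI)
qed

lemma first_order_series:
  fixes L phi :: "nat \<Rightarrow> nat \<Rightarrow> real" and p :: "real \<Rightarrow> real \<Rightarrow> real" and a b c :: "nat \<Rightarrow> real"
  assumes residual: "\<And>n k. ratio_k (real n) (real k) *
        ((2 * real n + 3 * real k + 5) * (L n (Suc k) - L n k) + phi n (Suc k)) - phi n k =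
      - corr (3 + j) p (real n) (real k) - ratio_x (real n) (real k) *
        (cert (real n + 1) (real k) * (L (Suc n) k - L n k) - corr (3 + j) p (real n + 1) (real k))"
    and growth: "\<And>n. poly_growth (L n)" "\<And>n. poly_growth (phi n)"
    and p_nonneg: "\<And>x z. x \<ge> 0 \<Longrightarrow> z \<ge> 0 \<Longrightarrow> p x z \<ge> 0"
    and p_le: "\<And>x z. x \<ge> 0 \<Longrightarrow> z \<ge> 0 \<Longrightarrow> (z + 1) * p x z \<le> M * (cert_poly x z * (2 * z + 1) ^ j)"
    and bulk: "\<And>n k. \<bar>L n k - l\<bar> \<le> a n + b k + c n * spread (real n) k"
    and null: "a \<longlonglongrightarrow> 0" "b \<longlonglongrightarrow> 0" "c \<longlonglongrightarrow> 0"
    and nonneg: "\<And>n. a n \<ge> 0" "\<And>n. b n \<ge> 0" "\<And>n. c n \<ge> 0" "M \<ge> 0"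
    and initial: "(\<lambda>n. ((2 * real n + 2) * L n 0 + phi n 0) / (real n + 1) ^ 3) sums S"
  shows "(\<lambda>k. kern 0 k * (cert 0 (real k) * L 0 k - corr (3 + j) p 0 (real k))) sums (l * pi\<^sup>2 - S)"
proof -
  define A where "A n k = (2 * real n + 3 * real k + 2) * L n k + phi n k" for n k :: nat
  define B where "B n k = cert (real n) (real k) * L n k + - corr (3 + j) p (real n) (real k)" for n k :: nat
  have "(\<lambda>k. kern 0 k * B 0 k) sums (l * pi\<^sup>2 - S)"
  \<comment> \<open>The summand \<open>M / (k + 1)\<close> accounts for the correction of the certificate, see \<open>corr_bounds\<close>.\<close>
  proof (rule deformed_series[where A = A and a = a and b = "\<lambda>k. b k + M / (real k + 1)" and c = c])
    show "kern (real n) (Suc k) * A n (Suc k) - kern (real n) k * A n k =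
        kern (real n) k * B n k - kern (real (Suc n)) k * B (Suc n) k" for n k
      unfolding A_def B_def by (rule wz_deformed) (use residual in \<open>simp add: add.commute\<close>)
    show "\<exists>C p. \<forall>k. \<bar>A n k\<bar> \<le> C * (real k + 1) ^ p" for n
      unfolding A_def poly_growth_def[symmetric] by (intro poly_growth_intros growth)
    show "\<bar>B n k - l * cert (real n) (real k)\<bar> \<le>
        (a n + (b k + M / (real k + 1)) + c n * spread (real n) k) * cert (real n) (real k)" for n k
    proof -
      have c: "cert (real n) (real k) \<ge> 0"
        by (intro less_imp_le[OF cert_pos]) auto
      have "\<bar>corr (3 + j) p (real n) (real k)\<bar> \<le> M / (real k + 1) * cert (real n) (real k)"
        by (intro corr_bounds p_nonneg p_le) auto
      moreover have "\<bar>cert (real n) (real k) * (L n k - l)\<bar> \<le>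
          (a n + b k + c n * spread (real n) k) * cert (real n) (real k)"
        using mult_right_mono[OF bulk c, of n k] c by (simp add: abs_mult mult.commute)
      ultimately show ?thesis
        unfolding B_def by (simp add: algebra_simps)
    qed
    show "(\<lambda>k. b k + M / (real k + 1)) \<longlonglongrightarrow> 0"
      using tendsto_add[OF null(2) null_inverse[of M]] by simp
    show "(\<lambda>n. A n 0 / (real n + 1) ^ 3) sums S"
      using initial by (simp add: A_def)
  qed (use null nonneg in auto)
  then show ?thesis
    by (simp add: B_def)
qed

lemma null_gap: "X \<longlonglongrightarrow> (d :: real) \<Longrightarrow> (\<lambda>n. \<bar>X n - d\<bar>) \<longlonglongrightarrow> 0"
  by (simp add: LIM_zero_iff tendsto_rabs_zero_iff)

lemma poly_growth_harm_arguments: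
  "poly_growth (\<lambda>k. gen_harm m (n + 2 * k + 2))" "poly_growth (\<lambda>k. gen_harm m (n + k))"
  "poly_growth (\<lambda>k. gen_harm m k)" "poly_growth (\<lambda>k. half_harm m k)"
  "poly_growth (\<lambda>k. gen_harm m (n + 2 * k + 1))" "poly_growth (\<lambda>k. half_harm m (n + 3 * k + 1))"
  by (auto intro!: poly_growth_gen_harm poly_growth_half_harm poly_growth_intros simp del: gen_harm_Suc half_harm_Suc)

text \<open>
  Second differences of harmonic numbers and differences of gaps are both negligible in the bulk, whence \<open>l
  = 0\<close>.
\<close>
lemma series_dlog_e1:
  "(\<lambda>k. kern 0 k * (cert 0 (real k) * dlog_e1 0 k - corr 4 e1_poly 0 (real k))) sums (- 6 * zeta_nat 3)"
proof -
  obtain d where d: "half_gap \<longlonglongrightarrow> d"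
    using half_gap_convergent by (auto simp: convergent_def)
  define phi where "phi n k = (2 * real n + 3 * real k + 2) * (2 / (2 * real n + 1) - 1 / (real n + 2 * real k + 2)) - 1"
    for n k :: nat
  have "(\<lambda>k. kern 0 k * (cert 0 (real k) * dlog_e1 0 k - corr (3 + 1) e1_poly 0 (real k))) sums (0 * pi\<^sup>2 - 6 * zeta_nat 3)"
  proof (rule first_order_series[where phi = phi and a = "\<lambda>n. \<bar>half_gap n - d\<bar> + 2 / (real n + 1) + 1 / sqrt (real n + 1)"
        and b = "\<lambda>k. \<bar>half_gap k - d\<bar>" and c = "\<lambda>n. 8 / sqrt (real n + 1)" and M = 3])
    fix n k :: nat
    have k: "dlog_e1 n (Suc k) - dlog_e1 n k = 1 / (real n + 2 * real k + 3) + 1 / (real n + 2 * real k + 4)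
        - 2 / (real n + real k + 1) + 1 / (real k + 1) - 2 / (2 * real k + 1)"
      unfolding dlog_e1_def harm_increments by simp
    have x: "dlog_e1 (Suc n) k - dlog_e1 n k = 1 / (real n + 2 * real k + 3) - 2 / (real n + real k + 1)
        + 2 / (2 * real n + 1)"
      unfolding dlog_e1_def harm_increments by simp
    show "ratio_k (real n) (real k) * ((2 * real n + 3 * real k + 5) * (dlog_e1 n (Suc k) - dlog_e1 n k) + phi n (Suc k))
          - phi n k = - corr (3 + 1) e1_poly (real n) (real k) - ratio_x (real n) (real k) *
        (cert (real n + 1) (real k) * (dlog_e1 (Suc n) k - dlog_e1 n k) - corr (3 + 1) e1_poly (real n + 1) (real k))"
      unfolding k x phi_def using wz_e1[of "real n" "real k"] by (simp add: add.commute)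
    have "dlog_e1 n k = (gen_harm 1 (n + 2 * k + 2) - 2 * gen_harm 1 (n + k) + gen_harm 1 n) + (half_gap n - d) - (half_gap k - d)"
      by (simp add: dlog_e1_def half_gap_def)
    then have "\<bar>dlog_e1 n k\<bar> \<le> 2 / (real n + 1) + (1 + 8 * spread (real n) k) / sqrt (real n + 1)
        + \<bar>half_gap n - d\<bar> + \<bar>half_gap k - d\<bar>"
      using gen_harm_second_difference[of n k] spread_dominates[of k n] by linarith
    then show "\<bar>dlog_e1 n k - 0\<bar> \<le> \<bar>half_gap n - d\<bar> + 2 / (real n + 1) + 1 / sqrt (real n + 1) + \<bar>half_gap k - d\<bar>
        + 8 / sqrt (real n + 1) * spread (real n) k"
      by (simp add: add_divide_distrib)
  next
    fix n
    show "poly_growth (dlog_e1 n)"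
      unfolding dlog_e1_def by (intro poly_growth_intros poly_growth_harm_arguments)
    show "poly_growth (phi n)"
      unfolding phi_def by (intro poly_growth_intros poly_growth_divide) auto
  next
    have sq0: "(\<lambda>n. c / sqrt (real n + 1)) \<longlonglongrightarrow> 0" for c :: real
      by real_asymp
    show "(\<lambda>n. \<bar>half_gap n - d\<bar> + 2 / (real n + 1) + 1 / sqrt (real n + 1)) \<longlonglongrightarrow> 0"
      using tendsto_add[OF tendsto_add[OF null_gap[OF d] null_inverse[of 2]] sq0[of 1]] by simp
    show "(\<lambda>n. 8 / sqrt (real n + 1)) \<longlonglongrightarrow> 0" by (rule sq0)
    show "(\<lambda>n. \<bar>half_gap n - d\<bar>) \<longlonglongrightarrow> 0" by (rule null_gap[OF d])
  next
    show "(\<lambda>n. ((2 * real n + 2) * dlog_e1 n 0 + phi n 0) / (real n + 1) ^ 3) sums (6 * zeta_nat 3)"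
    proof -
      have term_eq: "((2 * real n + 2) * dlog_e1 n 0 + phi n 0) / (real n + 1) ^ 3 =
          3 * (1 / (real n + 1) ^ 3) - 2 * (gen_harm 1 (n + 1) / (real n + 1) ^ 2)
          + 2 * (half_harm 1 (n + 1) / (real n + 1) ^ 2)" for n
      proof -
        have nz: "real n + 1 \<noteq> 0" "real n + 2 \<noteq> 0" "2 * real n + 1 \<noteq> 0" by linarith+
        have lv: "dlog_e1 n 0 = 1 / (real n + 1) + 1 / (real n + 2) - gen_harm 1 n + half_harm 1 n"
          by (simp add: dlog_e1_def add_ac)
        have h: "gen_harm 1 (n + 1) = gen_harm 1 n + 1 / (real n + 1)"
            "half_harm 1 (n + 1) = half_harm 1 n + 2 / (2 * real n + 1)"
          using harm_increments(6)[of 1 n] by (simp_all add: add_ac)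
        show ?thesis
          unfolding phi_def lv h using nz by (simp add: divide_simps) algebra
      qed
      have "(\<lambda>n. 3 * (1 / (real n + 1) ^ 3) - 2 * (gen_harm 1 (n + 1) / (real n + 1) ^ 2)
          + 2 * (half_harm 1 (n + 1) / (real n + 1) ^ 2)) sums
          (3 * zeta_nat 3 - 2 * (dzeta 2 1 + zeta_nat (2 + 1)) + 2 * (7 / 2 * zeta_nat 3))"
        using zeta_nat_sums[of 3]
        by (intro sums_add sums_diff sums_mult sums_gen_harm_powers half_euler_21) (simp_all add: add.commute)
      then show ?thesis
        unfolding term_eq by (simp add: euler_21[unfolded One_nat_def] del: gen_harm_Suc half_harm_Suc)
    qed
  next
    fix x z :: real assume "x \<ge> 0" "z \<ge> 0"
    then show "e1_poly x z \<ge> 0" "(z + 1) * e1_poly x z \<le> 3 * (cert_poly x z * (2 * z + 1) ^ 1)"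
      using e1_poly_nonneg e1_poly_le by auto
  qed auto
  then show ?thesis by simp
qed

definition dlog_e2 :: "nat \<Rightarrow> nat \<Rightarrow> real" where
  "dlog_e2 n k = gen_harm 2 (n + k) + gen_harm 2 k - gen_harm 2 (n + 2 * k + 2) - half_harm 2 k"

text \<open>
  For large \<open>n\<close> the harmonic numbers at \<open>n + k\<close> and \<open>n + 2 k + 2\<close> cancel,
  and for large \<open>k\<close> the rest tends to \<open>l = \<zeta>(2) - 3 \<zeta>(2)\<close>.
\<close>
lemma series_dlog_e2:
  "(\<lambda>k. kern 0 k * (cert 0 (real k) * dlog_e2 0 k - corr 5 e2_poly 0 (real k))) sums (- 14 / 45 * pi ^ 4)"
proof -
  define X where "X k = gen_harm 2 k - half_harm 2 k" for k
  have X: "X \<longlonglongrightarrow> - 2 * zeta_nat 2"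
    using tendsto_diff[OF gen_harm_LIMSEQ[of 2] half_harm_LIMSEQ[of 2]] by (simp add: X_def[abs_def])
  define phi where "phi n k = (2 * real n + 3 * real k + 2) / (real n + 2 * real k + 2) ^ 2" for n k :: nat
  have "(\<lambda>k. kern 0 k * (cert 0 (real k) * dlog_e2 0 k - corr (3 + 2) e2_poly 0 (real k))) sums
      (- 2 * zeta_nat 2 * pi\<^sup>2 - - 2 * zeta_nat 4)"
  proof (rule first_order_series[where phi = phi and a = "\<lambda>n. \<bar>gen_harm 2 n - zeta_nat 2\<bar>"
        and b = "\<lambda>k. \<bar>X k - - 2 * zeta_nat 2\<bar>" and c = "\<lambda>n. 0" and M = 4])
    fix n k :: nat
    have k: "dlog_e2 n (Suc k) - dlog_e2 n k = 1 / (real n + real k + 1) ^ 2 + 1 / (real k + 1) ^ 2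
        - 1 / (real n + 2 * real k + 3) ^ 2 - 1 / (real n + 2 * real k + 4) ^ 2 - 4 / (2 * real k + 1) ^ 2"
      unfolding dlog_e2_def harm_increments by simp
    have x: "dlog_e2 (Suc n) k - dlog_e2 n k = 1 / (real n + real k + 1) ^ 2 - 1 / (real n + 2 * real k + 3) ^ 2"
      unfolding dlog_e2_def harm_increments by simp
    show "ratio_k (real n) (real k) * ((2 * real n + 3 * real k + 5) * (dlog_e2 n (Suc k) - dlog_e2 n k) + phi n (Suc k))
          - phi n k = - corr (3 + 2) e2_poly (real n) (real k) - ratio_x (real n) (real k) *
        (cert (real n + 1) (real k) * (dlog_e2 (Suc n) k - dlog_e2 n k) - corr (3 + 2) e2_poly (real n + 1) (real k))"
      unfolding k x phi_def using wz_e2[of "real n" "real k"] by (simp add: add.commute)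
    have "gen_harm 2 n \<le> gen_harm 2 (n + k)" "gen_harm 2 (n + k) \<le> gen_harm 2 (n + 2 * k + 2)"
        "gen_harm 2 (n + 2 * k + 2) \<le> zeta_nat 2"
      by (auto intro!: gen_harm_mono gen_harm_le_zeta simp del: gen_harm_Suc)
    then show "\<bar>dlog_e2 n k - - 2 * zeta_nat 2\<bar> \<le> \<bar>gen_harm 2 n - zeta_nat 2\<bar> + \<bar>X k - - 2 * zeta_nat 2\<bar> + 0 * spread (real n) k"
      unfolding dlog_e2_def X_def by linarith
  next
    fix n
    show "poly_growth (dlog_e2 n)"
      unfolding dlog_e2_def by (intro poly_growth_intros poly_growth_harm_arguments)
    show "poly_growth (phi n)"
      unfolding phi_def by (intro poly_growth_intros poly_growth_divide) (auto simp: one_le_power)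
  next
    show "(\<lambda>n. \<bar>gen_harm 2 n - zeta_nat 2\<bar>) \<longlonglongrightarrow> 0" by (intro null_gap gen_harm_LIMSEQ) simp
    show "(\<lambda>k. \<bar>X k - - 2 * zeta_nat 2\<bar>) \<longlonglongrightarrow> 0" by (rule null_gap[OF X])
  next
    show "(\<lambda>n. ((2 * real n + 2) * dlog_e2 n 0 + phi n 0) / (real n + 1) ^ 3) sums (- 2 * zeta_nat 4)"
    proof -
      have term_eq: "((2 * real n + 2) * dlog_e2 n 0 + phi n 0) / (real n + 1) ^ 3 = - 2 * (1 / real (Suc n) ^ 4)" for n
      proof -
        have nz: "real n + 1 \<noteq> 0" "real n + 2 \<noteq> 0" by linarith+
        have lv: "dlog_e2 n 0 = - (1 / (real n + 1) ^ 2) - 1 / (real n + 2) ^ 2" "real (Suc n) = real n + 1"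
          by (simp_all add: dlog_e2_def add_ac)
        show ?thesis
          unfolding phi_def lv using nz by (simp add: divide_simps) algebra
      qed
      show ?thesis
        unfolding term_eq by (intro sums_mult zeta_nat_sums) simp
    qed
  next
    fix x z :: real assume "x \<ge> 0" "z \<ge> 0"
    then show "e2_poly x z \<ge> 0" "(z + 1) * e2_poly x z \<le> 4 * (cert_poly x z * (2 * z + 1) ^ 2)"
      using e2_poly_nonneg e2_poly_le by auto
  qed auto
  moreover have "- 2 * zeta_nat 2 * pi\<^sup>2 - - 2 * zeta_nat 4 = - 14 / 45 * pi ^ 4"
    by (simp add: zeta_2 zeta_4 power2_eq_square power4_eq_xxxx)
  ultimately show ?thesis by simp
qed

definition dlog_e3 :: "nat \<Rightarrow> nat \<Rightarrow> real" where
  "dlog_e3 n k = gen_harm 3 (n + k) + gen_harm 3 k + gen_harm 3 (n + 2 * k + 2) - half_harm 3 k"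

text \<open>
  Here \<open>l = \<zeta>(3) + \<zeta>(3) + \<zeta>(3) - 7 \<zeta>(3)\<close>.
\<close>
lemma series_dlog_e3:
  "(\<lambda>k. kern 0 k * (cert 0 (real k) * dlog_e3 0 k - corr 6 e3_poly 0 (real k))) sums
     (- 8 / 3 * pi\<^sup>2 * zeta_nat 3 - 20 * zeta_nat 5)"
proof -
  define X where "X k = gen_harm 3 k - half_harm 3 k" for k
  have X: "X \<longlonglongrightarrow> - 6 * zeta_nat 3"
    using tendsto_diff[OF gen_harm_LIMSEQ[of 3] half_harm_LIMSEQ[of 3]] by (simp add: X_def[abs_def])
  define phi where "phi n k = - (2 * real n + 3 * real k + 2) / (real n + 2 * real k + 2) ^ 3" for n k :: nat
  have "(\<lambda>k. kern 0 k * (cert 0 (real k) * dlog_e3 0 k - corr (3 + 3) e3_poly 0 (real k))) sums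
      (- 4 * zeta_nat 3 * pi\<^sup>2 - (4 * dzeta 2 3 + 2 * zeta_nat 5))"
  proof (rule first_order_series[where phi = phi and a = "\<lambda>n. 2 * \<bar>gen_harm 3 n - zeta_nat 3\<bar>"
        and b = "\<lambda>k. \<bar>X k - - 6 * zeta_nat 3\<bar>" and c = "\<lambda>n. 0" and M = 11])
    fix n k :: nat
    have k: "dlog_e3 n (Suc k) - dlog_e3 n k = 1 / (real n + real k + 1) ^ 3 + 1 / (real k + 1) ^ 3
        + 1 / (real n + 2 * real k + 3) ^ 3 + 1 / (real n + 2 * real k + 4) ^ 3 - 8 / (2 * real k + 1) ^ 3"
      unfolding dlog_e3_def harm_increments by simp
    have x: "dlog_e3 (Suc n) k - dlog_e3 n k = 1 / (real n + real k + 1) ^ 3 + 1 / (real n + 2 * real k + 3) ^ 3"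
      unfolding dlog_e3_def harm_increments by simp
    show "ratio_k (real n) (real k) * ((2 * real n + 3 * real k + 5) * (dlog_e3 n (Suc k) - dlog_e3 n k) + phi n (Suc k))
          - phi n k = - corr (3 + 3) e3_poly (real n) (real k) - ratio_x (real n) (real k) *
        (cert (real n + 1) (real k) * (dlog_e3 (Suc n) k - dlog_e3 n k) - corr (3 + 3) e3_poly (real n + 1) (real k))"
      unfolding k x phi_def using wz_e3[of "real n" "real k"] by (simp add: add.commute)
    have "gen_harm 3 n \<le> gen_harm 3 (n + k)" "gen_harm 3 (n + k) \<le> zeta_nat 3" "gen_harm 3 n \<le> gen_harm 3 (n + 2 * k + 2)"
        "gen_harm 3 (n + 2 * k + 2) \<le> zeta_nat 3"
      by (auto intro!: gen_harm_mono gen_harm_le_zeta simp del: gen_harm_Suc)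
    then have "\<bar>gen_harm 3 (n + k) - zeta_nat 3\<bar> \<le> \<bar>gen_harm 3 n - zeta_nat 3\<bar>"
        "\<bar>gen_harm 3 (n + 2 * k + 2) - zeta_nat 3\<bar> \<le> \<bar>gen_harm 3 n - zeta_nat 3\<bar>"
      by linarith+
    moreover have "dlog_e3 n k - - 4 * zeta_nat 3 = (gen_harm 3 (n + k) - zeta_nat 3) +
        (gen_harm 3 (n + 2 * k + 2) - zeta_nat 3) + (X k - - 6 * zeta_nat 3)"
      by (simp add: dlog_e3_def X_def del: gen_harm_Suc)
    moreover have "\<bar>e\<bar> \<le> 2 * r + \<bar>w\<bar> + 0 * s" if "\<bar>u\<bar> \<le> r" "\<bar>v\<bar> \<le> r" "e = u + v + w" for e r s u v w :: real
      using that by simp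
    ultimately show "\<bar>dlog_e3 n k - - 4 * zeta_nat 3\<bar> \<le> 2 * \<bar>gen_harm 3 n - zeta_nat 3\<bar> + \<bar>X k - - 6 * zeta_nat 3\<bar> + 0 * spread (real n) k"
      by blast
  next
    fix n
    show "poly_growth (dlog_e3 n)"
      unfolding dlog_e3_def by (intro poly_growth_intros poly_growth_harm_arguments)
    show "poly_growth (phi n)"
      unfolding phi_def by (intro poly_growth_intros poly_growth_divide) (auto simp: one_le_power)
  next
    show "(\<lambda>n. 2 * \<bar>gen_harm 3 n - zeta_nat 3\<bar>) \<longlonglongrightarrow> 0"
      using tendsto_mult[OF tendsto_const null_gap[OF gen_harm_LIMSEQ[of 3]], of 2] by simp
    show "(\<lambda>k. \<bar>X k - - 6 * zeta_nat 3\<bar>) \<longlonglongrightarrow> 0" by (rule null_gap[OF X])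
  next
    show "(\<lambda>n. ((2 * real n + 2) * dlog_e3 n 0 + phi n 0) / (real n + 1) ^ 3) sums (4 * dzeta 2 3 + 2 * zeta_nat 5)"
    proof -
      have term_eq: "((2 * real n + 2) * dlog_e3 n 0 + phi n 0) / (real n + 1) ^ 3 =
          4 * dzeta_term 2 3 n + 2 * (1 / real (Suc n) ^ 5)" for n
      proof -
        have nz: "real n + 1 \<noteq> 0" "real n + 2 \<noteq> 0" by linarith+
        have lv: "dlog_e3 n 0 = 2 * gen_harm 3 n + 1 / (real n + 1) ^ 3 + 1 / (real n + 2) ^ 3" "real (Suc n) = real n + 1"
          by (simp_all add: dlog_e3_def add_ac)
        show ?thesis
          unfolding phi_def lv dzeta_term_def using nz by (simp add: divide_simps) algebra
      qed
      show ?thesis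
        unfolding term_eq by (intro sums_add sums_mult zeta_nat_sums dzeta_sums) simp_all
    qed
  next
    fix x z :: real assume "x \<ge> 0" "z \<ge> 0"
    then show "e3_poly x z \<ge> 0" "(z + 1) * e3_poly x z \<le> 11 * (cert_poly x z * (2 * z + 1) ^ 3)"
      using e3_poly_nonneg e3_poly_le by auto
  qed auto
  moreover have "- 4 * zeta_nat 3 * pi\<^sup>2 - (4 * dzeta 2 3 + 2 * zeta_nat 5) = - 8 / 3 * pi\<^sup>2 * zeta_nat 3 - 20 * zeta_nat 5"
    by (simp add: zeta_2 dzeta_23 algebra_simps)
  ultimately have "(\<lambda>k. kern 0 k * (cert 0 (real k) * dlog_e3 0 k - corr (3 + 3) e3_poly 0 (real k))) sums
      (- 8 / 3 * pi\<^sup>2 * zeta_nat 3 - 20 * zeta_nat 5)"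
    by (simp only:)
  then show ?thesis by simp
qed

section \<open>A mixed second-order deformation\<close>

text \<open>
  Harmonic factor for the direction \<open>(1; 0, 1, 1, 1)\<close>. Both it and \<open>shift_poly\<close> vanish
  for \<open>n = 0\<close>; therefore at \<open>n = 0\<close> the derivative of the deformed pair in
  \<open>n\<close> contains no products of harmonic numbers.
\<close>
definition dlog_shift :: "nat \<Rightarrow> nat \<Rightarrow> real" where
  "dlog_shift n k = 3 * gen_harm 1 (n + k) - 3 * gen_harm 1 k - half_harm 1 n"

text \<open>
  The derivative of \<open>dlog_shift\<close> in \<open>n\<close>, harmonic numbers being interpolated by digamma
  functions. The constants that arise, \<open>3 \<zeta>(2)\<close> from the integers and \<open>\<pi>\<^sup>2 /
  2\<close> from the half-integers, cancel.
\<close>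
definition dlog_shift_dx :: "nat \<Rightarrow> nat \<Rightarrow> real" where
  "dlog_shift_dx n k = half_harm 2 n - 3 * gen_harm 2 (n + k)"

text \<open>
  The logarithmic derivative of \<open>kern\<close> in \<open>x\<close>, at \<open>x = n\<close>.
\<close>
definition kern_log_dx :: "nat \<Rightarrow> nat \<Rightarrow> real" where
  "kern_log_dx n k =
     half_harm 1 (n + 3 * k + 1) - half_harm 1 (n + 1) - 3 * (gen_harm 1 (n + 2 * k + 1) - gen_harm 1 (n + k))"

lemma kern_log_dx_increments:
  "kern_log_dx n (Suc k) = kern_log_dx n k + (2 / (2 * real n + 6 * real k + 3) + 2 / (2 * real n + 6 * real k + 5)
     + 2 / (2 * real n + 6 * real k + 7) + 3 / (real n + real k + 1) - 3 / (real n + 2 * real k + 2)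
     - 3 / (real n + 2 * real k + 3))"
  "kern_log_dx (Suc n) k = kern_log_dx n k + (2 / (2 * real n + 6 * real k + 3) + 3 / (real n + real k + 1)
     - 2 / (2 * real n + 3) - 3 / (real n + 2 * real k + 2))"
proof -
  have e: "n + 3 * Suc k + 1 = Suc (Suc (Suc (n + 3 * k + 1)))" "n + 2 * Suc k + 1 = Suc (Suc (n + 2 * k + 1))"
      "n + Suc k = Suc (n + k)" "Suc n + 3 * k + 1 = Suc (n + 3 * k + 1)" "Suc n + 1 = Suc (n + 1)"
      "Suc n + 2 * k + 1 = Suc (n + 2 * k + 1)" "Suc n + k = Suc (n + k)"
    by simp_all
  show "kern_log_dx n (Suc k) = kern_log_dx n k + (2 / (2 * real n + 6 * real k + 3) + 2 / (2 * real n + 6 * real k + 5)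
     + 2 / (2 * real n + 6 * real k + 7) + 3 / (real n + real k + 1) - 3 / (real n + 2 * real k + 2)
     - 3 / (real n + 2 * real k + 3))"
    unfolding kern_log_dx_def e harm_increments(5,6) by (simp add: add_ac del: gen_harm_Suc half_harm_Suc)
  show "kern_log_dx (Suc n) k = kern_log_dx n k + (2 / (2 * real n + 6 * real k + 3) + 3 / (real n + real k + 1)
     - 2 / (2 * real n + 3) - 3 / (real n + 2 * real k + 2))"
    unfolding kern_log_dx_def e harm_increments(5,6) by (simp add: add_ac del: gen_harm_Suc half_harm_Suc)
qed

text \<open>
  Grouping the half-integers into three blocks of length \<open>k\<close>, one obtains second differences of the
  reciprocal function with step \<open>k\<close>, each at most of order \<open>k\<^sup>2 / n\<^sup>3\<close>, and
  errors caused by the offset \<open>1/2\<close>.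
\<close>
lemma kern_log_dx_bound: "\<bar>kern_log_dx n k\<bar> \<le> 8 * (spread (real n) k + 1) / (real n + 1)"
proof -
  define m where "m = real k"
  define N where "N = real n + 1"
  have m: "m \<ge> 0" and N: "N \<ge> 1" by (auto simp: m_def N_def)
  define t where "t j = 1 / (N + real j + 1 / 2) + 1 / (N + m + real j + 1 / 2) + 1 / (N + 2 * m + real j + 1 / 2)
      - 3 * (1 / (N + m + real j))" for j :: nat
  define q where "q = 2 * m ^ 2 / (N * (N + m) ^ 2) + 3 / 2 / (N + m) ^ 2"
  have t: "\<bar>t j\<bar> \<le> q" for j
  proof -
    define a where "a = N + real j + 1 / 2"
    have a: "a \<ge> N" by (simp add: a_def)
    have "t j = 2 * m ^ 2 / (a * ((a + m) * (a + 2 * m))) - 3 / 2 / ((a + m - 1 / 2) * (a + m))"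
    proof -
      have "1 / u + 1 / p + 1 / s - 3 / b = 2 * m ^ 2 / (u * (p * s)) - 3 / 2 / (b * p)"
        if "u \<noteq> 0" "p \<noteq> 0" "s \<noteq> 0" "b \<noteq> 0" "p = u + m" "s = u + 2 * m" "2 * b = 2 * p - 1" for u p s b
        using that(1-4) by (simp add: divide_simps) (use that(5-7) in algebra)
      moreover have "a \<noteq> 0" "a + m \<noteq> 0" "a + 2 * m \<noteq> 0" "a + m - 1 / 2 \<noteq> 0" using a m N by auto
      moreover have "t j = 1 / a + 1 / (a + m) + 1 / (a + 2 * m) - 3 / (a + m - 1 / 2)"
        by (simp add: t_def a_def algebra_simps)
      ultimately show ?thesis
        by simp
    qed
    moreover have "0 \<le> 2 * m ^ 2 / (a * ((a + m) * (a + 2 * m)))" "0 \<le> 3 / 2 / ((a + m - 1 / 2) * (a + m))"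
      using a m N by auto
    moreover have "2 * m ^ 2 / (a * ((a + m) * (a + 2 * m))) \<le> 2 * m ^ 2 / (N * (N + m) ^ 2)"
      unfolding power2_eq_square[of "N + m"] using a m N by (intro divide_left_mono mult_mono mult_pos_pos) auto
    moreover have "3 / 2 / ((a + m - 1 / 2) * (a + m)) \<le> 3 / 2 / (N + m) ^ 2"
      unfolding power2_eq_square[of "N + m"] using a m N by (intro divide_left_mono mult_mono mult_pos_pos) (auto simp: a_def)
    ultimately show ?thesis
      unfolding q_def by linarith
  qed
  have "half_harm 1 (n + 3 * k + 1) - half_harm 1 (n + 1) =
      (\<Sum>j<k. 1 / (N + real j + 1 / 2)) + (\<Sum>j<k. 1 / (N + m + real j + 1 / 2)) + (\<Sum>j<k. 1 / (N + 2 * m + real j + 1 / 2))"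
  proof -
    have e: "n + 3 * k + 1 = n + 1 + k + k + k" "real (n + 1) = N" "real (n + 1 + k) = N + m" "real (n + 1 + k + k) = N + 2 * m"
      by (simp_all add: N_def m_def)
    show ?thesis
      using half_harm_diff[of 1 "n + 1" k] half_harm_diff[of 1 "n + 1 + k" k] half_harm_diff[of 1 "n + 1 + k + k" k]
      unfolding e power_one_right by linarith
  qed
  moreover have "gen_harm 1 (n + 2 * k + 1) - gen_harm 1 (n + k) = (\<Sum>j<k. 1 / (N + m + real j)) + 1 / (N + 2 * m)"
  proof -
    have e: "n + 2 * k + 1 = Suc (n + k + k)" "real (n + k + k) + 1 = N + 2 * m"
        "real (n + k) + real j + 1 = N + m + real j" for j
      by (simp_all add: N_def m_def)
    show ?thesis
      using gen_harm_diff[of 1 "n + k" k] unfolding e(1) gen_harm_Suc e(2,3) power_one_right by linarith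
  qed
  moreover have "(\<Sum>j<k. t j) = (\<Sum>j<k. 1 / (N + real j + 1 / 2)) + (\<Sum>j<k. 1 / (N + m + real j + 1 / 2)) +
      (\<Sum>j<k. 1 / (N + 2 * m + real j + 1 / 2)) - 3 * (\<Sum>j<k. 1 / (N + m + real j))"
    unfolding t_def sum.distrib sum_subtractf sum_distrib_left ..
  ultimately have "kern_log_dx n k = (\<Sum>j<k. t j) - 3 * (1 / (N + 2 * m))"
    unfolding kern_log_dx_def by (simp only: distrib_left diff_diff_eq)
  moreover have "\<bar>\<Sum>j<k. t j\<bar> \<le> m * q"
    by (rule order_trans[OF sum_abs]) (use sum_bounded_above[of "{..<k}" "\<lambda>j. \<bar>t j\<bar>" q] t in \<open>simp add: m_def\<close>)
  moreover have "m * q \<le> 8 * (spread (real n) k / N) + 3 / 2 * (1 / N)"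
  proof -
    have "m * q = 2 * (m ^ 3 / (N + m) ^ 2 / N) + 3 / 2 * (m / (N + m) ^ 2)"
      using N m by (simp add: q_def divide_simps power2_eq_square power3_eq_cube) (simp add: algebra_simps)
    moreover have "m ^ 3 / (N + m) ^ 2 / N \<le> 4 * spread (real n) k / N"
      using cube_le_spread[of k n] N by (intro divide_right_mono) (auto simp: N_def m_def)
    moreover have "m / (N + m) ^ 2 \<le> 1 / N"
    proof -
      have "m * N \<le> (N + m) * (N + m)" using N m by (intro mult_mono) auto
      then show ?thesis using N m by (intro frac_cross_le) (auto simp: power2_eq_square)
    qed
    ultimately show ?thesis by simp
  qed
  moreover have "0 \<le> 1 / (N + 2 * m)" "1 / (N + 2 * m) \<le> 1 / N"
    using N m by (auto intro!: divide_left_mono)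
  ultimately have "\<bar>kern_log_dx n k\<bar> \<le> 8 * (spread (real n) k / N) + 8 * (1 / N)"
    by linarith
  then show ?thesis
    by (simp add: N_def add_divide_distrib)
qed

lemma dlog_shift_bound: "\<bar>dlog_shift n k\<bar> \<le> 6 * sqrt (real n + 1)"
proof -
  have "gen_harm 1 (n + k) - gen_harm 1 k \<le> gen_harm 1 n"
  proof -
    have "gen_harm 1 (k + n) - gen_harm 1 k \<le> (\<Sum>j<n. 1 / (real j + 1))"
      unfolding gen_harm_diff by (intro sum_mono) (auto intro!: divide_left_mono)
    then show ?thesis by (simp add: gen_harm_conv_lessThan add.commute)
  qed
  moreover have "gen_harm 1 k \<le> gen_harm 1 (n + k)" by (rule gen_harm_mono) simp
  moreover have "gen_harm 1 n \<le> 2 * sqrt (real n)" by (rule gen_harm_le_sqrt) simp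
  moreover have "sqrt (real n) \<le> sqrt (real n + 1)" by simp
  moreover have "half_harm 1 n \<le> 2 * gen_harm 1 n" using half_harm_le[of 1 n] by simp
  moreover note half_harm_nonneg[of 1 n] gen_harm_nonneg[of 1 n]
  ultimately show ?thesis
    unfolding dlog_shift_def abs_le_iff by (auto simp del: real_sqrt_le_iff)
qed

text \<open>
  The product rule: the second-order pair is a combination of the four identities, with the kernel and the
  harmonic factors as coefficients. Here \<open>f, g\<close> are the linear factors at \<open>k\<close> and
  \<open>k + 1\<close>, \<open>W\<close> and \<open>V\<close> stand for the certificate and its correction,
  \<open>W1\<close> and \<open>V1\<close> for their derivatives in \<open>n\<close>, \<open>M\<close> for that of
  the harmonic factor \<open>L\<close>; primes denote values at \<open>n + 1\<close>, respectively at \<open>k +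
  1\<close> for \<open>p, q\<close>.
\<close>
lemma second_order_combination:
  fixes P r t f g W W' W1 W1' V V' V1 V1' h hk hx L Lk Lx M dk dx p p' q q' :: real
  assumes base: "r * g - f = W - t * W'"
    and base_dx: "r * (hk * g + 2) - 2 = W1 - t * (hx * W' + W1')"
    and shift: "r * (g * Lk + p') - p = - V - t * (W' * Lx - V')"
    and shift_dx: "r * (hk * (g * Lk + p') + 2 * Lk - g * dk + q') - q =
      - V1 - t * (hx * (W' * Lx - V') + W1' * Lx + W' * dx - V1')"
  shows "P * r * ((h + hk) * (g * (L + Lk) + p') + 2 * (L + Lk) + g * (M - dk) + q') -
      P * (h * (f * L + p) + 2 * L + f * M + q) =
    P * (h * (W * L - V) + W1 * L + W * M - V1) -
      P * t * ((h + hx) * (W' * (L + Lx) - V') + W1' * (L + Lx) + W' * (M + dx) - V1')"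
proof -
  define R0 where "R0 = r * g - f - (W - t * W')"
  define R1 where "R1 = r * (hk * g + 2) - 2 - (W1 - t * (hx * W' + W1'))"
  define R2 where "R2 = r * (g * Lk + p') - p - (- V - t * (W' * Lx - V'))"
  define R3 where "R3 = r * (hk * (g * Lk + p') + 2 * Lk - g * dk + q') - q -
      (- V1 - t * (hx * (W' * Lx - V') + W1' * Lx + W' * dx - V1'))"
  have "(P * r * ((h + hk) * (g * (L + Lk) + p') + 2 * (L + Lk) + g * (M - dk) + q') -
        P * (h * (f * L + p) + 2 * L + f * M + q)) -
      (P * (h * (W * L - V) + W1 * L + W * M - V1) -
        P * t * ((h + hx) * (W' * (L + Lx) - V') + W1' * (L + Lx) + W' * (M + dx) - V1')) =
      P * (h * L * R0 + h * R2 + L * R1 + M * R0 + R3)"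
    unfolding R0_def R1_def R2_def R3_def by algebra
  moreover have "R0 = 0" "R1 = 0" "R2 = 0" "R3 = 0"
    using assms by (simp_all add: R0_def R1_def R2_def R3_def)
  ultimately show ?thesis by simp
qed

text \<open>
  Since the second-order pair is a derivative in \<open>n\<close>, it is smaller than the first-order pair by a
  factor of order \<open>1 / n\<close>, up to the spread. This outweighs the logarithmic growth of
  \<open>dlog_shift\<close>, so that \<open>l = 0\<close>.
\<close>
lemma series_shift:
  "(\<lambda>k. kern 0 k * (cert 0 (real k) * (- 3 * gen_harm 2 k) - corr_dx shift_poly shift_poly_dx 0 (real k))) sums
     (- 2 / 15 * pi ^ 4)"
proof -
  define phi where "phi x z = 1 - (2 * x + 3 * z + 2) * (2 / (2 * x + 1))" for x z :: real
  define dphi where "dphi x z = 4 * (2 * x + 3 * z + 2) / (2 * x + 1) ^ 2 - 4 / (2 * x + 1)" for x z :: real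
  define A where "A n k = kern_log_dx n k * ((2 * real n + 3 * real k + 2) * dlog_shift n k + phi (real n) (real k))
      + 2 * dlog_shift n k + (2 * real n + 3 * real k + 2) * dlog_shift_dx n k + dphi (real n) (real k)" for n k :: nat
  define B where "B n k = kern_log_dx n k * (cert (real n) (real k) * dlog_shift n k - corr 3 shift_poly (real n) (real k))
      + cert_dx (real n) (real k) * dlog_shift n k + cert (real n) (real k) * dlog_shift_dx n k
      - corr_dx shift_poly shift_poly_dx (real n) (real k)" for n k :: nat
  define a where "a n = 126 / sqrt (real n + 1) + (\<bar>half_harm 2 n - 3 * zeta_nat 2\<bar> + 3 * \<bar>gen_harm 2 n - zeta_nat 2\<bar>)" for n
  have "(\<lambda>k. kern 0 k * B 0 k) sums (0 * pi\<^sup>2 - 2 / 15 * pi ^ 4)"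
  \<comment> \<open>The constants \<open>126 = 64 + 48 + 14\<close> and \<open>64\<close> collect the four parts of \<open>B\<close>.\<close>
  proof (rule deformed_series[where A = A and a = a and b = "\<lambda>k. 0" and c = "\<lambda>n. 64 / sqrt (real n + 1)"])
    fix n k :: nat
    define x z where "x = real n" and "z = real k"
    have xz: "x \<ge> 0" "z \<ge> 0" "x > - 1" by (auto simp: x_def z_def)
    have incr: "dlog_shift n (Suc k) = dlog_shift n k + (3 / (x + z + 1) - 3 / (z + 1))"
        "dlog_shift (Suc n) k = dlog_shift n k + (3 / (x + z + 1) - 2 / (2 * x + 1))"
        "dlog_shift_dx n (Suc k) = dlog_shift_dx n k - 3 / (x + z + 1) ^ 2"
        "dlog_shift_dx (Suc n) k = dlog_shift_dx n k + (4 / (2 * x + 1) ^ 2 - 3 / (x + z + 1) ^ 2)"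
      unfolding dlog_shift_def dlog_shift_dx_def harm_increments x_def z_def by simp_all
    have eqs: "kern (real (Suc n)) k = kern x k * ratio_x x z" "real (Suc n) = x + 1" "real (Suc k) = z + 1"
        "2 * x + 3 * (z + 1) + 2 = 2 * x + 3 * z + 5"
      using kern_shift[of x k] xz by (auto simp: x_def z_def add.commute)
    note base = wz_base[OF xz(3,2)] and base_dx = wz_base_dx[OF xz(1,2)]
      and shift = wz_shift[OF xz(1,2), folded phi_def] and shift_dx = wz_shift_dx[OF xz(1,2), folded phi_def dphi_def]
    show "kern (real n) (Suc k) * A n (Suc k) - kern (real n) k * A n k =
        kern (real n) k * B n k - kern (real (Suc n)) k * B (Suc n) k"
      unfolding A_def B_def eqs(1) kern.simps kern_log_dx_increments incr x_def[symmetric] z_def[symmetric]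
      unfolding eqs(2-4)
      using base base_dx shift shift_dx by (rule second_order_combination)
  next
    fix n k :: nat
    let ?c = "cert (real n) (real k)" and ?s = "spread (real n) k" and ?r = "1 / sqrt (real n + 1)"
    have c: "?c \<ge> 0" by (intro less_imp_le[OF cert_pos]) auto
    have s: "?s \<ge> 0" by (rule spread_nonneg) simp
    have sq: "sqrt (real n + 1) \<ge> 1" "sqrt (real n + 1) * sqrt (real n + 1) = real n + 1" by auto
    have r: "?r \<ge> 0" "1 / (real n + 1) * sqrt (real n + 1) = ?r" "1 / (real n + 1) \<le> ?r"
    proof -
      show "?r \<ge> 0" by simp
      show "1 / (real n + 1) * sqrt (real n + 1) = ?r"
        using sq by (metis divide_divide_eq_left' nonzero_divide_eq_eq not_one_le_zero times_divide_eq_left mult_1)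
      have "sqrt (real n + 1) * 1 \<le> sqrt (real n + 1) * sqrt (real n + 1)"
        using sq(1) by (intro mult_left_mono) auto
      then show "1 / (real n + 1) \<le> ?r"
        using sq by (intro divide_left_mono) auto
    qed
    have sp: "\<bar>corr 3 shift_poly (real n) (real k)\<bar> \<le> 2 * ?c"
    proof -
      have "\<bar>corr (3 + 0) shift_poly (real n) (real k)\<bar> \<le> 2 / (real k + 1) * ?c"
        using shift_poly_le[of "real n" "real k"] by (intro corr_bounds shift_poly_nonneg) auto
      also have "\<dots> \<le> 2 * ?c"
        using c by (intro mult_right_mono) (auto simp: divide_le_eq)
      finally show ?thesis by simp
    qed
    have "\<bar>cert_dx (real n) (real k)\<bar> \<le> (4 * 1 + 4) / (real n + 1) * ?c"
      unfolding cert_dx_def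
      by (intro corr_dx_bounds cert_poly_dx_nonneg cert_poly_dx_le less_imp_le[OF cert_poly_pos]) auto
    then have cdx: "\<bar>cert_dx (real n) (real k)\<bar> \<le> 8 * (1 / (real n + 1)) * ?c" by simp
    have "\<bar>corr_dx shift_poly shift_poly_dx (real n) (real k)\<bar> \<le> (4 * 2 + 6) / (real n + 1) * ?c"
    proof (intro corr_dx_bounds shift_poly_dx_nonneg shift_poly_dx_le shift_poly_nonneg)
      have "1 * shift_poly (real n) (real k) \<le> (real k + 1) * shift_poly (real n) (real k)"
        by (intro mult_right_mono shift_poly_nonneg) auto
      then show "shift_poly (real n) (real k) \<le> 2 * cert_poly (real n) (real k)"
        using shift_poly_le[of "real n" "real k"] by simp
    qed auto
    then have sdx: "\<bar>corr_dx shift_poly shift_poly_dx (real n) (real k)\<bar> \<le> 14 * (1 / (real n + 1)) * ?c" by simp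
    have ldx: "\<bar>dlog_shift_dx n k\<bar> \<le> \<bar>half_harm 2 n - 3 * zeta_nat 2\<bar> + 3 * \<bar>gen_harm 2 n - zeta_nat 2\<bar>"
    proof -
      have "gen_harm 2 n \<le> gen_harm 2 (n + k)" "gen_harm 2 (n + k) \<le> zeta_nat 2"
        by (auto intro!: gen_harm_mono gen_harm_le_zeta)
      then have "\<bar>3 * (zeta_nat 2 - gen_harm 2 (n + k))\<bar> \<le> 3 * \<bar>gen_harm 2 n - zeta_nat 2\<bar>"
        by simp
      moreover have "dlog_shift_dx n k = (half_harm 2 n - 3 * zeta_nat 2) + 3 * (zeta_nat 2 - gen_harm 2 (n + k))"
        by (simp add: dlog_shift_dx_def)
      ultimately show ?thesis
        using abs_triangle_ineq[of "half_harm 2 n - 3 * zeta_nat 2" "3 * (zeta_nat 2 - gen_harm 2 (n + k))"]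
        by simp
    qed
    have h: "\<bar>kern_log_dx n k\<bar> \<le> 8 * (?s + 1) * (1 / (real n + 1))"
      using kern_log_dx_bound[of n k] by simp
    have "\<bar>kern_log_dx n k * (?c * dlog_shift n k - corr 3 shift_poly (real n) (real k))\<bar> \<le>
        8 * (?s + 1) * (1 / (real n + 1)) * (?c * (6 * sqrt (real n + 1)) + 2 * ?c)"
    proof -
      have "\<bar>?c * dlog_shift n k\<bar> \<le> ?c * (6 * sqrt (real n + 1))"
        using dlog_shift_bound[of n k] c by (simp add: abs_mult mult_left_mono)
      then have "\<bar>?c * dlog_shift n k - corr 3 shift_poly (real n) (real k)\<bar> \<le> ?c * (6 * sqrt (real n + 1)) + 2 * ?c"
        using sp by linarith
      then show ?thesis
        unfolding abs_mult[of "kern_log_dx n k"] using h by (intro mult_mono) (use s in auto)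
    qed
    also have "\<dots> = 8 * (?s + 1) * ?c * (6 * (1 / (real n + 1) * sqrt (real n + 1)) + 2 * (1 / (real n + 1)))"
      by (simp add: algebra_simps)
    also have "\<dots> \<le> 8 * (?s + 1) * ?c * (6 * ?r + 2 * ?r)"
      unfolding r(2) using s c r(3) by (intro mult_left_mono add_left_mono) auto
    finally have 1: "\<bar>kern_log_dx n k * (?c * dlog_shift n k - corr 3 shift_poly (real n) (real k))\<bar> \<le>
        (64 * ?r * ?s + 64 * ?r) * ?c"
      by (simp add: algebra_simps)
    have "\<bar>cert_dx (real n) (real k) * dlog_shift n k\<bar> \<le> 8 * (1 / (real n + 1)) * ?c * (6 * sqrt (real n + 1))"
      unfolding abs_mult using cdx dlog_shift_bound[of n k] c by (intro mult_mono) auto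
    also have "\<dots> = 48 * (1 / (real n + 1) * sqrt (real n + 1)) * ?c"
      by simp
    finally have 2: "\<bar>cert_dx (real n) (real k) * dlog_shift n k\<bar> \<le> 48 * ?r * ?c"
      unfolding r(2) .
    have 3: "\<bar>?c * dlog_shift_dx n k\<bar> \<le> (\<bar>half_harm 2 n - 3 * zeta_nat 2\<bar> + 3 * \<bar>gen_harm 2 n - zeta_nat 2\<bar>) * ?c"
      using mult_left_mono[OF ldx c] c by (simp add: abs_mult mult.commute)
    have 4: "\<bar>corr_dx shift_poly shift_poly_dx (real n) (real k)\<bar> \<le> 14 * ?r * ?c"
      using sdx mult_right_mono[OF r(3) c] by linarith
    have "\<bar>B n k\<bar> \<le> (64 * ?r * ?s + 64 * ?r) * ?c + 48 * ?r * ?c +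
        (\<bar>half_harm 2 n - 3 * zeta_nat 2\<bar> + 3 * \<bar>gen_harm 2 n - zeta_nat 2\<bar>) * ?c + 14 * ?r * ?c"
      unfolding B_def using 1 2 3 4 by linarith
    also have "\<dots> = (a n + 0 + 64 / sqrt (real n + 1) * ?s) * ?c"
      by (simp add: a_def algebra_simps)
    finally show "\<bar>B n k - 0 * ?c\<bar> \<le> (a n + 0 + 64 / sqrt (real n + 1) * ?s) * ?c"
      by simp
  next
    fix n
    have "poly_growth (kern_log_dx n)" "poly_growth (dlog_shift n)" "poly_growth (dlog_shift_dx n)"
      unfolding kern_log_dx_def dlog_shift_def dlog_shift_dx_def
      by (intro poly_growth_intros poly_growth_harm_arguments)+
    then have "poly_growth (A n)"
      unfolding A_def phi_def dphi_def by (intro poly_growth_intros poly_growth_divide) (auto simp: one_le_power)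
    then show "\<exists>C p. \<forall>k. \<bar>A n k\<bar> \<le> C * (real k + 1) ^ p"
      unfolding poly_growth_def .
  next
    have sq0: "(\<lambda>n. c / sqrt (real n + 1)) \<longlonglongrightarrow> 0" for c :: real
      by real_asymp
    show "(\<lambda>n. 64 / sqrt (real n + 1)) \<longlonglongrightarrow> 0" by (rule sq0)
    have "half_harm 2 \<longlonglongrightarrow> 3 * zeta_nat 2"
      using half_harm_LIMSEQ[of 2] by simp
    from tendsto_add[OF sq0[of 126] tendsto_add[OF null_gap[OF this] tendsto_mult[OF tendsto_const null_gap[OF gen_harm_LIMSEQ[of 2]], of 3]]]
    show "a \<longlonglongrightarrow> 0"
      by (simp add: a_def[abs_def])
  next
    show "(\<lambda>n. A n 0 / (real n + 1) ^ 3) sums (2 / 15 * pi ^ 4)"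
    proof -
      have term_eq: "A n 0 / (real n + 1) ^ 3 =
          2 * (half_harm 2 (n + 1) / (real n + 1) ^ 2 + 2 * half_harm 1 (n + 1) / (real n + 1) ^ 3)
          - (6 * dzeta_term 2 2 n + 12 * dzeta_term 3 1 n) - 3 * (1 / real (Suc n) ^ 4)" for n
      proof -
        have nz: "real n + 1 \<noteq> 0" "2 * real n + 1 \<noteq> 0" by linarith+
        have lv: "dlog_shift n 0 = 3 * gen_harm 1 n - half_harm 1 n" "dlog_shift_dx n 0 = half_harm 2 n - 3 * gen_harm 2 n"
            "kern_log_dx n 0 = - (3 / (real n + 1))" "real (Suc n) = real n + 1"
            "half_harm 1 (n + 1) = half_harm 1 n + 2 / (2 * real n + 1)"
            "half_harm 2 (n + 1) = half_harm 2 n + 4 / (2 * real n + 1) ^ 2"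
          using harm_increments(6)[of 1 n] harm_increments(6)[of 2 n]
          by (simp_all add: dlog_shift_def dlog_shift_dx_def kern_log_dx_def)
        show ?thesis
          unfolding A_def phi_def dphi_def lv dzeta_term_def using nz by (simp add: divide_simps) algebra
      qed
      have "(\<lambda>n. 2 * (half_harm 2 (n + 1) / (real n + 1) ^ 2 + 2 * half_harm 1 (n + 1) / (real n + 1) ^ 3)
          - (6 * dzeta_term 2 2 n + 12 * dzeta_term 3 1 n) - 3 * (1 / real (Suc n) ^ 4)) sums
          (2 * (pi ^ 4 / 8) - (6 * dzeta 2 2 + 12 * dzeta 3 1) - 3 * zeta_nat 4)"
        by (intro sums_add sums_diff sums_mult half_shuffle_22 dzeta_sums zeta_nat_sums) simp_all
      moreover have "2 * (pi ^ 4 / 8) - (6 * dzeta 2 2 + 12 * dzeta 3 1) - 3 * zeta_nat 4 = 2 / 15 * pi ^ 4"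
      proof -
        have "6 * dzeta 2 2 + 12 * dzeta 3 1 = 3 * (zeta_nat 2 * zeta_nat 2)"
          using euler_shuffle_22 by simp
        also have "\<dots> = pi ^ 4 / 12"
          by (simp add: zeta_2 power2_eq_square power4_eq_xxxx)
        finally show ?thesis by (simp add: zeta_4)
      qed
      ultimately show ?thesis
        unfolding term_eq by (simp only:)
    qed
  qed (auto simp: a_def)
  moreover have "B 0 k = cert 0 (real k) * (- 3 * gen_harm 2 k) - corr_dx shift_poly shift_poly_dx 0 (real k)" for k
    by (simp add: B_def dlog_shift_def dlog_shift_dx_def corr_def shift_poly_def)
  ultimately show ?thesis by simp
qed

section \<open>The three identities\<close>

lemma binom_weight_fact:
  "binom_weight k = fact (6 * k) * fact k ^ 9 / (fact (3 * k) * fact (2 * k) ^ 6 * ((6 * real k - 1) * real k ^ 3))"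
proof -
  have binom: "real ((3 * k) choose k) = fact (3 * k) / (fact k * fact (2 * k))"
      "real ((6 * k) choose (3 * k)) = fact (6 * k) / (fact (3 * k) * fact (3 * k))"
      "real ((2 * k) choose k) = fact (2 * k) / (fact k * fact k)"
    using binomial_fact[of k "3 * k", where 'a = real] binomial_fact[of "3 * k" "6 * k", where 'a = real]
      binomial_fact[of k "2 * k", where 'a = real] by (simp_all add: diff_mult_distrib[symmetric] mult_2)
  have "c / (a * b) * (d / (c * c)) / (e * (b / (a * a)) ^ 5) = d * a ^ 9 / (c * b ^ 6 * e)"
    if "a \<noteq> 0" "b \<noteq> 0" "c \<noteq> 0" for a b c d e :: real
    using that by (simp add: power_divide divide_simps) algebra
  then show ?thesis
    unfolding binom_weight_def binom by simp
qed

lemma binom_weight_Suc: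
  "binom_weight (Suc (Suc k)) = binom_weight (Suc k) *
     (3 * (6 * real k + 5) * (6 * real k + 7) * (real k + 1) ^ 3 / (8 * (2 * real k + 3) ^ 5))"
proof -
  define z where "z = real k"
  have z: "z \<ge> 0" by (simp add: z_def)
  have nz: "3 * z + 6 \<noteq> 0" "3 * z + 5 \<noteq> 0" "3 * z + 4 \<noteq> 0" "2 * z + 4 \<noteq> 0" "2 * z + 3 \<noteq> 0" "6 * z + 11 \<noteq> 0"
      "6 * z + 5 \<noteq> 0" "z + 2 \<noteq> 0" "z + 1 \<noteq> 0"
    using z by auto
  have facts: "(fact (6 * Suc (Suc k)) :: real) =
        (6 * z + 12) * (6 * z + 11) * (6 * z + 10) * (6 * z + 9) * (6 * z + 8) * (6 * z + 7) * fact (6 * Suc k)"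
      "(fact (3 * Suc (Suc k)) :: real) = (3 * z + 6) * (3 * z + 5) * (3 * z + 4) * fact (3 * Suc k)"
      "(fact (2 * Suc (Suc k)) :: real) = (2 * z + 4) * (2 * z + 3) * fact (2 * Suc k)"
      "(fact (Suc (Suc k)) :: real) = (z + 2) * fact (Suc k)"
  proof -
    have e: "6 * Suc (Suc k) = Suc (Suc (Suc (Suc (Suc (Suc (6 * Suc k))))))"
        "3 * Suc (Suc k) = Suc (Suc (Suc (3 * Suc k)))" "2 * Suc (Suc k) = Suc (Suc (2 * Suc k))"
      by simp_all
    show "(fact (6 * Suc (Suc k)) :: real) =
        (6 * z + 12) * (6 * z + 11) * (6 * z + 10) * (6 * z + 9) * (6 * z + 8) * (6 * z + 7) * fact (6 * Suc k)"
      unfolding e(1) fact_Suc[where 'a = real] mult.assoc[symmetric] by (simp add: z_def algebra_simps del: fact_Suc mult_Suc_right)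
    show "(fact (3 * Suc (Suc k)) :: real) = (3 * z + 6) * (3 * z + 5) * (3 * z + 4) * fact (3 * Suc k)"
      unfolding e(2) fact_Suc[where 'a = real] mult.assoc[symmetric] by (simp add: z_def algebra_simps del: fact_Suc mult_Suc_right)
    show "(fact (2 * Suc (Suc k)) :: real) = (2 * z + 4) * (2 * z + 3) * fact (2 * Suc k)"
      unfolding e(3) fact_Suc[where 'a = real] mult.assoc[symmetric] by (simp add: z_def algebra_simps del: fact_Suc mult_Suc_right)
    show "(fact (Suc (Suc k)) :: real) = (z + 2) * fact (Suc k)"
      by (simp only: fact_Suc[of "Suc k"]) (simp add: z_def add.commute del: fact_Suc)
  qed
  have reals: "real (Suc (Suc k)) = z + 2" "real (Suc k) = z + 1" "real k = z"
      "6 * (z + 2) - 1 = 6 * z + 11" "6 * (z + 1) - 1 = 6 * z + 5"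
    by (simp_all add: z_def)
  have main: "((6 * z + 12) * (6 * z + 11) * (6 * z + 10) * (6 * z + 9) * (6 * z + 8) * (6 * z + 7) * d) * ((z + 2) * a) ^ 9 /
        ((3 * z + 6) * (3 * z + 5) * (3 * z + 4) * c * ((2 * z + 4) * (2 * z + 3) * b) ^ 6 * ((6 * z + 11) * (z + 2) ^ 3)) =
      d * a ^ 9 / (c * b ^ 6 * ((6 * z + 5) * (z + 1) ^ 3)) *
        (3 * (6 * z + 5) * (6 * z + 7) * (z + 1) ^ 3 / (8 * (2 * z + 3) ^ 5))"
    if "b \<noteq> 0" "c \<noteq> 0" for a b c d :: real
  proof -
    have gen: "((2 * u) * g * (2 * v) * (3 * f) * (2 * w) * h * d) * (e * a) ^ 9 /
          (u * v * w * c * ((2 * e) * f * b) ^ 6 * (g * e ^ 3)) =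
        d * a ^ 9 / (c * b ^ 6 * (j * l ^ 3)) * (3 * j * h * l ^ 3 / (8 * f ^ 5))"
      if "u \<noteq> 0" "v \<noteq> 0" "w \<noteq> 0" "e \<noteq> 0" "f \<noteq> 0" "g \<noteq> 0" "j \<noteq> 0" "l \<noteq> 0" for u v w e f g h j l :: real
      using that \<open>b \<noteq> 0\<close> \<open>c \<noteq> 0\<close> by (simp add: power_mult_distrib divide_simps) algebra
    have lin: "6 * z + 12 = 2 * (3 * z + 6)" "6 * z + 10 = 2 * (3 * z + 5)" "6 * z + 8 = 2 * (3 * z + 4)"
        "6 * z + 9 = 3 * (2 * z + 3)" "2 * z + 4 = 2 * (z + 2)"
      by simp_all
    show ?thesis
      unfolding lin by (rule gen) (use nz in auto)
  qed
  show ?thesis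
    unfolding binom_weight_fact facts reals by (rule main) simp_all
qed

text \<open>
  Both sides have the same quotients of consecutive terms.
\<close>
lemma binom_weight_eq_kern: "binom_weight (Suc k) = 3 / 8 * kern 0 k / (2 * real k + 1) ^ 2"
proof (induction k)
  case 0
  show ?case
    by (simp add: binom_weight_fact fact_numeral)
next
  case (Suc k)
  define z where "z = real k"
  have nz: "2 * z + 1 \<noteq> 0" "2 * z + 2 \<noteq> 0" "2 * z + 3 \<noteq> 0" by (auto simp: z_def)
  have "3 / 8 * K / (2 * z + 1) ^ 2 * (3 * (6 * z + 5) * (6 * z + 7) * (z + 1) ^ 3 / (8 * (2 * z + 3) ^ 5)) =
      3 / 8 * (K * ratio_k 0 z) / (2 * z + 3) ^ 2" for K
  proof -
    have ratio: "ratio_k 0 z = 3 * (2 * z + 1) * (6 * z + 5) * (6 * z + 7) * (z + 1) ^ 6 /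
        ((2 * (z + 1)) ^ 3 * (2 * z + 3) ^ 3 * (2 * z + 1) ^ 3)"
      unfolding ratio_k_def by (rule arg_cong2[where f = "(/)"]) algebra+
    have gen: "3 / 8 * K / u ^ 2 * (3 * p * q * w ^ 3 / (8 * v ^ 5)) =
        3 / 8 * (K * (3 * u * p * q * w ^ 6 / ((2 * w) ^ 3 * v ^ 3 * u ^ 3))) / v ^ 2"
      if "u \<noteq> 0" "v \<noteq> 0" "w \<noteq> 0" for u v w p q :: real
      using that by (simp add: power_mult_distrib divide_simps) algebra
    show ?thesis
      unfolding ratio by (rule gen) (use nz in auto)
  qed
  moreover have "2 * real (Suc k) + 1 = 2 * z + 3" by (simp add: z_def)
  ultimately show ?case
    unfolding binom_weight_Suc Suc by (simp only: kern.simps z_def)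
qed

lemma gen_harm_odd: "gen_harm m (2 * k + 2) = gen_harm m (2 * k + 1) + 1 / (2 * real k + 2) ^ m"
  "gen_harm m (2 * k) = gen_harm m (2 * k + 1) - 1 / (2 * real k + 1) ^ m"
  by (simp_all add: add_ac)

theorem theorem1p17:
  shows "((\<lambda>i. let k = Suc i in
             binom_weight k *
               (2 * (74 * real k ^ 2 - 47 * real k + 8) * harm (2 * k - 1)
                - 34 * real k + 11))
          sums (36 * zeta_nat 3)) \<and>
         ((\<lambda>i. let k = Suc i in
             binom_weight k *
               ((74 * real k ^ 2 - 47 * real k + 8)
                  * (200 * gen_harm 2 (2 * k - 1) - 137 * gen_harm 2 (k - 1))
                - 168 / real k))
          sums (526 / 15 * pi ^ 4)) \<and>
         ((\<lambda>i. let k = Suc i in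
             binom_weight k *
               ((74 * real k ^ 2 - 47 * real k + 8)
                  * (7 * gen_harm 3 (2 * k - 1) - 3 * gen_harm 3 (k - 1))
                + (1228 * real k ^ 2 - 648 * real k + 81)
                    / (8 * real k ^ 2 * (2 * real k - 1))))
          sums (8 * pi ^ 2 * zeta_nat 3 + 60 * zeta_nat 5))"
proof (intro conjI)
  have nz: "2 * real i + 1 \<noteq> 0" "2 * real i + 2 \<noteq> 0" "real i + 1 \<noteq> 0" for i by linarith+
  have reals: "real (Suc i) = real i + 1" "2 * Suc i - 1 = 2 * i + 1" "Suc i - 1 = i" "2 * (real i + 1) - 1 = 2 * real i + 1" for i
    by simp_all
  have dlog_e1: "dlog_e1 0 i = 1 / (2 * real i + 2) + 2 / (2 * real i + 1) - gen_harm 1 (2 * i + 1)" for i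
  proof -
    have "dlog_e1 0 i = gen_harm 1 (2 * i + 2) - 2 * gen_harm 1 (2 * i)"
      by (simp add: dlog_e1_def half_harm_eq del: gen_harm_Suc half_harm_Suc)
    then show ?thesis unfolding gen_harm_odd by simp
  qed
  have "(\<lambda>i. - 6 * (kern 0 i * (cert 0 (real i) * dlog_e1 0 i - corr 4 e1_poly 0 (real i)))) sums (- 6 * (- 6 * zeta_nat 3))"
    by (intro sums_mult series_dlog_e1)
  also have "(\<lambda>i. - 6 * (kern 0 i * (cert 0 (real i) * dlog_e1 0 i - corr 4 e1_poly 0 (real i)))) =
      (\<lambda>i. let k = Suc i in binom_weight k * (2 * (74 * real k ^ 2 - 47 * real k + 8) * harm (2 * k - 1) - 34 * real k + 11))"
    unfolding Let_def reals binom_weight_eq_kern gen_harm_1[symmetric] dlog_e1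
  proof
    fix i
    show "- 6 * (kern 0 i * (cert 0 (real i) * (1 / (2 * real i + 2) + 2 / (2 * real i + 1) - gen_harm 1 (2 * i + 1)) - corr 4 e1_poly 0 (real i))) =
      3 / 8 * kern 0 i / (2 * real i + 1) ^ 2 * (2 * (74 * (real i + 1) ^ 2 - 47 * (real i + 1) + 8) * gen_harm 1 (2 * i + 1) - 34 * (real i + 1) + 11)"
      unfolding cert_def corr_def cert_poly_def e1_poly_def using nz[of i]
      by (simp add: divide_simps del: gen_harm_Suc) algebra
  qed
  finally show "(\<lambda>i. let k = Suc i in binom_weight k * (2 * (74 * real k ^ 2 - 47 * real k + 8) * harm (2 * k - 1) - 34 * real k + 11))
      sums (36 * zeta_nat 3)" by simp

  have dlog_e2: "dlog_e2 0 i = 3 * gen_harm 2 i - 5 * gen_harm 2 (2 * i + 1) - 1 / (2 * real i + 2) ^ 2 + 4 / (2 * real i + 1) ^ 2" for i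
  proof -
    have "dlog_e2 0 i = 3 * gen_harm 2 i - gen_harm 2 (2 * i + 2) - 4 * gen_harm 2 (2 * i)"
      by (simp add: dlog_e2_def half_harm_eq del: gen_harm_Suc half_harm_Suc)
    then show ?thesis unfolding gen_harm_odd by simp
  qed
  \<comment> \<open>The coefficients solve \<open>- 120 (3 H - 5 H') + 17 (- 3 H) = 3 (200 H' - 137 H)\<close>.\<close>
  have "(\<lambda>i. - 120 * (kern 0 i * (cert 0 (real i) * dlog_e2 0 i - corr 5 e2_poly 0 (real i))) +
      17 * (kern 0 i * (cert 0 (real i) * (- 3 * gen_harm 2 i) - corr_dx shift_poly shift_poly_dx 0 (real i)))) sums
      (- 120 * (- 14 / 45 * pi ^ 4) + 17 * (- 2 / 15 * pi ^ 4))"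
    by (intro sums_add sums_mult series_dlog_e2 series_shift)
  also have "(\<lambda>i. - 120 * (kern 0 i * (cert 0 (real i) * dlog_e2 0 i - corr 5 e2_poly 0 (real i))) +
      17 * (kern 0 i * (cert 0 (real i) * (- 3 * gen_harm 2 i) - corr_dx shift_poly shift_poly_dx 0 (real i)))) =
      (\<lambda>i. let k = Suc i in binom_weight k * ((74 * real k ^ 2 - 47 * real k + 8)
        * (200 * gen_harm 2 (2 * k - 1) - 137 * gen_harm 2 (k - 1)) - 168 / real k))"
    unfolding Let_def reals binom_weight_eq_kern dlog_e2
  proof
    fix i
    show "- 120 * (kern 0 i * (cert 0 (real i) * (3 * gen_harm 2 i - 5 * gen_harm 2 (2 * i + 1) - 1 / (2 * real i + 2) ^ 2 + 4 / (2 * real i + 1) ^ 2)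
        - corr 5 e2_poly 0 (real i))) +
      17 * (kern 0 i * (cert 0 (real i) * (- 3 * gen_harm 2 i) - corr_dx shift_poly shift_poly_dx 0 (real i))) =
      3 / 8 * kern 0 i / (2 * real i + 1) ^ 2 * ((74 * (real i + 1) ^ 2 - 47 * (real i + 1) + 8)
        * (200 * gen_harm 2 (2 * i + 1) - 137 * gen_harm 2 i) - 168 / (real i + 1))"
      unfolding cert_def corr_def corr_dx_def cert_poly_def e2_poly_def shift_poly_def shift_poly_dx_def using nz[of i]
      by (simp add: divide_simps del: gen_harm_Suc) algebra
  qed
  finally show "(\<lambda>i. let k = Suc i in binom_weight k * ((74 * real k ^ 2 - 47 * real k + 8)
        * (200 * gen_harm 2 (2 * k - 1) - 137 * gen_harm 2 (k - 1)) - 168 / real k)) sums (526 / 15 * pi ^ 4)"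
    by simp

  have dlog_e3: "dlog_e3 0 i = 3 * gen_harm 3 i - 7 * gen_harm 3 (2 * i + 1) + 1 / (2 * real i + 2) ^ 3 + 8 / (2 * real i + 1) ^ 3" for i
  proof -
    have "dlog_e3 0 i = 3 * gen_harm 3 i + gen_harm 3 (2 * i + 2) - 8 * gen_harm 3 (2 * i)"
      by (simp add: dlog_e3_def half_harm_eq del: gen_harm_Suc half_harm_Suc)
    then show ?thesis unfolding gen_harm_odd by simp
  qed
  have "(\<lambda>i. - 3 * (kern 0 i * (cert 0 (real i) * dlog_e3 0 i - corr 6 e3_poly 0 (real i)))) sums
      (- 3 * (- 8 / 3 * pi\<^sup>2 * zeta_nat 3 - 20 * zeta_nat 5))"
    by (intro sums_mult series_dlog_e3)
  also have "(\<lambda>i. - 3 * (kern 0 i * (cert 0 (real i) * dlog_e3 0 i - corr 6 e3_poly 0 (real i)))) =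
      (\<lambda>i. let k = Suc i in binom_weight k * ((74 * real k ^ 2 - 47 * real k + 8)
        * (7 * gen_harm 3 (2 * k - 1) - 3 * gen_harm 3 (k - 1))
        + (1228 * real k ^ 2 - 648 * real k + 81) / (8 * real k ^ 2 * (2 * real k - 1))))"
    unfolding Let_def reals binom_weight_eq_kern dlog_e3
  proof
    fix i
    show "- 3 * (kern 0 i * (cert 0 (real i) * (3 * gen_harm 3 i - 7 * gen_harm 3 (2 * i + 1) + 1 / (2 * real i + 2) ^ 3 + 8 / (2 * real i + 1) ^ 3)
        - corr 6 e3_poly 0 (real i))) =
      3 / 8 * kern 0 i / (2 * real i + 1) ^ 2 * ((74 * (real i + 1) ^ 2 - 47 * (real i + 1) + 8)
        * (7 * gen_harm 3 (2 * i + 1) - 3 * gen_harm 3 i)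
        + (1228 * (real i + 1) ^ 2 - 648 * (real i + 1) + 81) / (8 * (real i + 1) ^ 2 * (2 * real i + 1)))"
      unfolding cert_def corr_def cert_poly_def e3_poly_def using nz[of i]
      by (simp add: divide_simps del: gen_harm_Suc) algebra
  qed
  finally show "(\<lambda>i. let k = Suc i in binom_weight k * ((74 * real k ^ 2 - 47 * real k + 8)
        * (7 * gen_harm 3 (2 * k - 1) - 3 * gen_harm 3 (k - 1))
        + (1228 * real k ^ 2 - 648 * real k + 81) / (8 * real k ^ 2 * (2 * real k - 1)))) sums
      (8 * pi ^ 2 * zeta_nat 3 + 60 * zeta_nat 5)"
    by (simp add: algebra_simps)
qed

end
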